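(* Let $(u,\varphi,\psi)$ be a solution of the system $$\begin{cases}\rho u_{tt}=\mu u_{xx}+b\varphi_{x}+d\psi_{x},\\ \kappa_{1}\varphi_{tt}=\alpha\varphi_{xx}+\beta\psi_{xx}-bu_{x}-\alpha_{1}\varphi-\alpha_{3}\psi-\tau_{1}\varphi_{t}-\tau_{2}\psi_{t},\\ \kappa_{2}\psi_{tt}=\beta\varphi_{xx}+\gamma\psi_{xx}-du_{x}-\alpha_{3}\varphi-\alpha_{2}\psi-\tau_{3}\varphi_{t}-\tau_{4}\psi_{t}\end{cases}\quad\text{in }(0,\pi)\times(0,\infty),$$ with boundary conditions $u(0,t)=u(\pi,t)=\varphi_x(0,t)=\varphi_x(\pi,t)=\psi_x(0,t)=\psi_x(\pi,t)=0$ for $t\ge 0$, and initial data $(u,u_t,\varphi,\varphi_t,\psi,\psi_t)|_{t=0}=U_0\in\mathcal H$. Assume that $\chi_0=0$ and $\chi_1\neq 0$. Then there exist two positive constants $\lambda$ and $\xi$ such that the energy $E$ satisfies $$E(t)\le \lambda e^{-\xi t},\qquad \forall t\ge 0.$$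
   Context: Standing assumptions on the real coefficients: $\rho,\kappa_1,\kappa_2,\mu,\alpha,\gamma,\beta,\alpha_1,\alpha_2>0$; $b,d$ are not both zero; the symmetric matrix $$\begin{pmatrix}\mu&b&d&0&0\\ b&\alpha_1&\alpha_3&0&0\\ d&\alpha_3&\alpha_2&0&0\\ 0&0&0&\alpha&\beta\\ 0&0&0&\beta&\gamma\end{pmatrix}$$ is positive definite; $\tau_1>0$ and $4\tau_1\tau_4>(\tau_2+\tau_3)^2$. (The paper lists $\beta$ among the positive coefficients but also treats the case $\beta=0$; accordingly the positivity of $\beta$ is not to be used as a hypothesis: $\beta$ is any real number compatible with the positive definiteness above.) Energy space: $\mathcal H=H_0^1(0,\pi)\times L^2(0,\pi)\times H_*^1(0,\pi)\times L_*^2(0,\pi)\times H_*^1(0,\pi)\times L_*^2(0,\pi)$, where $L_*^2(0,\pi)=\{\phi\in L^2(0,\pi):\int_0^\pi\phi\,dx=0\}$ and $H_*^1(0,\pi)=\{\phi\in H^1(0,\pi):\int_0^\pi\phi\,dx=0\}$. Solutions are the weak (semigroup) solutions, with $(u,u_t,\varphi,\varphi_t,\psi,\psi_t)\in C([0,\infty);\mathcal H)$; in particular $\varphi$ and $\psi$ have zero mean over $(0,\pi)$. Energy: $$E(t)=\frac12\int_0^\pi\big[\rho u_t^2+\kappa_1\varphi_t^2+\kappa_2\psi_t^2+\mu u_x^2+\alpha\varphi_x^2+\gamma\psi_x^2+\alpha_1\varphi^2+\alpha_2\psi^2+2\beta\varphi_x\psi_x+2bu_x\varphi+2du_x\psi+2\alpha_3\varphi\psi\big]dx.$$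 Stability numbers: $$\chi_0=\Big(\frac{\mu\kappa_1}{\rho}-\alpha\Big)\Big(\frac{\mu\kappa_2}{\rho}-\gamma\Big)-\beta^2,\qquad \chi_1=d^2\Big(\frac{\mu\kappa_1}{\rho}-\alpha\Big)+b^2\Big(\frac{\mu\kappa_2}{\rho}-\gamma\Big)+2bd\beta.$$ *)

theory Defs
  imports "HOL-Analysis.Analysis"
begin

text \<open>
  The spatial domain is the interval from 0 to \<open>pi\<close>. Elements of the Lebesgue and Sobolev
  spaces are represented by functions on the whole real line, of which only the almost-everywhere class on the open interval matters.
\<close>

abbreviation I\<pi> :: "real measure" where
  "I\<pi> \<equiv> lebesgue_on {0<..<pi}"

definition L2 :: "(real \<Rightarrow> real) set" where
  "L2 = {f. f \<in> borel_measurable I\<pi> \<and> integrable I\<pi> (\<lambda>x. (f x)\<^sup>2)}"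

definition L2_star :: "(real \<Rightarrow> real) set" where
  "L2_star = {f \<in> L2. (LINT x|I\<pi>. f x) = 0}"

definition L2_norm :: "(real \<Rightarrow> real) \<Rightarrow> real" where
  "L2_norm f = sqrt (LINT x|I\<pi>. (f x)\<^sup>2)"

definition test_function :: "(real \<Rightarrow> real) \<Rightarrow> bool" where
  "test_function w \<longleftrightarrow>
     (\<forall>k x. (deriv ^^ k) w field_differentiable (at x)) \<and>
     (\<exists>K. compact K \<and> K \<subseteq> {0<..<pi} \<and> (\<forall>x. x \<notin> K \<longrightarrow> w x = 0))"

definition has_weak_deriv :: "(real \<Rightarrow> real) \<Rightarrow> (real \<Rightarrow> real) \<Rightarrow> bool" where
  "has_weak_deriv f g \<longleftrightarrow>
     (\<forall>w. test_function w \<longrightarrow>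
        (LINT x|I\<pi>. f x * deriv w x) = - (LINT x|I\<pi>. g x * w x))"

definition H1 :: "(real \<Rightarrow> real) set" where
  "H1 = {f \<in> L2. \<exists>g\<in>L2. has_weak_deriv f g}"

text \<open>
  The weak derivative is unique up to null sets, so the choice below does not affect any
  of the integrals in which it is used.
\<close>

definition wderiv :: "(real \<Rightarrow> real) \<Rightarrow> real \<Rightarrow> real" where
  "wderiv f = (SOME g. g \<in> L2 \<and> has_weak_deriv f g)"

definition H1_norm :: "(real \<Rightarrow> real) \<Rightarrow> real" where
  "H1_norm f = sqrt ((L2_norm f)\<^sup>2 + (L2_norm (wderiv f))\<^sup>2)"

definition H1_0 :: "(real \<Rightarrow> real) set" where
  "H1_0 = {f \<in> H1. \<forall>e>0. \<exists>w. test_function w \<and> H1_norm (\<lambda>x. f x - w x) < e}"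

definition H1_star :: "(real \<Rightarrow> real) set" where
  "H1_star = {f \<in> H1. (LINT x|I\<pi>. f x) = 0}"

text \<open>Components of a state: \<open>(u, u\<^sub>t, \<phi>, \<phi>\<^sub>t, \<psi>, \<psi>\<^sub>t)\<close>.\<close>

type_synonym state =
  "(real \<Rightarrow> real) \<times> (real \<Rightarrow> real) \<times> (real \<Rightarrow> real) \<times> (real \<Rightarrow> real) \<times> (real \<Rightarrow> real) \<times> (real \<Rightarrow> real)"

definition energy_space :: "state set" where
  "energy_space = H1_0 \<times> L2 \<times> H1_star \<times> L2_star \<times> H1_star \<times> L2_star"

text \<open>
  A function of time and space is written \<open>f t x\<close>. Limits in time are taken within the closed
  half line, hence one-sided at time 0.
\<close>

definition continuous_in_norm ::
  "((real \<Rightarrow> real) \<Rightarrow> real) \<Rightarrow> (real \<Rightarrow> real \<Rightarrow> real) \<Rightarrow> bool" where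
  "continuous_in_norm N f \<longleftrightarrow>
     (\<forall>t\<ge>0. ((\<lambda>s. N (\<lambda>x. f s x - f t x)) \<longlongrightarrow> 0) (at t within {0..}))"

definition has_L2_time_deriv ::
  "(real \<Rightarrow> real \<Rightarrow> real) \<Rightarrow> (real \<Rightarrow> real \<Rightarrow> real) \<Rightarrow> bool" where
  "has_L2_time_deriv f g \<longleftrightarrow>
     (\<forall>t\<ge>0. ((\<lambda>s. L2_norm (\<lambda>x. (f s x - f t x) / (s - t) - g t x)) \<longlongrightarrow> 0) (at t within {0..}))"


record coefficients =
  c_rho :: real
  c_kappa1 :: real
  c_kappa2 :: real
  c_mu :: real
  c_alpha :: real
  c_gamma :: real
  c_beta :: real
  c_b :: real
  c_d :: real
  c_alpha1 :: real
  c_alpha2 :: real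
  c_alpha3 :: real
  c_tau1 :: real
  c_tau2 :: real
  c_tau3 :: real
  c_tau4 :: real

definition positive_definite :: "real ^ 'n ^ 'n \<Rightarrow> bool" where
  "positive_definite A \<longleftrightarrow> transpose A = A \<and> (\<forall>x. x \<noteq> 0 \<longrightarrow> x \<bullet> (A *v x) > 0)"

definition coefficient_matrix :: "coefficients \<Rightarrow> real ^ 5 ^ 5" where
  "coefficient_matrix C = vector [
     vector [c_mu C, c_b C,      c_d C,      0,         0],
     vector [c_b C,  c_alpha1 C, c_alpha3 C, 0,         0],
     vector [c_d C,  c_alpha3 C, c_alpha2 C, 0,         0],
     vector [0,      0,          0,          c_alpha C, c_beta C],
     vector [0,      0,          0,          c_beta C,  c_gamma C]]"

definition admissible :: "coefficients \<Rightarrow> bool" where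
  "admissible C \<longleftrightarrow>
     c_rho C > 0 \<and> c_kappa1 C > 0 \<and> c_kappa2 C > 0 \<and> c_mu C > 0 \<and>
     c_alpha C > 0 \<and> c_gamma C > 0 \<and> c_alpha1 C > 0 \<and> c_alpha2 C > 0 \<and>
     \<not> (c_b C = 0 \<and> c_d C = 0) \<and>
     positive_definite (coefficient_matrix C) \<and>
     c_tau1 C > 0 \<and> 4 * c_tau1 C * c_tau4 C > (c_tau2 C + c_tau3 C)\<^sup>2"

definition chi0 :: "coefficients \<Rightarrow> real" where
  "chi0 C = (c_mu C * c_kappa1 C / c_rho C - c_alpha C) * (c_mu C * c_kappa2 C / c_rho C - c_gamma C)
     - (c_beta C)\<^sup>2"

definition chi1 :: "coefficients \<Rightarrow> real" where
  "chi1 C = (c_d C)\<^sup>2 * (c_mu C * c_kappa1 C / c_rho C - c_alpha C)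
     + (c_b C)\<^sup>2 * (c_mu C * c_kappa2 C / c_rho C - c_gamma C)
     + 2 * c_b C * c_d C * c_beta C"

definition energy :: "coefficients \<Rightarrow> state \<Rightarrow> real" where
  "energy C = (\<lambda>(u, u', \<phi>, \<phi>', \<psi>, \<psi>').
     1/2 * (LINT x|I\<pi>.
       c_rho C * (u' x)\<^sup>2 + c_kappa1 C * (\<phi>' x)\<^sup>2 + c_kappa2 C * (\<psi>' x)\<^sup>2
       + c_mu C * (wderiv u x)\<^sup>2 + c_alpha C * (wderiv \<phi> x)\<^sup>2 + c_gamma C * (wderiv \<psi> x)\<^sup>2
       + c_alpha1 C * (\<phi> x)\<^sup>2 + c_alpha2 C * (\<psi> x)\<^sup>2
       + 2 * c_beta C * wderiv \<phi> x * wderiv \<psi> x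
       + 2 * c_b C * wderiv u x * \<phi> x + 2 * c_d C * wderiv u x * \<psi> x
       + 2 * c_alpha3 C * \<phi> x * \<psi> x))"

text \<open>
  The Dirichlet condition on \<open>u\<close> is membership in \<open>H1_0\<close>. The Neumann conditions
  on \<open>\<phi>\<close> and \<open>\<psi>\<close> are the natural boundary conditions of the variational equations, whose test
  functions range over all of \<open>H1\<close> and are not required to vanish at the boundary.
  The functions \<open>u'\<close>, \<open>\<phi>'\<close>, \<open>\<psi>'\<close> are the time derivatives of \<open>u\<close>, \<open>\<phi>\<close>, \<open>\<psi>\<close>.
  Every orbit, for an initial state in the energy space, of the semigroup associated with the
  system is a weak solution in this sense.
\<close>

definition weak_solution ::
  "coefficients \<Rightarrow> state \<Rightarrow>
   (real \<Rightarrow> real \<Rightarrow> real) \<Rightarrow> (real \<Rightarrow> real \<Rightarrow> real) \<Rightarrow>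
   (real \<Rightarrow> real \<Rightarrow> real) \<Rightarrow> (real \<Rightarrow> real \<Rightarrow> real) \<Rightarrow>
   (real \<Rightarrow> real \<Rightarrow> real) \<Rightarrow> (real \<Rightarrow> real \<Rightarrow> real) \<Rightarrow> bool" where
  "weak_solution C U0 u u' \<phi> \<phi>' \<psi> \<psi>' \<longleftrightarrow>
     (\<forall>t\<ge>0. (u t, u' t, \<phi> t, \<phi>' t, \<psi> t, \<psi>' t) \<in> energy_space) \<and>
     continuous_in_norm H1_norm u \<and> continuous_in_norm L2_norm u' \<and>
     continuous_in_norm H1_norm \<phi> \<and> continuous_in_norm L2_norm \<phi>' \<and>
     continuous_in_norm H1_norm \<psi> \<and> continuous_in_norm L2_norm \<psi>' \<and>
     has_L2_time_deriv u u' \<and> has_L2_time_deriv \<phi> \<phi>' \<and> has_L2_time_deriv \<psi> \<psi>' \<and>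
     (\<forall>w\<in>H1_0. \<forall>t\<ge>0.
        ((\<lambda>s. LINT x|I\<pi>. c_rho C * u' s x * w x) has_real_derivative
          - (LINT x|I\<pi>. (c_mu C * wderiv (u t) x + c_b C * \<phi> t x + c_d C * \<psi> t x) * wderiv w x))
        (at t within {0..})) \<and>
     (\<forall>w\<in>H1. \<forall>t\<ge>0.
        ((\<lambda>s. LINT x|I\<pi>. c_kappa1 C * \<phi>' s x * w x) has_real_derivative
          - (LINT x|I\<pi>. (c_alpha C * wderiv (\<phi> t) x + c_beta C * wderiv (\<psi> t) x) * wderiv w x)
          - (LINT x|I\<pi>. (c_b C * wderiv (u t) x + c_alpha1 C * \<phi> t x + c_alpha3 C * \<psi> t x
                        + c_tau1 C * \<phi>' t x + c_tau2 C * \<psi>' t x) * w x))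
        (at t within {0..})) \<and>
     (\<forall>w\<in>H1. \<forall>t\<ge>0.
        ((\<lambda>s. LINT x|I\<pi>. c_kappa2 C * \<psi>' s x * w x) has_real_derivative
          - (LINT x|I\<pi>. (c_beta C * wderiv (\<phi> t) x + c_gamma C * wderiv (\<psi> t) x) * wderiv w x)
          - (LINT x|I\<pi>. (c_d C * wderiv (u t) x + c_alpha3 C * \<phi> t x + c_alpha2 C * \<psi> t x
                        + c_tau3 C * \<phi>' t x + c_tau4 C * \<psi>' t x) * w x))
        (at t within {0..})) \<and>
     (case U0 of (u0, u1, \<phi>0, \<phi>1, \<psi>0, \<psi>1) \<Rightarrow>
        (AE x in I\<pi>. u 0 x = u0 x \<and> u' 0 x = u1 x \<and> \<phi> 0 x = \<phi>0 x \<and> \<phi>' 0 x = \<phi>1 x \<and>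
                     \<psi> 0 x = \<psi>0 x \<and> \<psi>' 0 x = \<psi>1 x))"

end

theory Submission
  imports Defs
begin

text \<open>
  The boundary conditions allow all three unknowns to be expanded in Fourier modes: \<open>u\<close> in the
  sines and \<open>\<phi>\<close>, \<open>\<psi>\<close> in the cosines of \<open>n x\<close>. Testing the weak equations with these functions, for
  each \<open>n \<ge> 1\<close> the coefficients \<open>a\<close> of \<open>u\<close> and \<open>y = (p, q)\<close> of \<open>(\<phi>, \<psi>)\<close> satisfy an autonomous
  linear system of ordinary differential equations. With the vector \<open>B = (b, d)\<close> and the matrices
  \<open>K = diag (\<kappa>1, \<kappa>2)\<close>, \<open>A = ((\<alpha>, \<beta>), (\<beta>, \<gamma>))\<close>, \<open>R = ((\<alpha>1, \<alpha>3), (\<alpha>3, \<alpha>2))\<close>,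
  \<open>T = ((\<tau>1, \<tau>2), (\<tau>3, \<tau>4))\<close> it reads
  \<open>\<rho> a'' = - n (\<mu> n a + B \<bullet> y)\<close> and \<open>K y'' = - n\<^sup>2 A y - n a B - R y - T y'\<close>.
  By Parseval's identity (lemmas \<open>Parseval_cosines\<close> and \<open>Parseval_sines\<close>) the energy is controlled by
  the sum over \<open>n\<close> of the modal sizes
  \<open>(n a)\<^sup>2 + a'\<^sup>2 + n\<^sup>2 \<bar>y\<bar>\<^sup>2 + \<bar>y'\<bar>\<^sup>2\<close>, so it suffices that all modes decay exponentially with the same
  constants.

  The modal energy is dissipated only through \<open>y'\<close>. Exponential decay follows from a Lyapunov functional
  \<open>L\<close>, bounded by the modal size, with \<open>L' \<le> - c (size) + K \<bar>y'\<bar>\<^sup>2\<close>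
  (lemma \<open>lyapunov_exponential_decay\<close>); what matters is that its constants do not depend on \<open>n\<close>.

  This is where \<open>\<chi>\<^sub>0 = 0\<close> and \<open>\<chi>\<^sub>1 \<noteq> 0\<close> enter. A free oscillation of \<open>u\<close> has \<open>a'' = - n\<^sup>2 (\<mu> / \<rho>) a\<close>, and
  forces \<open>y\<close> through the matrix \<open>A - (\<mu> / \<rho>) K\<close>, whose determinant is \<open>\<chi>\<^sub>0\<close>. If this
  determinant vanishes, the adjugate matrix applied to \<open>B\<close> gives a vector \<open>k\<close> in the kernel, and
  \<open>B \<bullet> k = - \<chi>\<^sub>1\<close>. Hence the scalar \<open>z = k \<bullet> K y\<close> propagates with exactly the speed of \<open>u\<close> and is
  genuinely driven by it. In the derivative of \<open>n (a' z - a z')\<close> the terms of second order cancel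
  and \<open>n\<^sup>2 (B \<bullet> k) a\<^sup>2\<close> remains, which recovers the part \<open>(n a)\<^sup>2\<close> of the size up to terms in \<open>n\<^sup>2 \<bar>y\<bar>\<^sup>2\<close> and
  \<open>y'\<close>. The remaining parts are recovered from \<open>y \<bullet> K y'\<close> and \<open>\<rho> a a'\<close>
  (lemma \<open>high_frequency_lyapunov\<close>). The errors are of relative order \<open>1 / n\<close>, so this works for large \<open>n\<close>.
  The finitely many remaining modes are handled one by one, using that \<open>B \<noteq> 0\<close>: the force
  \<open>f = (n\<^sup>2 A + R) y + n a B\<close> equals \<open>- K y'' - T y'\<close> and is seen by \<open>f \<bullet> K y'\<close>, and the change of \<open>f\<close>
  in the direction \<open>B\<close> sees \<open>a'\<close> (lemma \<open>fixed_frequency_lyapunov\<close>).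

  Two analytic facts make the passage to modes possible. The sines belong to \<open>H1_0\<close> because they are limits of
  test functions (lemma \<open>sine_cutoff_approximation\<close>), and weak derivatives are unique, because the sine
  system is complete (lemma \<open>orthogonal_test_functions_imp_AE_0\<close>).
\<close>

section \<open>Square integrable functions on the interval\<close>

lemma sets_I\<pi> [simp, measurable]: "{0<..<pi} \<in> sets lebesgue"
  by simp

lemma space_I\<pi> [simp]: "space I\<pi> = {0<..<pi}"
  by (simp add: space_restrict_space)

lemma finite_measure_I\<pi>: "finite_measure I\<pi>"
  by (rule finite_measure_lebesgue_on) (simp add: bounded_set_imp_lmeasurable)

lemma integrable_bounded_I\<pi>:
  fixes f :: "real \<Rightarrow> real"
  assumes "f \<in> borel_measurable I\<pi>" "\<And>x. x \<in> {0<..<pi} \<Longrightarrow> \<bar>f x\<bar> \<le> B"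
  shows "integrable I\<pi> f"
  by (rule finite_measure.integrable_const_bound[OF finite_measure_I\<pi>, where B = B])
     (use assms in auto)

lemma bounded_in_L2:
  assumes "f \<in> borel_measurable I\<pi>" "\<And>x. x \<in> {0<..<pi} \<Longrightarrow> \<bar>f x\<bar> \<le> B"
  shows "f \<in> L2"
proof -
  have "integrable I\<pi> (\<lambda>x. (f x)\<^sup>2)"
  proof (rule integrable_bounded_I\<pi>[where B = "B\<^sup>2"])
    fix x assume "x \<in> {0<..<pi}"
    then have "\<bar>f x\<bar>\<^sup>2 \<le> B\<^sup>2" by (intro power_mono assms) auto
    then show "\<bar>(f x)\<^sup>2\<bar> \<le> B\<^sup>2" by simp
  qed (use assms in auto)
  then show ?thesis using assms by (simp add: L2_def)
qed

lemma continuous_measurable_I\<pi>: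
  "continuous_on {0..pi} f \<Longrightarrow> f \<in> borel_measurable I\<pi>" for f :: "real \<Rightarrow> real"
  by (rule continuous_imp_measurable_on_sets_lebesgue[OF continuous_on_subset]) auto

lemma continuous_in_L2:
  assumes "continuous_on {0..pi} f" shows "f \<in> L2"
proof -
  have "bounded (f ` {0..pi})"
    by (intro compact_imp_bounded compact_continuous_image assms) auto
  then obtain B where "\<forall>y\<in>f ` {0..pi}. norm y \<le> B" by (auto simp: bounded_iff)
  then show ?thesis
    by (intro bounded_in_L2[where B = B] continuous_measurable_I\<pi> assms) auto
qed

lemma L2_measurable: "f \<in> L2 \<Longrightarrow> f \<in> borel_measurable I\<pi>"
  by (simp add: L2_def)

lemma L2_square_integrable: "f \<in> L2 \<Longrightarrow> integrable I\<pi> (\<lambda>x. (f x)\<^sup>2)"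
  by (simp add: L2_def)

lemma L2_mult_integrable:
  assumes "f \<in> L2" "g \<in> L2" shows "integrable I\<pi> (\<lambda>x. f x * g x)"
proof (rule Bochner_Integration.integrable_bound)
  show "integrable I\<pi> (\<lambda>x. (f x)\<^sup>2 + (g x)\<^sup>2)"
    using assms by (intro Bochner_Integration.integrable_add L2_square_integrable)
  show "(\<lambda>x. f x * g x) \<in> borel_measurable I\<pi>"
    using assms[THEN L2_measurable] by simp
  have "\<bar>a * b\<bar> \<le> a\<^sup>2 + b\<^sup>2" for a b :: real
  proof -
    have "2 * \<bar>a\<bar> * \<bar>b\<bar> \<le> a\<^sup>2 + b\<^sup>2"
      using sum_squares_bound[of "\<bar>a\<bar>" "\<bar>b\<bar>"] by simp
    moreover have "0 \<le> \<bar>a\<bar> * \<bar>b\<bar>" by simp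
    ultimately show ?thesis unfolding abs_mult by linarith
  qed
  then show "AE x in I\<pi>. norm (f x * g x) \<le> norm ((f x)\<^sup>2 + (g x)\<^sup>2)" by simp
qed

lemma L2_const [simp]: "(\<lambda>x. c) \<in> L2"
  by (rule continuous_in_L2) simp

lemma L2_integrable: "f \<in> L2 \<Longrightarrow> integrable I\<pi> f"
  using L2_mult_integrable[of f "\<lambda>x. 1"] by simp

lemma L2_cmult: "f \<in> L2 \<Longrightarrow> (\<lambda>x. c * f x) \<in> L2"
  by (auto simp: L2_def power_mult_distrib)

lemma L2_add:
  assumes "f \<in> L2" "g \<in> L2" shows "(\<lambda>x. f x + g x) \<in> L2"
proof -
  have "integrable I\<pi> (\<lambda>x. (f x)\<^sup>2 + (g x)\<^sup>2 + 2 * (f x * g x))"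
    using assms by (intro Bochner_Integration.integrable_add integrable_mult_right
        L2_square_integrable L2_mult_integrable)
  then have "integrable I\<pi> (\<lambda>x. (f x + g x)\<^sup>2)" by (simp add: power2_sum algebra_simps)
  then show ?thesis using assms by (auto simp: L2_def)
qed

lemma L2_diff: "f \<in> L2 \<Longrightarrow> g \<in> L2 \<Longrightarrow> (\<lambda>x. f x - g x) \<in> L2"
  using L2_add[of f "\<lambda>x. (-1) * g x"] L2_cmult[of g "-1"] by simp

lemma L2_divide: "f \<in> L2 \<Longrightarrow> (\<lambda>x. f x / c) \<in> L2"
  using L2_cmult[of f "1/c"] by simp

lemma L2_sum: "(\<And>i. i \<in> A \<Longrightarrow> f i \<in> L2) \<Longrightarrow> (\<lambda>x. \<Sum>i\<in>A. f i x) \<in> L2"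
  by (induction A rule: infinite_finite_induct) (auto intro: L2_add)

lemma L2_norm_nonneg [simp]: "0 \<le> L2_norm f"
  by (simp add: L2_norm_def)

lemma L2_norm_power2: "(L2_norm f)\<^sup>2 = (LINT x|I\<pi>. (f x)\<^sup>2)"
  by (simp add: L2_norm_def)

lemma L2_norm_cong_AE:
  assumes "f \<in> L2" "g \<in> L2" "AE x in I\<pi>. f x = g x" shows "L2_norm f = L2_norm g"
  unfolding L2_norm_def using assms
  by (intro arg_cong[where f = sqrt] integral_cong_AE) (auto simp: L2_def)

text \<open>The discriminant argument: the quadratic polynomial \<open>\<parallel>f + t g\<parallel>\<^sup>2\<close> in \<open>t\<close> is nowhere negative.\<close>

lemma L2_Cauchy_Schwarz:
  assumes "f \<in> L2" "g \<in> L2"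
  shows "\<bar>LINT x|I\<pi>. f x * g x\<bar> \<le> L2_norm f * L2_norm g"
proof -
  define a b c where "a = (LINT x|I\<pi>. (g x)\<^sup>2)" and "b = (LINT x|I\<pi>. f x * g x)"
    and "c = (LINT x|I\<pi>. (f x)\<^sup>2)"
  have q: "0 \<le> a * t\<^sup>2 + b * t * 2 + c" for t
  proof -
    have "0 \<le> (LINT x|I\<pi>. (f x + t * g x)\<^sup>2)" by simp
    also have "\<dots> = (LINT x|I\<pi>. (f x)\<^sup>2 + t\<^sup>2 * (g x)\<^sup>2 + 2 * t * (f x * g x))"
      by (simp add: power2_sum power_mult_distrib algebra_simps)
    also have "\<dots> = c + t\<^sup>2 * a + 2 * t * b"
      using assms by (simp add: a_def b_def c_def L2_square_integrable L2_mult_integrable)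
    finally show ?thesis by (simp add: algebra_simps)
  qed
  have "b\<^sup>2 \<le> a * c"
  proof (cases "a = 0")
    case True
    have "b = 0"
    proof (rule ccontr)
      assume "b \<noteq> 0"
      \<comment> \<open>If \<open>\<parallel>g\<parallel> = 0\<close> the polynomial is affine; this \<open>t\<close> would give it the value \<open>- 1\<close>.\<close>
      then show False using q[of "- (c + 1) / (2 * b)"] True by (simp add: field_simps)
    qed
    then show ?thesis using True by simp
  next
    case False
    then have "a > 0" using q[of 0] by (simp add: a_def order_less_le)
    moreover have "0 \<le> (c * a - b\<^sup>2) / a" 
      using q[of "- b / a"] False by (simp add: field_simps power2_eq_square)
    ultimately show ?thesis by (simp add: field_simps zero_le_divide_iff)
  qed
  then have "sqrt (b\<^sup>2) \<le> sqrt (c * a)" by (subst mult.commute) (rule real_sqrt_le_mono)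
  then show ?thesis by (simp add: a_def b_def c_def L2_norm_def real_sqrt_mult[symmetric])
qed

lemma L2_norm_dominated_convergence:
  assumes "\<And>k. f k \<in> borel_measurable I\<pi>" "g \<in> L2" "h \<in> L2"
    and "\<And>k x. x \<in> {0<..<pi} \<Longrightarrow> \<bar>f k x\<bar> \<le> h x"
    and "AE x in I\<pi>. (\<lambda>k. f k x) \<longlonglongrightarrow> g x"
  shows "(\<lambda>k. L2_norm (\<lambda>x. f k x - g x)) \<longlonglongrightarrow> 0"
proof -
  have gm: "g \<in> borel_measurable I\<pi>" and hm: "h \<in> borel_measurable I\<pi>"
    using assms(2,3) by (simp_all add: L2_def)
  have lim: "(\<lambda>k. LINT x|I\<pi>. (f k x - g x)\<^sup>2) \<longlonglongrightarrow> (LINT x|I\<pi>. 0)"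
  proof (rule integral_dominated_convergence[where w = "\<lambda>x. (\<bar>h x\<bar> + \<bar>g x\<bar>)\<^sup>2"])
    have "(\<lambda>x. \<bar>h x\<bar> + \<bar>g x\<bar>) \<in> L2"
      using assms(2,3) by (intro L2_add) (auto simp: L2_def)
    then show "integrable I\<pi> (\<lambda>x. (\<bar>h x\<bar> + \<bar>g x\<bar>)\<^sup>2)" by (rule L2_square_integrable)
    show "AE x in I\<pi>. (\<lambda>k. (f k x - g x)\<^sup>2) \<longlonglongrightarrow> 0"
      using assms(5) by eventually_elim (auto intro!: tendsto_eq_intros)
    fix k
    show "AE x in I\<pi>. norm ((f k x - g x)\<^sup>2) \<le> (\<bar>h x\<bar> + \<bar>g x\<bar>)\<^sup>2"
    proof (rule AE_I2)
      fix x assume "x \<in> space I\<pi>"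
      then have "\<bar>f k x - g x\<bar> \<le> \<bar>h x\<bar> + \<bar>g x\<bar>" using assms(4)[of x k] by simp
      then have "\<bar>f k x - g x\<bar>\<^sup>2 \<le> (\<bar>h x\<bar> + \<bar>g x\<bar>)\<^sup>2" by (rule power_mono) simp
      then show "norm ((f k x - g x)\<^sup>2) \<le> (\<bar>h x\<bar> + \<bar>g x\<bar>)\<^sup>2" by simp
    qed
  qed (use assms gm in auto)
  have "(\<lambda>k. sqrt (LINT x|I\<pi>. (f k x - g x)\<^sup>2)) \<longlonglongrightarrow> sqrt 0"
    using lim by (intro tendsto_real_sqrt) simp
  then show ?thesis by (simp add: L2_norm_def)
qed

lemma L2_norm_tendsto_integral:
  assumes "\<And>k. f k \<in> L2" "g \<in> L2" "e \<in> L2"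
    and "(\<lambda>k. L2_norm (\<lambda>x. f k x - g x)) \<longlonglongrightarrow> 0"
  shows "(\<lambda>k. LINT x|I\<pi>. f k x * e x) \<longlonglongrightarrow> (LINT x|I\<pi>. g x * e x)"
proof (rule LIM_zero_cancel, rule Lim_null_comparison)
  show "\<forall>\<^sub>F k in sequentially. norm ((LINT x|I\<pi>. f k x * e x) - (LINT x|I\<pi>. g x * e x))
      \<le> L2_norm (\<lambda>x. f k x - g x) * L2_norm e"
  proof (rule always_eventually, rule allI)
    fix k
    have "(LINT x|I\<pi>. f k x * e x) - (LINT x|I\<pi>. g x * e x) = (LINT x|I\<pi>. (f k x - g x) * e x)"
      using assms by (simp add: left_diff_distrib L2_mult_integrable)
    then show "norm ((LINT x|I\<pi>. f k x * e x) - (LINT x|I\<pi>. g x * e x))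
      \<le> L2_norm (\<lambda>x. f k x - g x) * L2_norm e"
      using L2_Cauchy_Schwarz[OF L2_diff[OF assms(1)[of k] assms(2)] assms(3)] by simp
  qed
  show "(\<lambda>k. L2_norm (\<lambda>x. f k x - g x) * L2_norm e) \<longlonglongrightarrow> 0"
    using tendsto_mult_right[OF assms(4), of "L2_norm e"] by simp
qed

lemma integral_deriv_I\<pi>:
  fixes F f :: "real \<Rightarrow> real"
  assumes "\<And>x. x \<in> {0..pi} \<Longrightarrow> (F has_real_derivative f x) (at x)" "continuous_on {0..pi} f"
  shows "(LINT x|I\<pi>. f x) = F pi - F 0"
proof -
  have "(f has_integral F pi - F 0) {0..pi}"
    using assms(1) by (intro fundamental_theorem_of_calculus)
      (auto simp: has_real_derivative_iff_has_vector_derivative intro: has_vector_derivative_at_within)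
  then have "integral {0<..<pi} f = F pi - F 0"
    by (simp add: integral_open_interval_real[symmetric] integral_unique)
  moreover have "(LINT x|I\<pi>. f x) = integral {0<..<pi} f"
    by (rule lebesgue_integral_eq_integral) (auto intro: L2_integrable continuous_in_L2 assms)
  ultimately show ?thesis by simp
qed

section \<open>Completeness of the sine and cosine systems\<close>

lemma L2_triangle:
  assumes "f \<in> L2" "g \<in> L2"
  shows "L2_norm (\<lambda>x. f x + g x) \<le> L2_norm f + L2_norm g"
proof (rule power2_le_imp_le)
  have "(L2_norm (\<lambda>x. f x + g x))\<^sup>2 = (LINT x|I\<pi>. (f x)\<^sup>2 + (g x)\<^sup>2 + 2 * (f x * g x))"
    by (simp add: L2_norm_power2 power2_sum mult_ac)
  also have "\<dots> = (L2_norm f)\<^sup>2 + (L2_norm g)\<^sup>2 + 2 * (LINT x|I\<pi>. f x * g x)"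
    using assms by (simp add: L2_norm_power2 L2_square_integrable L2_mult_integrable)
  also have "\<dots> \<le> (L2_norm f + L2_norm g)\<^sup>2"
    using L2_Cauchy_Schwarz[OF assms] by (simp add: power2_sum)
  finally show "(L2_norm (\<lambda>x. f x + g x))\<^sup>2 \<le> (L2_norm f + L2_norm g)\<^sup>2" .
qed (simp add: add_nonneg_nonneg)

lemma L2_triangle3:
  assumes "f \<in> L2" "g \<in> L2" "h \<in> L2"
  shows "L2_norm (\<lambda>x. f x - h x) \<le> L2_norm (\<lambda>x. f x - g x) + L2_norm (\<lambda>x. g x - h x)"
  using L2_triangle[OF L2_diff[OF assms(1,2)] L2_diff[OF assms(2,3)]] by simp

lemma L2_norm_le_sup:
  assumes "f \<in> L2" "\<And>x. x \<in> {0<..<pi} \<Longrightarrow> \<bar>f x\<bar> \<le> B" "B \<ge> 0"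
  shows "L2_norm f \<le> B * sqrt pi"
proof -
  have "(LINT x|I\<pi>. (f x)\<^sup>2) \<le> (LINT x|I\<pi>. B\<^sup>2)"
  proof (rule integral_mono)
    fix x assume "x \<in> space I\<pi>"
    then have "\<bar>f x\<bar>\<^sup>2 \<le> B\<^sup>2" by (intro power_mono assms) auto
    then show "(f x)\<^sup>2 \<le> B\<^sup>2" by simp
  qed (use assms L2_square_integrable L2_integrable[OF L2_const[of "B\<^sup>2"]] in auto)
  also have "\<dots> = B\<^sup>2 * pi"
    using integral_deriv_I\<pi>[of "\<lambda>x. B\<^sup>2 * x" "\<lambda>x. B\<^sup>2"]
    by (auto intro!: derivative_eq_intros)
  finally have "sqrt (LINT x|I\<pi>. (f x)\<^sup>2) \<le> sqrt (B\<^sup>2 * pi)" by (rule real_sqrt_le_mono)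
  then show ?thesis using assms(3) by (simp add: L2_norm_def real_sqrt_mult)
qed

definition finite_comb :: "(nat \<Rightarrow> real \<Rightarrow> real) \<Rightarrow> (real \<Rightarrow> real) \<Rightarrow> bool" where
  "finite_comb e f \<longleftrightarrow> (\<exists>N c. f = (\<lambda>x. \<Sum>n<N. c n * e n x))"

lemma finite_comb_zero: "finite_comb e (\<lambda>x. 0)"
  unfolding finite_comb_def by (rule exI[of _ 0]) auto

lemma finite_comb_basis: "finite_comb e (e n)"
proof -
  have "e n = (\<lambda>x. \<Sum>k<Suc n. (if k = n then 1 else 0) * e k x)" by (rule ext) simp
  then show ?thesis unfolding finite_comb_def
    by (intro exI[of _ "Suc n"] exI[of _ "\<lambda>k. if k = n then 1 else 0"])
qed

lemma finite_comb_cmult: "finite_comb e f \<Longrightarrow> finite_comb e (\<lambda>x. k * f x)"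
proof -
  assume "finite_comb e f"
  then obtain N c where "f = (\<lambda>x. \<Sum>n<N. c n * e n x)" by (auto simp: finite_comb_def)
  then have "(\<lambda>x. k * f x) = (\<lambda>x. \<Sum>n<N. (k * c n) * e n x)" by (simp add: sum_distrib_left mult.assoc)
  then show ?thesis unfolding finite_comb_def by (intro exI[of _ N] exI[of _ "\<lambda>n. k * c n"])
qed

lemma finite_comb_add:
  assumes "finite_comb e f" "finite_comb e g" shows "finite_comb e (\<lambda>x. f x + g x)"
proof -
  obtain N c M d where f: "f = (\<lambda>x. \<Sum>n<N. c n * e n x)" and g: "g = (\<lambda>x. \<Sum>n<M. d n * e n x)"
    using assms by (auto simp: finite_comb_def)
  have pad: "(\<Sum>n<N. c n * e n x) = (\<Sum>n<K. (if n < N then c n else 0) * e n x)" if "N \<le> K" for N K c x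
    using that by (intro sum.mono_neutral_cong_left) auto
  have "(\<lambda>x. f x + g x) = (\<lambda>x. \<Sum>n<max N M. ((if n < N then c n else 0) + (if n < M then d n else 0)) * e n x)"
    unfolding f g by (subst pad[of N "max N M"], simp, subst pad[of M "max N M"], simp)
      (simp add: sum.distrib distrib_right)
  then show ?thesis unfolding finite_comb_def
    by (intro exI[of _ "max N M"] exI[of _ "\<lambda>n. (if n < N then c n else 0) + (if n < M then d n else 0)"])
qed

lemma finite_comb_sum:
  "finite A \<Longrightarrow> (\<And>i. i \<in> A \<Longrightarrow> finite_comb e (f i)) \<Longrightarrow> finite_comb e (\<lambda>x. \<Sum>i\<in>A. f i x)"
  by (induction A rule: finite_induct) (auto intro: finite_comb_zero finite_comb_add)

lemma finite_comb_mult_left: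
  assumes "\<And>n. finite_comb e (\<lambda>x. h x * e' n x)" "finite_comb e' f"
  shows "finite_comb e (\<lambda>x. h x * f x)"
proof -
  obtain N c where "f = (\<lambda>x. \<Sum>n<N. c n * e' n x)" using assms(2) by (auto simp: finite_comb_def)
  then have "(\<lambda>x. h x * f x) = (\<lambda>x. \<Sum>n<N. c n * (h x * e' n x))"
    by (simp add: sum_distrib_left mult_ac)
  moreover have "finite_comb e (\<lambda>x. \<Sum>n<N. c n * (h x * e' n x))"
    by (intro finite_comb_sum finite_comb_cmult assms(1)) auto
  ultimately show ?thesis by simp
qed

lemma finite_comb_in_L2:
  assumes "\<And>n. e n \<in> L2" "finite_comb e f" shows "f \<in> L2"
  using assms by (auto simp: finite_comb_def intro!: L2_sum L2_cmult)

text \<open>Density of the finite combinations is the form in which polynomial approximation delivers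
  completeness.\<close>

definition complete_system :: "(nat \<Rightarrow> real \<Rightarrow> real) \<Rightarrow> bool" where
  "complete_system e \<longleftrightarrow> (\<forall>f\<in>L2. \<forall>\<epsilon>>0. \<exists>g. finite_comb e g \<and> L2_norm (\<lambda>x. f x - g x) < \<epsilon>)"

text \<open>Write \<open>F n\<close> for the coefficients of \<open>f\<close>. Completing the square, a combination \<open>g\<close> with coefficients
  \<open>c n\<close> has \<open>\<parallel>f - g\<parallel>\<^sup>2 = \<parallel>f\<parallel>\<^sup>2 - (\<Sum>n. (F n)\<^sup>2 / \<nu> n) + (\<Sum>n. \<nu> n * (c n - F n / \<nu> n)\<^sup>2)\<close>. The choice
  \<open>c n = F n / \<nu> n\<close> gives Bessel's inequality, and a \<open>g\<close> close to \<open>f\<close> gives the converse up to an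
  arbitrarily small error.\<close>

lemma Parseval:
  assumes e: "\<And>n. e n \<in> L2" and orth: "\<And>m n. (LINT x|I\<pi>. e m x * e n x) = (if m = n then \<nu> n else 0)"
    and \<nu>: "\<And>n. \<nu> n > 0" and compl: "complete_system e" and f: "f \<in> L2"
  shows "(\<lambda>n. (LINT x|I\<pi>. f x * e n x)\<^sup>2 / \<nu> n) sums (L2_norm f)\<^sup>2"
proof -
  define F where "F n = (LINT x|I\<pi>. f x * e n x)" for n
  have lin: "(LINT x|I\<pi>. h x * (\<Sum>n<N. c n * e n x)) = (\<Sum>n<N. c n * (LINT x|I\<pi>. h x * e n x))"
    if "h \<in> L2" for h c and N :: nat
  proof -
    have "(LINT x|I\<pi>. h x * (\<Sum>n<N. c n * e n x)) = (LINT x|I\<pi>. (\<Sum>n<N. c n * (h x * e n x)))"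
      by (simp add: sum_distrib_left mult_ac)
    also have "\<dots> = (\<Sum>n<N. (LINT x|I\<pi>. c n * (h x * e n x)))"
      using that e by (intro Bochner_Integration.integral_sum integrable_mult_right L2_mult_integrable)
    finally show ?thesis by simp
  qed
  have dist: "(L2_norm (\<lambda>x. f x - (\<Sum>n<N. c n * e n x)))\<^sup>2
      = (L2_norm f)\<^sup>2 - (\<Sum>n<N. (F n)\<^sup>2 / \<nu> n) + (\<Sum>n<N. \<nu> n * (c n - F n / \<nu> n)\<^sup>2)" for N c
  proof -
    define g where "g = (\<lambda>x. \<Sum>n<N. c n * e n x)"
    have g: "g \<in> L2" unfolding g_def by (intro L2_sum L2_cmult e)
    have ge: "(LINT x|I\<pi>. g x * e n x) = c n * \<nu> n" if "n < N" for n
    proof -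
      have "(LINT x|I\<pi>. g x * e n x) = (LINT x|I\<pi>. e n x * (\<Sum>k<N. c k * e k x))"
        by (simp add: g_def mult.commute)
      also have "\<dots> = (\<Sum>k<N. c k * (if n = k then \<nu> k else 0))"
        unfolding lin[OF e] orth ..
      also have "\<dots> = c n * \<nu> n" using that by (simp add: if_distrib[of "\<lambda>y. c _ * y"] cong: if_cong)
      finally show ?thesis .
    qed
    have "(LINT x|I\<pi>. g x * g x) = (\<Sum>n<N. c n * (LINT x|I\<pi>. g x * e n x))"
      using lin[OF g, where c = c and N = N] by (simp add: g_def)
    also have "\<dots> = (\<Sum>n<N. (c n)\<^sup>2 * \<nu> n)"
      by (rule sum.cong) (simp_all add: ge power2_eq_square)
    finally have gg: "(LINT x|I\<pi>. (g x)\<^sup>2) = (\<Sum>n<N. (c n)\<^sup>2 * \<nu> n)" by (simp add: power2_eq_square)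
    have fg: "(LINT x|I\<pi>. f x * g x) = (\<Sum>n<N. c n * F n)"
      unfolding g_def lin[OF f] F_def ..
    have "(L2_norm (\<lambda>x. f x - g x))\<^sup>2 = (LINT x|I\<pi>. (f x)\<^sup>2 + (g x)\<^sup>2 - 2 * (f x * g x))"
      by (simp add: L2_norm_power2 power2_diff mult_ac)
    also have "\<dots> = (L2_norm f)\<^sup>2 + (\<Sum>n<N. (c n)\<^sup>2 * \<nu> n) - 2 * (\<Sum>n<N. c n * F n)"
      using f g by (simp add: L2_norm_power2 L2_square_integrable L2_mult_integrable gg fg)
    also have "\<dots> = (L2_norm f)\<^sup>2 + (\<Sum>n<N. (c n)\<^sup>2 * \<nu> n - 2 * (c n * F n))"
      by (simp add: sum_subtractf sum_distrib_left)
    also have "(\<Sum>n<N. (c n)\<^sup>2 * \<nu> n - 2 * (c n * F n))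
        = (\<Sum>n<N. \<nu> n * (c n - F n / \<nu> n)\<^sup>2 - (F n)\<^sup>2 / \<nu> n)"
    proof (rule sum.cong)
      fix n
      show "(c n)\<^sup>2 * \<nu> n - 2 * (c n * F n) = \<nu> n * (c n - F n / \<nu> n)\<^sup>2 - (F n)\<^sup>2 / \<nu> n"
        using \<nu>[of n] by (simp add: field_simps power2_eq_square)
    qed simp
    finally show ?thesis by (simp add: g_def sum_subtractf)
  qed
  have bessel: "(\<Sum>n<N. (F n)\<^sup>2 / \<nu> n) \<le> (L2_norm f)\<^sup>2" for N
  proof -
    have "0 \<le> (L2_norm (\<lambda>x. f x - (\<Sum>n<N. F n / \<nu> n * e n x)))\<^sup>2" by simp
    then show ?thesis unfolding dist by simp
  qed
  have terms: "0 \<le> (F n)\<^sup>2 / \<nu> n" for n using \<nu>[of n] by simp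
  have "(\<lambda>n. (F n)\<^sup>2 / \<nu> n) sums (L2_norm f)\<^sup>2"
    unfolding sums_def
  proof (rule LIMSEQ_I)
    fix r :: real assume "0 < r"
    then obtain g where g: "finite_comb e g" "L2_norm (\<lambda>x. f x - g x) < sqrt r"
      using compl f unfolding complete_system_def by (meson real_sqrt_gt_zero)
    then obtain N c where N: "g = (\<lambda>x. \<Sum>n<N. c n * e n x)" by (auto simp: finite_comb_def)
    have "(L2_norm (\<lambda>x. f x - g x))\<^sup>2 < (sqrt r)\<^sup>2"
      using g(2) by (intro power_strict_mono) auto
    moreover have "0 \<le> (\<Sum>n<N. \<nu> n * (c n - F n / \<nu> n)\<^sup>2)"
      using \<nu> by (intro sum_nonneg mult_nonneg_nonneg) (auto simp: less_imp_le)
    ultimately have close: "(L2_norm f)\<^sup>2 - (\<Sum>n<N. (F n)\<^sup>2 / \<nu> n) < r"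
      using dist[where N = N and c = c] \<open>0 < r\<close> unfolding N by simp
    show "\<exists>no. \<forall>n\<ge>no. norm ((\<Sum>i<n. (F i)\<^sup>2 / \<nu> i) - (L2_norm f)\<^sup>2) < r"
    proof (intro exI allI impI)
      fix n assume "N \<le> n"
      then have "(\<Sum>n<N. (F n)\<^sup>2 / \<nu> n) \<le> (\<Sum>i<n. (F i)\<^sup>2 / \<nu> i)"
        using terms by (intro sum_mono2) auto
      then show "norm ((\<Sum>i<n. (F i)\<^sup>2 / \<nu> i) - (L2_norm f)\<^sup>2) < r"
        using close bessel[of n] by simp
    qed
  qed
  then show ?thesis by (simp add: F_def)
qed

text \<open>Truncation reduces the claim to bounded functions. A measurable function is almost everywhere a limit
  of continuous functions, and cutting these off at the same level makes the limit dominated.\<close>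

lemma continuous_dense_in_L2:
  assumes f: "f \<in> L2" and "\<epsilon> > 0"
  obtains h where "continuous_on UNIV h" "L2_norm (\<lambda>x. f x - h x) < \<epsilon>"
proof -
  have fm: "f \<in> borel_measurable I\<pi>" using f by (rule L2_measurable)
  define T where "T k x = max (- real k) (min (real k) (f x))" for k :: nat and x
  have Tm: "T k \<in> borel_measurable I\<pi>" for k unfolding T_def[abs_def] using fm by measurable
  have T2: "T k \<in> L2" for k by (rule bounded_in_L2[OF Tm, of k "real k"]) (auto simp: T_def)
  have "(\<lambda>k. L2_norm (\<lambda>x. T k x - f x)) \<longlonglongrightarrow> 0"
  proof (rule L2_norm_dominated_convergence[OF Tm f, where h = "\<lambda>x. \<bar>f x\<bar>"])
    show "(\<lambda>x. \<bar>f x\<bar>) \<in> L2" using f by (auto simp: L2_def)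
    show "\<bar>T k x\<bar> \<le> \<bar>f x\<bar>" for k x by (auto simp: T_def)
    have "(\<lambda>k. T k x) \<longlonglongrightarrow> f x" for x
    proof (rule tendsto_eventually)
      obtain K :: nat where "\<bar>f x\<bar> \<le> real K" using real_arch_simple by blast
      then show "\<forall>\<^sub>F k in sequentially. T k x = f x"
        by (auto simp: T_def eventually_sequentially intro!: exI[of _ K])
    qed
    then show "AE x in I\<pi>. (\<lambda>k. T k x) \<longlonglongrightarrow> f x" by simp
  qed
  from LIMSEQ_D[OF this, of "\<epsilon> / 2"] obtain k where k: "L2_norm (\<lambda>x. T k x - f x) < \<epsilon> / 2"
    using \<open>\<epsilon> > 0\<close> by fastforce
  have "T k measurable_on {0<..<pi}" using Tm by (simp add: measurable_on_iff_borel_measurable)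
  then obtain N g where N: "negligible N" and cont: "\<And>n. continuous_on UNIV (g n)"
    and lim: "\<And>x. x \<notin> N \<Longrightarrow> (\<lambda>n. g n x) \<longlonglongrightarrow> (if x \<in> {0<..<pi} then T k x else 0)"
    unfolding measurable_on_def by blast
  define G where "G n x = max (- real k) (min (real k) (g n x))" for n :: nat and x
  have Gc: "continuous_on A (G n)" for n A
    unfolding G_def[abs_def]
    by (intro continuous_intros continuous_on_subset[OF cont]) auto
  have "(\<lambda>n. L2_norm (\<lambda>x. G n x - T k x)) \<longlonglongrightarrow> 0"
  proof (rule L2_norm_dominated_convergence[OF _ T2 L2_const[of "real k"]])
    show "G n \<in> borel_measurable I\<pi>" for n by (rule continuous_measurable_I\<pi>[OF Gc])
    show "\<bar>G n x\<bar> \<le> real k" for n x by (auto simp: G_def)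
    have "AE x in lebesgue. x \<notin> N"
      using N by (simp add: negligible_iff_null_sets AE_not_in)
    then have "AE x in I\<pi>. x \<notin> N" by (auto simp: AE_restrict_space_iff elim: eventually_mono)
    moreover have "AE x in I\<pi>. x \<in> {0<..<pi}" by (rule AE_I2) simp
    ultimately show "AE x in I\<pi>. (\<lambda>n. G n x) \<longlonglongrightarrow> T k x"
    proof eventually_elim
      fix x assume "x \<notin> N" "x \<in> {0<..<pi}"
      then have "(\<lambda>n. max (- real k) (min (real k) (g n x))) \<longlonglongrightarrow> max (- real k) (min (real k) (T k x))"
        using lim[of x] by (intro tendsto_intros) auto
      then show "(\<lambda>n. G n x) \<longlonglongrightarrow> T k x" by (simp add: G_def T_def)
    qed
  qed
  from LIMSEQ_D[OF this, of "\<epsilon> / 2"] obtain n where n: "L2_norm (\<lambda>x. G n x - T k x) < \<epsilon> / 2"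
    using \<open>\<epsilon> > 0\<close> by fastforce
  have comm: "L2_norm (\<lambda>x. f x - g x) = L2_norm (\<lambda>x. g x - f x)" for f g
    by (simp add: L2_norm_def power2_commute)
  have "G n \<in> L2" by (rule continuous_in_L2[OF Gc])
  then have "L2_norm (\<lambda>x. f x - G n x) < \<epsilon>"
    using L2_triangle3[OF f T2[of k], of "G n"] k n comm[of f "T k"] comm[of "T k" "G n"] by linarith
  then show ?thesis using Gc that by blast
qed

definition cosines :: "nat \<Rightarrow> real \<Rightarrow> real" where "cosines n x = cos (real n * x)"

text \<open>The index is shifted so that every member of the system has positive norm.\<close>

definition sines :: "nat \<Rightarrow> real \<Rightarrow> real" where "sines n x = sin (real (Suc n) * x)"

lemma cosines_in_L2: "cosines n \<in> L2" and sines_in_L2: "sines n \<in> L2"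
  by (auto intro!: continuous_in_L2 continuous_intros simp: cosines_def[abs_def] sines_def[abs_def])

lemma finite_comb_cos_mult: "finite_comb cosines f \<Longrightarrow> finite_comb cosines (\<lambda>x. cos x * f x)"
proof (rule finite_comb_mult_left)
  fix n
  show "finite_comb cosines (\<lambda>x. cos x * cosines n x)"
  proof (cases n)
    case 0
    then have "(\<lambda>x. cos x * cosines n x) = cosines 1" by (simp add: cosines_def fun_eq_iff)
    then show ?thesis using finite_comb_basis[of cosines 1] by simp
  next
    case (Suc k)
    have "(\<lambda>x. cos x * cosines n x) = (\<lambda>x. 1/2 * (cosines (Suc n) x + cosines k x))"
    proof (rule ext)
      fix x
      have "real (Suc n) * x = real n * x + x" "real k * x = real n * x - x"
        by (simp_all add: Suc algebra_simps)
      then show "cos x * cosines n x = 1/2 * (cosines (Suc n) x + cosines k x)"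
        by (simp add: cosines_def cos_add cos_diff)
    qed
    then show ?thesis by (simp only: finite_comb_cmult finite_comb_add finite_comb_basis)
  qed
qed

lemma finite_comb_sin_mult: "finite_comb cosines f \<Longrightarrow> finite_comb sines (\<lambda>x. sin x * f x)"
proof (rule finite_comb_mult_left)
  fix n
  show "finite_comb sines (\<lambda>x. sin x * cosines n x)"
  proof (cases "n < 2")
    case True
    then consider "n = 0" | "n = 1" by linarith
    then show ?thesis
    proof cases
      case 1
      then have "(\<lambda>x. sin x * cosines n x) = sines 0" by (simp add: cosines_def sines_def fun_eq_iff)
      then show ?thesis using finite_comb_basis[of sines 0] by simp
    next
      case 2
      have "(\<lambda>x. sin x * cosines n x) = (\<lambda>x. 1/2 * sines 1 x)"
        by (simp add: fun_eq_iff 2 cosines_def sines_def sin_double)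
      then show ?thesis by (simp only: finite_comb_cmult finite_comb_basis)
    qed
  next
    case False
    then obtain k where k: "n = Suc (Suc k)" by (metis add_2_eq_Suc le_Suc_ex not_less)
    have "(\<lambda>x. sin x * cosines n x) = (\<lambda>x. 1/2 * (sines n x + (-1) * sines k x))"
    proof (rule ext)
      fix x
      have "real (Suc n) * x = real n * x + x" "real (Suc k) * x = real n * x - x"
        by (simp_all add: k algebra_simps)
      then show "sin x * cosines n x = 1/2 * (sines n x + (-1) * sines k x)"
        by (simp add: cosines_def sines_def sin_add sin_diff)
    qed
    then show ?thesis by (simp only: finite_comb_cmult finite_comb_add finite_comb_basis)
  qed
qed

text \<open>Weierstrass approximation in the variable \<open>cos x\<close>, which maps \<open>{0..pi}\<close> homeomorphically onto \<open>{-1..1}\<close>: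
  powers of \<open>cos x\<close> are combinations of cosines of multiples of \<open>x\<close>.\<close>

lemma cosine_approximation:
  assumes "continuous_on {0..pi} h" "\<epsilon> > 0"
  obtains g where "finite_comb cosines g" "\<And>x. x \<in> {0..pi} \<Longrightarrow> \<bar>h x - g x\<bar> < \<epsilon>"
proof -
  have "continuous_on {-1..1} (\<lambda>y. h (arccos y))"
    by (intro continuous_on_compose2[OF assms(1) continuous_on_arccos']) (auto simp: arccos_lbound arccos_ubound)
  then obtain P where P: "real_polynomial_function P"
    and close: "\<And>y. y \<in> {-1..1} \<Longrightarrow> \<bar>h (arccos y) - P y\<bar> < \<epsilon>"
    using Stone_Weierstrass_real_polynomial_function[of "{-1..1}" "\<lambda>y. h (arccos y)" \<epsilon>] assms(2) by auto
  obtain a N where PN: "P = (\<lambda>y. \<Sum>i\<le>N. a i * y ^ i)"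
    using real_polynomial_function_imp_sum[OF P] by blast
  have pow: "finite_comb cosines (\<lambda>x. cos x ^ i)" for i
  proof (induction i)
    case 0
    have "(\<lambda>x. cos x ^ 0) = cosines 0" by (simp add: cosines_def fun_eq_iff)
    then show ?case using finite_comb_basis[of cosines 0] by simp
  next
    case (Suc i) then show ?case using finite_comb_cos_mult[of "\<lambda>x. cos x ^ i"] by simp
  qed
  show ?thesis
  proof (rule that)
    show "finite_comb cosines (\<lambda>x. P (cos x))"
      unfolding PN by (intro finite_comb_sum finite_comb_cmult pow) auto
    show "\<bar>h x - P (cos x)\<bar> < \<epsilon>" if "x \<in> {0..pi}" for x
      using close[of "cos x"] that arccos_cos[of x] by auto
  qed
qed

text \<open>The factor \<open>1 / 4\<close> makes up for the norm \<open>sqrt pi < 2\<close> of the constant function \<open>1\<close>.\<close>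

lemma L2_norm_diff_small:
  assumes "h \<in> L2" "g \<in> L2" "\<epsilon> > 0" "\<And>x. x \<in> {0<..<pi} \<Longrightarrow> \<bar>h x - g x\<bar> \<le> \<epsilon> / 4"
  shows "L2_norm (\<lambda>x. h x - g x) < \<epsilon>"
proof -
  have "L2_norm (\<lambda>x. h x - g x) \<le> \<epsilon> / 4 * sqrt pi"
    using assms by (intro L2_norm_le_sup L2_diff) auto
  also have "\<dots> \<le> \<epsilon> / 4 * 2"
    using assms(3) pi_less_4 real_sqrt_le_mono[of pi 4] by (intro mult_left_mono) auto
  also have "\<dots> < \<epsilon>" using assms(3) by simp
  finally show ?thesis .
qed

lemma complete_cosines: "complete_system cosines"
  unfolding complete_system_def
proof (intro ballI allI impI)
  fix f \<epsilon> assume f: "f \<in> L2" and "\<epsilon> > (0 :: real)"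
  then obtain h where h: "continuous_on UNIV h" "L2_norm (\<lambda>x. f x - h x) < \<epsilon> / 2"
    using continuous_dense_in_L2[of f "\<epsilon> / 2"] by auto
  have hc: "continuous_on {0..pi} h" using h(1) continuous_on_subset by blast
  then obtain g where g: "finite_comb cosines g" "\<And>x. x \<in> {0..pi} \<Longrightarrow> \<bar>h x - g x\<bar> < \<epsilon> / 2 / 4"
    using cosine_approximation[of h "\<epsilon> / 2 / 4"] \<open>\<epsilon> > 0\<close> by auto
  have L: "h \<in> L2" "g \<in> L2"
    using continuous_in_L2[OF hc] finite_comb_in_L2[OF cosines_in_L2 g(1)] by auto
  have "L2_norm (\<lambda>x. h x - g x) < \<epsilon> / 2"
    using g(2) \<open>\<epsilon> > 0\<close> by (intro L2_norm_diff_small L) (auto simp: less_imp_le)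
  then have "L2_norm (\<lambda>x. f x - g x) < \<epsilon>"
    using h(2) L2_triangle3[OF f L] by linarith
  then show "\<exists>g. finite_comb cosines g \<and> L2_norm (\<lambda>x. f x - g x) < \<epsilon>" using g(1) by blast
qed

text \<open>A continuous \<open>h\<close> need not vanish at the boundary, so it is first replaced by
  \<open>h * sin\<^sup>2 / (sin\<^sup>2 + 1 / k)\<close>, which converges to \<open>h\<close> boundedly in the open interval. This is \<open>sin\<close> times a
  continuous function; approximating the latter by cosines and multiplying by \<open>sin\<close> yields sines.\<close>

lemma complete_sines: "complete_system sines"
  unfolding complete_system_def
proof (intro ballI allI impI)
  fix f \<epsilon> assume f: "f \<in> L2" and \<epsilon>: "\<epsilon> > (0 :: real)"
  then obtain h where h: "continuous_on UNIV h" "L2_norm (\<lambda>x. f x - h x) < \<epsilon> / 4"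
    using continuous_dense_in_L2[of f "\<epsilon> / 4"] by auto
  have hc: "continuous_on {0..pi} h" using h(1) continuous_on_subset by blast
  have hL: "h \<in> L2" by (rule continuous_in_L2[OF hc])
  define w where "w k x = h x * sin x / ((sin x)\<^sup>2 + 1 / real (Suc k))" for k :: nat and x
  have den: "(sin x)\<^sup>2 + 1 / real (Suc k) > 0" for x k by (intro add_nonneg_pos) auto
  have wc: "continuous_on {0..pi} (w k)" for k
    unfolding w_def[abs_def] using den[of _ k] by (intro continuous_intros hc) (auto simp: less_le)
  have swc: "continuous_on {0..pi} (\<lambda>x. sin x * w k x)" for k by (intro continuous_intros wc)
  have "(\<lambda>k. L2_norm (\<lambda>x. sin x * w k x - h x)) \<longlonglongrightarrow> 0"
  proof (rule L2_norm_dominated_convergence[OF _ hL, where h = "\<lambda>x. \<bar>h x\<bar>"])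
    show "(\<lambda>x. sin x * w k x) \<in> borel_measurable I\<pi>" for k by (rule continuous_measurable_I\<pi>[OF swc])
    show "(\<lambda>x. \<bar>h x\<bar>) \<in> L2" using hL by (auto simp: L2_def)
    fix k x
    define R where "R = (sin x)\<^sup>2 / ((sin x)\<^sup>2 + 1 / real (Suc k))"
    have R: "0 \<le> R" "R \<le> 1" using den[of x k] by (simp_all add: R_def divide_le_eq_1 del: of_nat_Suc)
    have "sin x * w k x = R * h x" by (simp add: w_def R_def power2_eq_square)
    then show "\<bar>sin x * w k x\<bar> \<le> \<bar>h x\<bar>"
      using mult_right_mono[OF R(2), of "\<bar>h x\<bar>"] R(1) by (simp add: abs_mult)
  next
    show "AE x in I\<pi>. (\<lambda>k. sin x * w k x) \<longlonglongrightarrow> h x"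
    proof (rule AE_I2)
      fix x assume "x \<in> space I\<pi>"
      then have "sin x > 0" by (simp add: sin_gt_zero)
      have "(\<lambda>k. 1 / real (Suc k)) \<longlonglongrightarrow> 0" by (rule LIMSEQ_Suc[OF lim_1_over_n])
      then have "(\<lambda>k. sin x * (h x * sin x / ((sin x)\<^sup>2 + 1 / real (Suc k))))
          \<longlonglongrightarrow> sin x * (h x * sin x / ((sin x)\<^sup>2 + 0))"
        using \<open>sin x > 0\<close> by (intro tendsto_intros) auto
      then show "(\<lambda>k. sin x * w k x) \<longlonglongrightarrow> h x"
        using \<open>sin x > 0\<close> by (simp add: w_def power2_eq_square)
    qed
  qed
  from LIMSEQ_D[OF this, of "\<epsilon> / 4"] obtain k where "L2_norm (\<lambda>x. sin x * w k x - h x) < \<epsilon> / 4"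
    using \<epsilon> by fastforce
  then have k: "L2_norm (\<lambda>x. h x - sin x * w k x) < \<epsilon> / 4" by (simp add: L2_norm_def power2_commute)
  obtain g where g: "finite_comb cosines g" "\<And>x. x \<in> {0..pi} \<Longrightarrow> \<bar>w k x - g x\<bar> < \<epsilon> / 2 / 4"
    using cosine_approximation[OF wc, of "\<epsilon> / 2 / 4"] \<epsilon> by auto
  have sg: "finite_comb sines (\<lambda>x. sin x * g x)" by (rule finite_comb_sin_mult[OF g(1)])
  have L: "(\<lambda>x. sin x * w k x) \<in> L2" "(\<lambda>x. sin x * g x) \<in> L2"
    using continuous_in_L2[OF swc] finite_comb_in_L2[OF sines_in_L2 sg] by auto
  have "L2_norm (\<lambda>x. sin x * w k x - sin x * g x) < \<epsilon> / 2"
  proof (intro L2_norm_diff_small L)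
    fix x assume x: "x \<in> {0<..<pi}"
    have "\<bar>sin x * w k x - sin x * g x\<bar> = \<bar>sin x\<bar> * \<bar>w k x - g x\<bar>"
      by (simp add: abs_mult flip: right_diff_distrib)
    also have "\<dots> \<le> 1 * (\<epsilon> / 2 / 4)" using g(2)[of x] x by (intro mult_mono) auto
    finally show "\<bar>sin x * w k x - sin x * g x\<bar> \<le> \<epsilon> / 2 / 4" by simp
  qed (use \<epsilon> in auto)
  then have "L2_norm (\<lambda>x. f x - sin x * g x) < \<epsilon>"
    using h(2) k L2_triangle3[OF f hL L(2)] L2_triangle3[OF hL L] by linarith
  then show "\<exists>g. finite_comb sines g \<and> L2_norm (\<lambda>x. f x - g x) < \<epsilon>" using sg by blast
qed

lemma integral_cos_multiple:
  assumes "m \<noteq> 0" shows "(LINT x|I\<pi>. cos (of_int m * x)) = 0"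
proof -
  have "(LINT x|I\<pi>. cos (of_int m * x)) = sin (of_int m * pi) / of_int m - sin (of_int m * 0) / of_int m"
    using assms by (intro integral_deriv_I\<pi> continuous_intros) (auto intro!: derivative_eq_intros)
  then show ?thesis by (simp add: sin_zero_iff_int2)
qed

lemma integral_cos_cos:
  fixes m n :: int
  shows "(LINT x|I\<pi>. cos (of_int m * x) * cos (of_int n * x))
      = ((if m + n = 0 then pi else 0) + (if m = n then pi else 0)) / 2" (is ?cos)
    and "(LINT x|I\<pi>. sin (of_int m * x) * sin (of_int n * x))
      = ((if m = n then pi else 0) - (if m + n = 0 then pi else 0)) / 2" (is ?sin)
proof -
  have I: "(LINT x|I\<pi>. cos (of_int k * x)) = (if k = 0 then pi else 0)" for k :: int
    using integral_cos_multiple[of k] integral_deriv_I\<pi>[of "\<lambda>x. x" "\<lambda>x. 1"]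
    by (auto intro!: derivative_eq_intros)
  have int: "integrable I\<pi> (\<lambda>x. cos (of_int k * x))" for k :: int
    by (intro L2_integrable continuous_in_L2 continuous_intros)
  have prod: "cos (of_int m * x) * cos (of_int n * x) = (cos (of_int (m + n) * x) + cos (of_int (m - n) * x)) / 2"
    "sin (of_int m * x) * sin (of_int n * x) = (cos (of_int (m - n) * x) - cos (of_int (m + n) * x)) / 2" for x :: real
    by (simp_all add: distrib_right left_diff_distrib cos_add cos_diff)
  show ?cos
    using I[of "m + n"] I[of "m - n"] unfolding prod
    by (simp add: int del: of_int_add of_int_diff)
  show ?sin
    using I[of "m + n"] I[of "m - n"] unfolding prod
    by (simp add: int del: of_int_add of_int_diff)
qed

lemma Parseval_cosines:
  assumes "f \<in> L2"
  shows "(\<lambda>n. (LINT x|I\<pi>. f x * cosines n x)\<^sup>2 / (if n = 0 then pi else pi / 2)) sums (L2_norm f)\<^sup>2"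
proof (rule Parseval[OF cosines_in_L2 _ _ complete_cosines assms])
  fix m n :: nat
  show "(LINT x|I\<pi>. cosines m x * cosines n x) = (if m = n then if n = 0 then pi else pi / 2 else 0)"
    using integral_cos_cos(1)[of "int m" "int n"] by (auto simp: cosines_def)
qed auto

lemma Parseval_sines:
  assumes "f \<in> L2"
  shows "(\<lambda>n. (LINT x|I\<pi>. f x * sines n x)\<^sup>2 / (pi / 2)) sums (L2_norm f)\<^sup>2"
proof (rule Parseval[OF sines_in_L2 _ _ complete_sines assms])
  fix m n :: nat
  show "(LINT x|I\<pi>. sines m x * sines n x) = (if m = n then pi / 2 else 0)"
    using integral_cos_cos(2)[of "int (Suc m)" "int (Suc n)"] by (auto simp: sines_def)
qed auto

section \<open>Smooth functions and a smooth step\<close>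

definition smooth :: "(real \<Rightarrow> real) \<Rightarrow> bool" where
  "smooth f \<longleftrightarrow> (\<forall>k x. (deriv ^^ k) f field_differentiable (at x))"

text \<open>Induction on the order of differentiation, uniformly over a family of functions, is the
  way closure properties of \<open>smooth\<close> are obtained, so a finite-order version is needed.\<close>

definition smooth_upto :: "nat \<Rightarrow> (real \<Rightarrow> real) \<Rightarrow> bool" where
  "smooth_upto n f \<longleftrightarrow> (\<forall>k\<le>n. \<forall>x. (deriv ^^ k) f field_differentiable (at x))"

lemma smooth_iff: "smooth f \<longleftrightarrow> (\<forall>n. smooth_upto n f)"
  by (auto simp: smooth_def smooth_upto_def)

lemma smooth_upto_0: "smooth_upto 0 f \<longleftrightarrow> (\<forall>x. f field_differentiable (at x))"
  by (simp add: smooth_upto_def)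

lemma smooth_upto_Suc:
  "smooth_upto (Suc n) f \<longleftrightarrow> (\<forall>x. f field_differentiable (at x)) \<and> smooth_upto n (deriv f)"
proof -
  have "(\<forall>k\<le>Suc n. P k) \<longleftrightarrow> P 0 \<and> (\<forall>k\<le>n. P (Suc k))" for P
    by (metis Suc_le_mono le0 not0_implies_Suc)
  then show ?thesis by (simp add: smooth_upto_def funpow_Suc_right del: funpow.simps)
qed

lemma smooth_upto_SucI:
  assumes "\<And>x. (f has_field_derivative f' x) (at x)" "smooth_upto n f'"
  shows "smooth_upto (Suc n) f"
proof -
  have "deriv f = f'" using assms(1) by (auto intro: DERIV_imp_deriv)
  then show ?thesis using assms by (auto simp: smooth_upto_Suc field_differentiable_def)
qed

lemma smooth_upto_differentiable: "smooth_upto n f \<Longrightarrow> (f has_field_derivative deriv f x) (at x)"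
  unfolding smooth_upto_def by (metis DERIV_deriv_iff_field_differentiable funpow_0 le0)

lemma smooth_upto_mono: "smooth_upto (Suc n) f \<Longrightarrow> smooth_upto n f"
  by (simp add: smooth_upto_def)

lemma smooth_upto_const: "smooth_upto n (\<lambda>x. c)"
proof (induction n arbitrary: c)
  case (Suc n)
  show ?case by (rule smooth_upto_SucI[where f' = "\<lambda>x. 0"]) (auto intro: Suc)
qed (simp add: smooth_upto_0)

lemma smooth_upto_add:
  "smooth_upto n f \<Longrightarrow> smooth_upto n g \<Longrightarrow> smooth_upto n (\<lambda>x. f x + g x)"
proof (induction n arbitrary: f g)
  case 0 then show ?case by (auto simp: smooth_upto_0 intro: field_differentiable_add)
next
  case (Suc n)
  show ?case
  proof (rule smooth_upto_SucI)
    show "((\<lambda>x. f x + g x) has_field_derivative deriv f x + deriv g x) (at x)" for x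
      using Suc.prems by (intro DERIV_add smooth_upto_differentiable)
    show "smooth_upto n (\<lambda>x. deriv f x + deriv g x)"
      using Suc.prems by (intro Suc.IH) (auto simp: smooth_upto_Suc)
  qed
qed

lemma smooth_upto_mult:
  "smooth_upto n f \<Longrightarrow> smooth_upto n g \<Longrightarrow> smooth_upto n (\<lambda>x. f x * g x)"
proof (induction n arbitrary: f g)
  case 0 then show ?case by (auto simp: smooth_upto_0 intro: field_differentiable_mult)
next
  case (Suc n)
  show ?case
  proof (rule smooth_upto_SucI)
    show "((\<lambda>x. f x * g x) has_field_derivative deriv f x * g x + deriv g x * f x) (at x)" for x
      using Suc.prems by (intro DERIV_mult smooth_upto_differentiable)
    show "smooth_upto n (\<lambda>x. deriv f x * g x + deriv g x * f x)"
      using Suc.prems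
      by (intro smooth_upto_add Suc.IH) (auto simp: smooth_upto_Suc intro: smooth_upto_mono)
  qed
qed

lemma smooth_upto_inverse:
  "smooth_upto n f \<Longrightarrow> (\<And>x. f x \<noteq> 0) \<Longrightarrow> smooth_upto n (\<lambda>x. inverse (f x))"
proof (induction n)
  case 0 then show ?case by (auto simp: smooth_upto_0 intro: field_differentiable_inverse)
next
  case (Suc n)
  show ?case
  proof (rule smooth_upto_SucI)
    show "((\<lambda>x. inverse (f x)) has_field_derivative
        (-1) * (inverse (f x) * deriv f x * inverse (f x))) (at x)" for x
      using DERIV_inverse'[OF smooth_upto_differentiable[OF Suc.prems(1)] Suc.prems(2)] by simp
    show "smooth_upto n (\<lambda>x. (-1) * (inverse (f x) * deriv f x * inverse (f x)))"
      using Suc.prems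
      by (intro smooth_upto_mult smooth_upto_const Suc.IH smooth_upto_mono[OF Suc.prems(1)])
        (auto simp: smooth_upto_Suc)
  qed
qed

lemma smooth_upto_affine:
  "smooth_upto n f \<Longrightarrow> smooth_upto n (\<lambda>x. f (c * x + d))"
proof (induction n arbitrary: f)
  case 0
  have "((\<lambda>x. f (c * x + d)) has_field_derivative deriv f (c * x + d) * c) (at x)" for x
    by (rule DERIV_chain'[where f = "\<lambda>x. c * x + d"])
      (auto intro!: derivative_eq_intros smooth_upto_differentiable[OF 0])
  then show ?case by (auto simp: smooth_upto_0 field_differentiable_def)
next
  case (Suc n)
  show ?case
  proof (rule smooth_upto_SucI)
    show "((\<lambda>x. f (c * x + d)) has_field_derivative deriv f (c * x + d) * c) (at x)" for x
      by (rule DERIV_chain'[where f = "\<lambda>x. c * x + d"])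
        (auto intro!: derivative_eq_intros smooth_upto_differentiable[OF Suc.prems])
    show "smooth_upto n (\<lambda>x. deriv f (c * x + d) * c)"
      using Suc by (intro smooth_upto_mult smooth_upto_const Suc.IH) (auto simp: smooth_upto_Suc)
  qed
qed

lemma smooth_differentiable: "smooth f \<Longrightarrow> (f has_field_derivative deriv f x) (at x)"
  unfolding smooth_iff using smooth_upto_differentiable by blast

lemma smooth_deriv: "smooth f \<Longrightarrow> smooth (deriv f)"
  unfolding smooth_iff using smooth_upto_Suc by blast

lemma smooth_continuous: "smooth f \<Longrightarrow> continuous_on A f"
  using smooth_differentiable[of f]
  by (meson DERIV_continuous_on has_field_derivative_at_within)

lemma smooth_add [intro]: "smooth f \<Longrightarrow> smooth g \<Longrightarrow> smooth (\<lambda>x. f x + g x)"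
  and smooth_mult [intro]: "smooth f \<Longrightarrow> smooth g \<Longrightarrow> smooth (\<lambda>x. f x * g x)"
  and smooth_inverse [intro]: "smooth f \<Longrightarrow> (\<And>x. f x \<noteq> 0) \<Longrightarrow> smooth (\<lambda>x. inverse (f x))"
  and smooth_affine [intro]: "smooth f \<Longrightarrow> smooth (\<lambda>x. f (c * x + d))"
  by (auto simp: smooth_iff smooth_upto_add smooth_upto_mult smooth_upto_inverse
      smooth_upto_affine)

lemma smooth_sin: "smooth (\<lambda>x. sin (c * x))" 
proof -
  have "smooth_upto n sin \<and> smooth_upto n cos" for n
  proof (induction n)
    case 0
    show ?case by (auto simp: smooth_upto_0 field_differentiable_at_sin field_differentiable_at_cos)
  next
    case (Suc n)
    have "smooth_upto n (\<lambda>x. (-1) * sin x)"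
      by (intro smooth_upto_mult smooth_upto_const) (use Suc in auto)
    moreover have "(cos has_field_derivative (-1) * sin x) (at x)" for x :: real
      using DERIV_cos[of x] by simp
    ultimately have "smooth_upto (Suc n) cos"
      by (intro smooth_upto_SucI[where f' = "\<lambda>x. (-1) * sin x"])
    then show ?case using Suc smooth_upto_SucI[OF DERIV_sin] by blast
  qed
  then have "smooth sin" by (simp add: smooth_iff)
  from smooth_affine[OF this, of c 0] show ?thesis by simp
qed

text \<open>All derivatives of \<open>exp (- 1 / x)\<close>, extended by zero to the negative half line, are
  combinations of the following functions.\<close>

definition flat_exp :: "nat \<Rightarrow> real \<Rightarrow> real" where
  "flat_exp m x = (if x > 0 then exp (- inverse x) * inverse x ^ m else 0)"

lemma flat_exp_tendsto_0: "(flat_exp m \<longlongrightarrow> 0) (at 0)"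
proof (rule filterlim_split_at)
  show "(flat_exp m \<longlongrightarrow> 0) (at_left 0)"
    by (rule tendsto_eventually) (auto simp: flat_exp_def eventually_at_filter)
  have "((\<lambda>y. y ^ m / exp y) \<longlongrightarrow> 0) (at_top :: real filter)"
    by (rule tendsto_power_div_exp_0)
  then have "((\<lambda>x. inverse x ^ m / exp (inverse x)) \<longlongrightarrow> 0) (at_right (0 :: real))"
    by (rule filterlim_compose[OF _ filterlim_inverse_at_top_right])
  then show "(flat_exp m \<longlongrightarrow> 0) (at_right 0)"
    by (rule tendsto_cong[THEN iffD1, rotated])
      (auto simp: flat_exp_def eventually_at_filter exp_minus field_simps)
qed

lemma flat_exp_derivative:
  "(flat_exp m has_field_derivative flat_exp (m + 2) x + (- real m) * flat_exp (m + 1) x) (at x)"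
proof (cases x "0 :: real" rule: linorder_cases)
  case less
  have "((\<lambda>x. 0) has_field_derivative 0) (at x)" by simp
  then have "(flat_exp m has_field_derivative 0) (at x)"
    by (rule has_field_derivative_transform_within_open[where S = "{..<0}"])
      (use less in \<open>auto simp: flat_exp_def\<close>)
  then show ?thesis using less by (simp add: flat_exp_def)
next
  case greater
  have "((\<lambda>x. exp (- inverse x) * inverse x ^ m) has_field_derivative
      flat_exp (m + 2) x + (- real m) * flat_exp (m + 1) x) (at x)"
    using greater power_minus_mult[of _ x]
    by (cases m; auto intro!: derivative_eq_intros simp: flat_exp_def field_simps power2_eq_square;
      metis neq0_conv)
  then show ?thesis
    by (rule has_field_derivative_transform_within_open[where S = "{0<..}"])
      (use greater in \<open>auto simp: flat_exp_def\<close>)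
next
  case equal
  have "((\<lambda>y. (flat_exp m y - flat_exp m 0) / (y - 0)) \<longlongrightarrow> 0) (at 0)"
    by (rule tendsto_cong[THEN iffD1, OF _ flat_exp_tendsto_0[of "Suc m"]])
      (auto simp: flat_exp_def eventually_at_filter field_simps)
  then have "(flat_exp m has_field_derivative 0) (at 0)"
    by (simp add: has_field_derivative_iff)
  then show ?thesis using equal by (simp add: flat_exp_def)
qed

lemma smooth_flat_exp: "smooth (flat_exp m)"
proof -
  have "smooth_upto n (flat_exp m)" for n
  proof (induction n arbitrary: m)
    case 0
    show ?case using flat_exp_derivative by (auto simp: smooth_upto_0 field_differentiable_def)
  next
    case (Suc n)
    show ?case
      by (rule smooth_upto_SucI[OF flat_exp_derivative])
        (intro smooth_upto_add smooth_upto_mult smooth_upto_const Suc)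
  qed
  then show ?thesis by (simp add: smooth_iff)
qed

definition smooth_step :: "real \<Rightarrow> real" where
  "smooth_step x = flat_exp 0 x * inverse (flat_exp 0 x + flat_exp 0 (1 - x))"

lemma flat_exp_0_pos: "flat_exp 0 x \<ge> 0" "x > 0 \<Longrightarrow> flat_exp 0 x > 0" "x \<le> 0 \<Longrightarrow> flat_exp 0 x = 0"
  by (auto simp: flat_exp_def)

lemma smooth_step_denominator_pos: "flat_exp 0 x + flat_exp 0 (1 - x) > 0"
  using flat_exp_0_pos[of x] flat_exp_0_pos[of "1 - x"] by (cases "x > 0") auto

lemma smooth_smooth_step: "smooth smooth_step"
proof -
  have "smooth (\<lambda>x. flat_exp 0 ((-1) * x + 1))" by (intro smooth_affine smooth_flat_exp)
  then have "smooth (\<lambda>x. flat_exp 0 (1 - x))" by simp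
  then have "smooth (\<lambda>x. flat_exp 0 x * inverse (flat_exp 0 x + flat_exp 0 (1 - x)))"
    by (intro smooth_mult smooth_inverse smooth_add smooth_flat_exp)
      (use smooth_step_denominator_pos in \<open>auto simp: less_le\<close>)
  then show ?thesis by (simp add: smooth_step_def[abs_def])
qed

lemma smooth_step_eq_0: "x \<le> 0 \<Longrightarrow> smooth_step x = 0"
  by (simp add: smooth_step_def flat_exp_0_pos)

lemma smooth_step_eq_1: "1 \<le> x \<Longrightarrow> smooth_step x = 1"
  using flat_exp_0_pos(2)[of x] flat_exp_0_pos(3)[of "1 - x"] by (simp add: smooth_step_def)

lemma smooth_step_bounds: "0 \<le> smooth_step x" "smooth_step x \<le> 1"
  using smooth_step_denominator_pos[of x] flat_exp_0_pos(1)[of x] flat_exp_0_pos(1)[of "1 - x"]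
  by (auto simp: smooth_step_def field_simps)

lemma deriv_smooth_step_eq_0:
  assumes "x < 0 \<or> 1 < x" shows "deriv smooth_step x = 0"
proof -
  have c: "((\<lambda>x. c) has_field_derivative 0) (at x)" for c :: real by simp
  from assms have "(smooth_step has_field_derivative 0) (at x)"
  proof
    assume "x < 0" then show ?thesis
      by (intro has_field_derivative_transform_within_open[OF c[of 0], where S = "{..<0}"])
        (auto simp: smooth_step_eq_0)
  next
    assume "1 < x" then show ?thesis
      by (intro has_field_derivative_transform_within_open[OF c[of 1], where S = "{1<..}"])
        (auto simp: smooth_step_eq_1)
  qed
  then show ?thesis by (rule DERIV_imp_deriv)
qed

lemma deriv_smooth_step_bounded: obtains M where "M \<ge> 0" "\<And>x. \<bar>deriv smooth_step x\<bar> \<le> M"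
proof -
  have "bounded (deriv smooth_step ` {0..1})"
    by (intro compact_imp_bounded compact_continuous_image smooth_continuous smooth_deriv
        smooth_smooth_step) auto
  then obtain B where B: "\<forall>y\<in>deriv smooth_step ` {0..1}. norm y \<le> B" by (auto simp: bounded_iff)
  have "\<bar>deriv smooth_step x\<bar> \<le> max 0 B" for x
    using B deriv_smooth_step_eq_0[of x] by (cases "x < 0 \<or> 1 < x") (auto simp: le_max_iff_disj)
  then show ?thesis by (intro that[of "max 0 B"]) auto
qed

section \<open>Weak derivatives and their Fourier coefficients\<close>

lemma test_function_smooth: "test_function w \<Longrightarrow> smooth w"
  by (simp add: test_function_def smooth_def)

lemma test_function_support:
  assumes "test_function w" "x \<notin> {0<..<pi}" shows "w x = 0"
  using assms unfolding test_function_def by blast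

lemma smooth_in_L2: "smooth f \<Longrightarrow> f \<in> L2"
  by (intro continuous_in_L2 smooth_continuous)

lemma integrate_by_parts:
  fixes f g f' g' :: "real \<Rightarrow> real"
  assumes "\<And>x. (f has_real_derivative f' x) (at x)" "\<And>x. (g has_real_derivative g' x) (at x)"
    and "continuous_on {0..pi} f'" "continuous_on {0..pi} g'"
    and "f 0 * g 0 = 0" "f pi * g pi = 0"
  shows "(LINT x|I\<pi>. f x * g' x) = - (LINT x|I\<pi>. f' x * g x)"
proof -
  have c: "continuous_on {0..pi} f" "continuous_on {0..pi} g"
    using assms(1,2) by (meson DERIV_continuous_on has_field_derivative_at_within)+
  have "(LINT x|I\<pi>. f' x * g x + f x * g' x) = f pi * g pi - f 0 * g 0"
    by (rule integral_deriv_I\<pi>)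
      (auto intro!: derivative_eq_intros assms(1,2) continuous_intros c assms(3,4))
  moreover have "(LINT x|I\<pi>. f' x * g x + f x * g' x) = (LINT x|I\<pi>. f' x * g x) + (LINT x|I\<pi>. f x * g' x)"
    by (intro Bochner_Integration.integral_add L2_mult_integrable continuous_in_L2 c assms(3,4))
  ultimately show ?thesis using assms(5,6) by simp
qed

lemma has_weak_deriv_C1:
  assumes "\<And>x. (f has_real_derivative f' x) (at x)" "continuous_on {0..pi} f'"
  shows "has_weak_deriv f f'"
  unfolding has_weak_deriv_def
proof (intro allI impI)
  fix w assume w: "test_function w"
  note smooth = test_function_smooth[OF w]
  show "(LINT x|I\<pi>. f x * deriv w x) = - (LINT x|I\<pi>. f' x * w x)"
    using test_function_support[OF w, of 0] test_function_support[OF w, of pi]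
    by (intro integrate_by_parts assms smooth_differentiable smooth smooth_continuous smooth_deriv) auto
qed

definition cutoff :: "nat \<Rightarrow> real \<Rightarrow> real" where
  "cutoff k x = smooth_step (real (Suc k) * x - 1) * smooth_step (real (Suc k) * (pi - x) - 1)"

definition cutoff' :: "nat \<Rightarrow> real \<Rightarrow> real" where
  "cutoff' k x = real (Suc k) * (deriv smooth_step (real (Suc k) * x - 1) * smooth_step (real (Suc k) * (pi - x) - 1)
     - smooth_step (real (Suc k) * x - 1) * deriv smooth_step (real (Suc k) * (pi - x) - 1))"

lemma smooth_cutoff: "smooth (cutoff k)"
proof -
  have "smooth (\<lambda>x. smooth_step (real (Suc k) * x + (-1)) *
      smooth_step ((- real (Suc k)) * x + (real (Suc k) * pi - 1)))"
    by (intro smooth_mult smooth_affine smooth_smooth_step)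
  then show ?thesis by (simp add: cutoff_def[abs_def] algebra_simps)
qed

lemma cutoff_derivative: "(cutoff k has_real_derivative cutoff' k x) (at x)"
proof -
  let ?K = "real (Suc k)"
  have 1: "((\<lambda>x. smooth_step (?K * x - 1)) has_real_derivative deriv smooth_step (?K * x - 1) * ?K) (at x)"
    by (rule DERIV_chain'[where f = "\<lambda>x. ?K * x - 1", OF _ smooth_differentiable[OF smooth_smooth_step]])
      (auto intro!: derivative_eq_intros)
  have 2: "((\<lambda>x. smooth_step (?K * (pi - x) - 1)) has_real_derivative
      deriv smooth_step (?K * (pi - x) - 1) * (- ?K)) (at x)"
    by (rule DERIV_chain'[where f = "\<lambda>x. ?K * (pi - x) - 1", OF _ smooth_differentiable[OF smooth_smooth_step]])
      (auto intro!: derivative_eq_intros)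
  show ?thesis
    unfolding cutoff_def[abs_def] by (rule DERIV_cong[OF DERIV_mult[OF 1 2]])
      (simp add: cutoff'_def algebra_simps del: of_nat_Suc)
qed

lemma cutoff_support:
  assumes "x \<notin> {1 / real (Suc k)..pi - 1 / real (Suc k)}" shows "cutoff k x = 0"
proof -
  have "real (Suc k) * x - 1 \<le> 0 \<or> real (Suc k) * (pi - x) - 1 \<le> 0"
    using assms by (auto simp: field_simps)
  then show ?thesis by (auto simp: cutoff_def smooth_step_eq_0)
qed

lemma test_function_cutoff_mult:
  assumes "smooth f" shows "test_function (\<lambda>x. cutoff k x * f x)"
proof -
  have "smooth (\<lambda>x. cutoff k x * f x)" by (intro smooth_mult smooth_cutoff assms)
  moreover have "1 / real (Suc k) > 0" by simp
  then have "{1 / real (Suc k)..pi - 1 / real (Suc k)} \<subseteq> {0<..<pi}"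
    by (intro subsetI) (simp only: atLeastAtMost_iff greaterThanLessThan_iff, linarith)
  ultimately show ?thesis
    unfolding test_function_def smooth_def[symmetric] using cutoff_support
    by (intro conjI exI[of _ "{1 / real (Suc k)..pi - 1 / real (Suc k)}"]) auto
qed

lemma cutoff_bounds: "0 \<le> cutoff k x" "cutoff k x \<le> 1"
  using smooth_step_bounds by (auto simp: cutoff_def intro!: mult_nonneg_nonneg mult_le_one)

lemma cutoff_eventually:
  assumes "x \<in> {0<..<pi}"
  shows "\<forall>\<^sub>F k in sequentially. cutoff k x = 1 \<and> cutoff' k x = 0"
proof -
  obtain k0 :: nat where k0: "real k0 > max (3 / x) (3 / (pi - x))" using reals_Archimedean2 by blast
  have "cutoff k x = 1 \<and> cutoff' k x = 0" if "k \<ge> k0" for k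
  proof -
    have K: "real (Suc k) > 3 / x" "real (Suc k) > 3 / (pi - x)" using that k0 by simp_all
    have "real (Suc k) * x > 3" "real (Suc k) * (pi - x) > 3"
      using K assms by (simp_all add: divide_less_eq)
    then have "real (Suc k) * x - 1 > 1" "real (Suc k) * (pi - x) - 1 > 1" by linarith+
    then show ?thesis
      by (simp add: cutoff_def cutoff'_def smooth_step_eq_1 deriv_smooth_step_eq_0 less_imp_le del: of_nat_Suc)
  qed
  then show ?thesis using eventually_sequentially by blast
qed

text \<open>The derivative of the cut-off is of the order \<open>k\<close> on a layer of width of the order \<open>1 / k\<close> at the
  boundary. There a function that vanishes linearly at the boundary is of the order \<open>1 / k\<close>, so the product is bounded
  uniformly in \<open>k\<close>.\<close>

lemma cutoff'_bound:
  obtains M where "\<And>k x f. \<lbrakk>x \<in> {0<..<pi}; \<bar>f\<bar> \<le> B * x; \<bar>f\<bar> \<le> B * (pi - x); B \<ge> 0\<rbrakk> \<Longrightarrow> \<bar>cutoff' k x * f\<bar> \<le> M * B"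
proof -
  obtain M where M: "M \<ge> 0" "\<And>x. \<bar>deriv smooth_step x\<bar> \<le> M" using deriv_smooth_step_bounded by blast
  have layer: "\<bar>real (Suc k) * (deriv smooth_step (real (Suc k) * y - 1) * f)\<bar> \<le> 2 * M * B"
    if "0 < y" "\<bar>f\<bar> \<le> B * y" "B \<ge> 0" for k y f B
  proof (cases "real (Suc k) * y \<le> 2")
    case True
    have "\<bar>real (Suc k) * (deriv smooth_step (real (Suc k) * y - 1) * f)\<bar>
        = \<bar>deriv smooth_step (real (Suc k) * y - 1)\<bar> * (real (Suc k) * \<bar>f\<bar>)"
      by (simp add: abs_mult)
    also have "\<dots> \<le> M * (real (Suc k) * (B * y))"
      using that M by (intro mult_mono mult_left_mono) auto
    also have "\<dots> = M * B * (real (Suc k) * y)" by (simp add: mult_ac)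
    also have "\<dots> \<le> M * B * 2" using True M that by (intro mult_left_mono) auto
    finally show ?thesis by simp
  next
    case False
    then have "deriv smooth_step (real (Suc k) * y - 1) = 0" by (intro deriv_smooth_step_eq_0) auto
    then show ?thesis using M that by simp
  qed
  have "\<bar>cutoff' k x * f\<bar> \<le> 4 * M * B"
    if x: "x \<in> {0<..<pi}" and f: "\<bar>f\<bar> \<le> B * x" "\<bar>f\<bar> \<le> B * (pi - x)" "B \<ge> 0" for k x f
  proof -
    have s: "\<bar>smooth_step y * z\<bar> \<le> \<bar>z\<bar>" for y z
      using smooth_step_bounds[of y] mult_right_mono[of "smooth_step y" 1 "\<bar>z\<bar>"] by (simp add: abs_mult)
    have "cutoff' k x * f =
        smooth_step (real (Suc k) * (pi - x) - 1) * (real (Suc k) * (deriv smooth_step (real (Suc k) * x - 1) * f))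
        - smooth_step (real (Suc k) * x - 1) * (real (Suc k) * (deriv smooth_step (real (Suc k) * (pi - x) - 1) * f))"
      by (simp add: cutoff'_def algebra_simps del: of_nat_Suc)
    also have "\<bar>\<dots>\<bar> \<le> 2 * M * B + 2 * M * B"
      using x f by (intro order_trans[OF abs_triangle_ineq4] add_mono order_trans[OF s] layer) auto
    finally show ?thesis by (simp add: mult_ac)
  qed
  then show ?thesis by (rule that)
qed

lemma abs_sin_le_dist_boundary:
  fixes n :: nat
  assumes "x \<in> {0..pi}"
  shows "\<bar>sin (real n * x)\<bar> \<le> real n * x" "\<bar>sin (real n * x)\<bar> \<le> real n * (pi - x)"
proof -
  show "\<bar>sin (real n * x)\<bar> \<le> real n * x" using abs_sin_x_le_abs_x[of "real n * x"] assms by simp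
  have "sin (real n * (pi - x)) = - (cos (real n * pi) * sin (real n * x))"
    by (simp add: right_diff_distrib sin_diff)
  then have "\<bar>sin (real n * x)\<bar> = \<bar>sin (real n * (pi - x))\<bar>" by (simp add: abs_mult power_abs)
  also have "\<dots> \<le> real n * (pi - x)"
    using abs_sin_x_le_abs_x[of "real n * (pi - x)"] assms by (simp add: abs_mult)
  finally show "\<bar>sin (real n * x)\<bar> \<le> real n * (pi - x)" .
qed

text \<open>Both the function and its derivative converge boundedly, pointwise in the open interval. This is what
  places the sines in \<open>H1_0\<close> and lets them serve as test functions in the definition of a weak derivative.\<close>

lemma sine_cutoff_approximation:
  fixes n :: nat
  defines "w \<equiv> \<lambda>k x. cutoff k x * sin (real n * x)"
  shows "test_function (w k)"
    and "(\<lambda>k. L2_norm (\<lambda>x. w k x - sin (real n * x))) \<longlonglongrightarrow> 0"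
    and "(\<lambda>k. L2_norm (\<lambda>x. deriv (w k) x - real n * cos (real n * x))) \<longlonglongrightarrow> 0"
proof -
  show test: "test_function (w k)" for k
    unfolding w_def by (intro test_function_cutoff_mult smooth_sin)
  have d: "deriv (w k) x = cutoff' k x * sin (real n * x) + cutoff k x * (real n * cos (real n * x))" for k x
    unfolding w_def by (rule DERIV_imp_deriv) (auto intro!: derivative_eq_intros cutoff_derivative)
  have c: "continuous_on {0..pi} (w k)" "continuous_on {0..pi} (deriv (w k))" for k
    using test_function_smooth[OF test[of k]] by (auto intro: smooth_continuous smooth_deriv)
  show "(\<lambda>k. L2_norm (\<lambda>x. w k x - sin (real n * x))) \<longlonglongrightarrow> 0"
  proof (rule L2_norm_dominated_convergence[OF _ _ L2_const[of 1]])
    show "w k \<in> borel_measurable I\<pi>" for k by (intro continuous_measurable_I\<pi> c)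
    show "(\<lambda>x. sin (real n * x)) \<in> L2" by (intro continuous_in_L2 continuous_intros)
    show "\<bar>w k x\<bar> \<le> 1" for k x
      unfolding w_def abs_mult using cutoff_bounds[of k x] by (intro mult_le_one) auto
    show "AE x in I\<pi>. (\<lambda>k. w k x) \<longlonglongrightarrow> sin (real n * x)"
    proof (rule AE_I2)
      fix x assume "x \<in> space I\<pi>"
      then have "\<forall>\<^sub>F k in sequentially. w k x = sin (real n * x)"
        using eventually_mono[OF cutoff_eventually[of x]] by (simp add: w_def)
      then show "(\<lambda>k. w k x) \<longlonglongrightarrow> sin (real n * x)" by (rule tendsto_eventually)
    qed
  qed
  obtain M where M: "\<And>k x f. \<lbrakk>x \<in> {0<..<pi}; \<bar>f\<bar> \<le> real n * x; \<bar>f\<bar> \<le> real n * (pi - x); real n \<ge> 0\<rbrakk>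
      \<Longrightarrow> \<bar>cutoff' k x * f\<bar> \<le> M * real n"
    using cutoff'_bound[of "real n"] by blast
  show "(\<lambda>k. L2_norm (\<lambda>x. deriv (w k) x - real n * cos (real n * x))) \<longlonglongrightarrow> 0"
  proof (rule L2_norm_dominated_convergence[OF _ _ L2_const[of "M * real n + real n"]])
    show "deriv (w k) \<in> borel_measurable I\<pi>" for k by (intro continuous_measurable_I\<pi> c)
    show "(\<lambda>x. real n * cos (real n * x)) \<in> L2" by (intro continuous_in_L2 continuous_intros)
    show "\<bar>deriv (w k) x\<bar> \<le> M * real n + real n" if "x \<in> {0<..<pi}" for k x
    proof -
      have "\<bar>cutoff' k x * sin (real n * x)\<bar> \<le> M * real n"
        using that abs_sin_le_dist_boundary[of x n] by (intro M) auto
      moreover have "\<bar>cutoff k x * (real n * cos (real n * x))\<bar> \<le> 1 * (real n * 1)"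
        unfolding abs_mult using cutoff_bounds[of k x] by (intro mult_mono) auto
      ultimately show ?thesis unfolding d by linarith
    qed
    show "AE x in I\<pi>. (\<lambda>k. deriv (w k) x) \<longlonglongrightarrow> real n * cos (real n * x)"
    proof (rule AE_I2)
      fix x assume "x \<in> space I\<pi>"
      then have "\<forall>\<^sub>F k in sequentially. deriv (w k) x = real n * cos (real n * x)"
        using eventually_mono[OF cutoff_eventually[of x]] by (simp add: d)
      then show "(\<lambda>k. deriv (w k) x) \<longlonglongrightarrow> real n * cos (real n * x)" by (rule tendsto_eventually)
    qed
  qed
qed

lemma sin_multiple_in_L2: "(\<lambda>x. sin (c * x)) \<in> L2" and cos_multiple_in_L2: "(\<lambda>x. cos (c * x)) \<in> L2"
  by (intro continuous_in_L2 continuous_intros)+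

text \<open>Sines are limits of test functions and form a complete system, so a function orthogonal to all
  test functions has vanishing sine coefficients.\<close>

lemma orthogonal_test_functions_imp_AE_0:
  assumes g: "g \<in> L2" and orth: "\<And>w. test_function w \<Longrightarrow> (LINT x|I\<pi>. g x * w x) = 0"
  shows "AE x in I\<pi>. g x = 0"
proof -
  have "(LINT x|I\<pi>. g x * sines n x) = 0" for n
  proof -
    let ?w = "\<lambda>k x. cutoff k x * sin (real (Suc n) * x)"
    have "(\<lambda>k. LINT x|I\<pi>. ?w k x * g x) \<longlonglongrightarrow> (LINT x|I\<pi>. sin (real (Suc n) * x) * g x)"
      by (intro L2_norm_tendsto_integral sine_cutoff_approximation smooth_in_L2 test_function_smooth
          sin_multiple_in_L2 g)
    moreover have "(LINT x|I\<pi>. ?w k x * g x) = 0" for k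
      using orth[OF sine_cutoff_approximation(1)[of k "Suc n"]] by (simp only: mult.commute)
    ultimately have "(\<lambda>k :: nat. 0) \<longlonglongrightarrow> (LINT x|I\<pi>. sin (real (Suc n) * x) * g x)" by (simp only:)
    from LIMSEQ_unique[OF this tendsto_const] show ?thesis
      by (simp only: sines_def mult.commute)
  qed
  then have "(\<lambda>n. 0) sums (L2_norm g)\<^sup>2" using Parseval_sines[OF g] by simp
  from sums_unique2[OF this sums_zero] have "(LINT x|I\<pi>. (g x)\<^sup>2) = 0" by (simp only: L2_norm_power2)
  then have "AE x in I\<pi>. (g x)\<^sup>2 = 0"
    using integral_nonneg_eq_0_iff_AE[OF L2_square_integrable[OF g]] by simp
  then show ?thesis by simp
qed

lemma weak_deriv_unique:
  assumes "g1 \<in> L2" "g2 \<in> L2" "has_weak_deriv f g1" "has_weak_deriv f g2"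
  shows "AE x in I\<pi>. g1 x = g2 x"
proof -
  have "AE x in I\<pi>. g1 x - g2 x = 0"
  proof (rule orthogonal_test_functions_imp_AE_0[OF L2_diff[OF assms(1,2)]])
    fix w assume w: "test_function w"
    then have "w \<in> L2" by (intro smooth_in_L2 test_function_smooth)
    then show "(LINT x|I\<pi>. (g1 x - g2 x) * w x) = 0"
      using assms w by (simp add: left_diff_distrib L2_mult_integrable has_weak_deriv_def)
  qed
  then show ?thesis by simp
qed

lemma wderiv_properties:
  assumes "f \<in> H1" shows "wderiv f \<in> L2" "has_weak_deriv f (wderiv f)"
  using someI_ex[of "\<lambda>g. g \<in> L2 \<and> has_weak_deriv f g"] assms
  unfolding H1_def wderiv_def by auto

lemma H1_I: "f \<in> L2 \<Longrightarrow> g \<in> L2 \<Longrightarrow> has_weak_deriv f g \<Longrightarrow> f \<in> H1"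
  by (auto simp: H1_def)

lemma H1_in_L2: "f \<in> H1 \<Longrightarrow> f \<in> L2"
  by (simp add: H1_def)

lemma wderiv_AE_eq:
  assumes "f \<in> L2" "g \<in> L2" "has_weak_deriv f g" shows "AE x in I\<pi>. wderiv f x = g x"
  using weak_deriv_unique[OF _ assms(2) _ assms(3)] wderiv_properties[OF H1_I[OF assms]] by blast

lemma has_weak_deriv_diff:
  assumes "f1 \<in> L2" "f2 \<in> L2" "g1 \<in> L2" "g2 \<in> L2" "has_weak_deriv f1 g1" "has_weak_deriv f2 g2"
  shows "has_weak_deriv (\<lambda>x. f1 x - f2 x) (\<lambda>x. g1 x - g2 x)"
  unfolding has_weak_deriv_def
proof (intro allI impI)
  fix w assume w: "test_function w"
  have s: "w \<in> L2" "deriv w \<in> L2"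
    using test_function_smooth[OF w] by (auto intro: smooth_in_L2 smooth_deriv)
  show "(LINT x|I\<pi>. (f1 x - f2 x) * deriv w x) = - (LINT x|I\<pi>. (g1 x - g2 x) * w x)"
    using assms w s by (simp add: left_diff_distrib L2_mult_integrable has_weak_deriv_def)
qed

lemma integral_mult_AE_cong:
  assumes "f \<in> L2" "g \<in> L2" "h \<in> L2" "AE x in I\<pi>. f x = g x"
  shows "(LINT x|I\<pi>. h x * f x) = (LINT x|I\<pi>. h x * g x)"
  using assms by (intro integral_cong_AE) (auto simp: L2_def)

lemma wderiv_C1_AE:
  assumes "\<And>x. (f has_real_derivative f' x) (at x)" "continuous_on {0..pi} f'"
  shows "f \<in> H1" "AE x in I\<pi>. wderiv f x = f' x"
proof -
  have "continuous_on {0..pi} f" using assms(1) by (meson DERIV_continuous_on has_field_derivative_at_within)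
  then have L: "f \<in> L2" "f' \<in> L2" using assms(2) by (auto intro: continuous_in_L2)
  then show "f \<in> H1" using has_weak_deriv_C1[OF assms] by (rule H1_I)
  show "AE x in I\<pi>. wderiv f x = f' x" using L has_weak_deriv_C1[OF assms] by (rule wderiv_AE_eq)
qed

lemma sin_in_H1: "(\<lambda>x. sin (c * x)) \<in> H1"
  and wderiv_sin: "AE x in I\<pi>. wderiv (\<lambda>x. sin (c * x)) x = c * cos (c * x)"
  by (rule wderiv_C1_AE[where f' = "\<lambda>x. c * cos (c * x)"];
      auto intro!: derivative_eq_intros continuous_intros)+

lemma cos_in_H1: "(\<lambda>x. cos (c * x)) \<in> H1"
  and wderiv_cos: "AE x in I\<pi>. wderiv (\<lambda>x. cos (c * x)) x = - c * sin (c * x)"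
  by (rule wderiv_C1_AE[where f' = "\<lambda>x. - c * sin (c * x)"];
      auto intro!: derivative_eq_intros continuous_intros)+

lemma H1_norm_diff_test_function:
  assumes "f \<in> H1" "test_function w"
  shows "H1_norm (\<lambda>x. f x - w x) = sqrt ((L2_norm (\<lambda>x. f x - w x))\<^sup>2 + (L2_norm (\<lambda>x. wderiv f x - deriv w x))\<^sup>2)"
proof -
  note s = test_function_smooth[OF assms(2)]
  have w: "w \<in> L2" "deriv w \<in> L2" "has_weak_deriv w (deriv w)"
    using s by (auto intro: smooth_in_L2 smooth_deriv has_weak_deriv_C1 smooth_differentiable smooth_continuous)
  note f = H1_in_L2[OF assms(1)] wderiv_properties[OF assms(1)]
  have D: "(\<lambda>x. f x - w x) \<in> L2" "(\<lambda>x. wderiv f x - deriv w x) \<in> L2"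
      "has_weak_deriv (\<lambda>x. f x - w x) (\<lambda>x. wderiv f x - deriv w x)"
    using f w by (auto intro: L2_diff has_weak_deriv_diff)
  have "L2_norm (wderiv (\<lambda>x. f x - w x)) = L2_norm (\<lambda>x. wderiv f x - deriv w x)"
    by (rule L2_norm_cong_AE[OF wderiv_properties(1)[OF H1_I[OF D]] D(2) wderiv_AE_eq[OF D]])
  then show ?thesis
    by (simp add: H1_norm_def)
qed

lemma sin_in_H1_0: "(\<lambda>x. sin (real n * x)) \<in> H1_0"
  unfolding H1_0_def
proof (intro CollectI conjI allI impI sin_in_H1)
  fix e :: real assume "e > 0"
  let ?w = "\<lambda>k x. cutoff k x * sin (real n * x)"
  note test = sine_cutoff_approximation(1)[of _ n]
  have eq: "H1_norm (\<lambda>x. sin (real n * x) - ?w k x) = sqrt ((L2_norm (\<lambda>x. ?w k x - sin (real n * x)))\<^sup>2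
      + (L2_norm (\<lambda>x. deriv (?w k) x - real n * cos (real n * x)))\<^sup>2)" for k
  proof -
    have "deriv (?w k) \<in> L2" using test[of k] by (intro smooth_in_L2 smooth_deriv test_function_smooth)
    then have "L2_norm (\<lambda>x. wderiv (\<lambda>x. sin (real n * x)) x - deriv (?w k) x)
        = L2_norm (\<lambda>x. real n * cos (real n * x) - deriv (?w k) x)"
      using wderiv_sin[of "real n"]
      by (intro L2_norm_cong_AE L2_diff wderiv_properties(1) sin_in_H1 L2_cmult cos_multiple_in_L2)
        (auto elim: eventually_mono)
    then show ?thesis
      unfolding H1_norm_diff_test_function[OF sin_in_H1 test] by (simp add: L2_norm_def power2_commute)
  qed
  have "(\<lambda>k. sqrt ((L2_norm (\<lambda>x. ?w k x - sin (real n * x)))\<^sup>2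
      + (L2_norm (\<lambda>x. deriv (?w k) x - real n * cos (real n * x)))\<^sup>2)) \<longlonglongrightarrow> sqrt (0\<^sup>2 + 0\<^sup>2)"
    by (intro tendsto_intros sine_cutoff_approximation)
  then have "(\<lambda>k. H1_norm (\<lambda>x. sin (real n * x) - ?w k x)) \<longlonglongrightarrow> 0" by (simp add: eq)
  from order_tendstoD(2)[OF this \<open>e > 0\<close>]
  obtain k where "H1_norm (\<lambda>x. sin (real n * x) - ?w k x) < e"
    by (auto simp: eventually_sequentially)
  then show "\<exists>w. test_function w \<and> H1_norm (\<lambda>x. sin (real n * x) - w x) < e" using test by blast
qed

text \<open>The boundary terms of the integration by parts vanish because of the sine, for every \<open>f\<close> in \<open>H1\<close>.\<close>

lemma sine_coefficient_wderiv:
  assumes f: "f \<in> H1"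
  shows "(LINT x|I\<pi>. wderiv f x * sin (real n * x)) = - (real n * (LINT x|I\<pi>. f x * cos (real n * x)))"
proof -
  let ?w = "\<lambda>k x. cutoff k x * sin (real n * x)"
  note test = sine_cutoff_approximation(1)[of _ n]
  have s: "?w k \<in> L2" "deriv (?w k) \<in> L2" for k
    using test_function_smooth[OF test[of k]] by (auto intro: smooth_in_L2 smooth_deriv)
  have "(\<lambda>k. LINT x|I\<pi>. ?w k x * wderiv f x) \<longlonglongrightarrow> (LINT x|I\<pi>. sin (real n * x) * wderiv f x)"
    by (intro L2_norm_tendsto_integral s sine_cutoff_approximation sin_multiple_in_L2 wderiv_properties f)
  moreover have "(\<lambda>k. LINT x|I\<pi>. deriv (?w k) x * f x) \<longlonglongrightarrow> (LINT x|I\<pi>. real n * cos (real n * x) * f x)"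
    by (intro L2_norm_tendsto_integral s sine_cutoff_approximation L2_cmult cos_multiple_in_L2 H1_in_L2 f)
  moreover have "(LINT x|I\<pi>. ?w k x * wderiv f x) = - (LINT x|I\<pi>. deriv (?w k) x * f x)" for k
    using wderiv_properties(2)[OF f] test[of k] by (simp add: has_weak_deriv_def mult.commute)
  ultimately have "(LINT x|I\<pi>. sin (real n * x) * wderiv f x) = - (LINT x|I\<pi>. real n * cos (real n * x) * f x)"
    by (simp only:) (rule LIMSEQ_unique, assumption, rule tendsto_minus)
  then show ?thesis by (simp add: mult_ac)
qed

text \<open>Here the boundary terms vanish because of \<open>f\<close>, which is a limit of test functions. For \<open>n = 0\<close> this
  says that \<open>wderiv f\<close> has zero mean.\<close>

lemma cosine_coefficient_wderiv:
  assumes f: "f \<in> H1_0"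
  shows "(LINT x|I\<pi>. wderiv f x * cos (real n * x)) = real n * (LINT x|I\<pi>. f x * sin (real n * x))"
proof -
  have f1: "f \<in> H1" using f by (simp add: H1_0_def)
  have "\<exists>w. test_function w \<and> H1_norm (\<lambda>x. f x - w x) < 1 / real (Suc k)" for k
    using f unfolding H1_0_def by simp
  then obtain w where test: "\<And>k. test_function (w k)"
    and close: "\<And>k. H1_norm (\<lambda>x. f x - w k x) < 1 / real (Suc k)" by metis
  have s: "w k \<in> L2" "deriv (w k) \<in> L2" for k
    using test_function_smooth[OF test[of k]] by (auto intro: smooth_in_L2 smooth_deriv)
  have norms: "L2_norm (\<lambda>x. w k x - f x) \<le> 1 / real (Suc k)"
    "L2_norm (\<lambda>x. deriv (w k) x - wderiv f x) \<le> 1 / real (Suc k)" for k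
  proof -
    have c: "L2_norm (\<lambda>x. g x - h x) = L2_norm (\<lambda>x. h x - g x)" for g h
      by (simp add: L2_norm_def power2_commute)
    have "L2_norm (\<lambda>x. f x - w k x) \<le> H1_norm (\<lambda>x. f x - w k x)"
      "L2_norm (\<lambda>x. wderiv f x - deriv (w k) x) \<le> H1_norm (\<lambda>x. f x - w k x)"
      unfolding H1_norm_diff_test_function[OF f1 test] by (rule real_le_rsqrt, simp)+
    then show "L2_norm (\<lambda>x. w k x - f x) \<le> 1 / real (Suc k)"
      "L2_norm (\<lambda>x. deriv (w k) x - wderiv f x) \<le> 1 / real (Suc k)"
      using close[of k] c[of "w k" f] c[of "deriv (w k)" "wderiv f"] by linarith+
  qed
  have lim0: "(\<lambda>k. 1 / real (Suc k)) \<longlonglongrightarrow> 0" by (rule LIMSEQ_Suc[OF lim_1_over_n])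
  have l1: "(\<lambda>k. L2_norm (\<lambda>x. w k x - f x)) \<longlonglongrightarrow> 0"
    by (rule tendsto_sandwich[OF _ _ tendsto_const lim0]) (auto simp: norms simp del: of_nat_Suc)
  have l2: "(\<lambda>k. L2_norm (\<lambda>x. deriv (w k) x - wderiv f x)) \<longlonglongrightarrow> 0"
    by (rule tendsto_sandwich[OF _ _ tendsto_const lim0]) (auto simp: norms simp del: of_nat_Suc)
  have "(\<lambda>k. LINT x|I\<pi>. w k x * (real n * sin (real n * x))) \<longlonglongrightarrow> (LINT x|I\<pi>. f x * (real n * sin (real n * x)))"
    by (intro L2_norm_tendsto_integral s l1 L2_cmult sin_multiple_in_L2 H1_in_L2 f1)
  moreover have "(\<lambda>k. LINT x|I\<pi>. deriv (w k) x * cos (real n * x)) \<longlonglongrightarrow> (LINT x|I\<pi>. wderiv f x * cos (real n * x))"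
    by (intro L2_norm_tendsto_integral s l2 cos_multiple_in_L2 wderiv_properties f1)
  moreover have "(LINT x|I\<pi>. deriv (w k) x * cos (real n * x)) = (LINT x|I\<pi>. w k x * (real n * sin (real n * x)))" for k
  proof -
    note sm = test_function_smooth[OF test[of k]]
    have "(LINT x|I\<pi>. cos (real n * x) * deriv (w k) x) = - (LINT x|I\<pi>. (- real n * sin (real n * x)) * w k x)"
      using test_function_support[OF test[of k], of 0] test_function_support[OF test[of k], of pi]
      by (intro integrate_by_parts)
        (auto intro!: derivative_eq_intros continuous_intros smooth_differentiable[OF sm]
          smooth_continuous[OF smooth_deriv[OF sm]])
    then show ?thesis by (simp add: mult_ac)
  qed
  ultimately have "(LINT x|I\<pi>. f x * (real n * sin (real n * x))) = (LINT x|I\<pi>. wderiv f x * cos (real n * x))"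
    by (simp add: LIMSEQ_unique)
  then show ?thesis by (simp add: mult.left_commute[of _ "real n"])
qed

section \<open>The equations of a single Fourier mode\<close>

text \<open>For large \<open>N\<close> the combination \<open>N E + L\<close> is equivalent to \<open>S\<close>, because \<open>E\<close> is and \<open>L\<close> is bounded by
  \<open>S\<close>, and the dissipation of \<open>N E\<close> absorbs the positive term of \<open>L'\<close>. Hence its derivative is at most a
  negative multiple of itself. The resulting constants are explicit so that they can be seen to be the same for
  all modes.\<close>

lemma lyapunov_exponential_decay:
  fixes E E' L L' D S :: "real \<Rightarrow> real"
  assumes E: "\<And>t. t \<ge> 0 \<Longrightarrow> (E has_real_derivative E' t) (at t within {0..})"
    and L: "\<And>t. t \<ge> 0 \<Longrightarrow> (L has_real_derivative L' t) (at t within {0..})"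
    and E': "\<And>t. t \<ge> 0 \<Longrightarrow> E' t \<le> - \<delta> * D t"
    and L': "\<And>t. t \<ge> 0 \<Longrightarrow> L' t \<le> - c * S t + K * D t"
    and LS: "\<And>t. t \<ge> 0 \<Longrightarrow> \<bar>L t\<bar> \<le> M * S t"
    and ES: "\<And>t. t \<ge> 0 \<Longrightarrow> e1 * S t \<le> E t" "\<And>t. t \<ge> 0 \<Longrightarrow> E t \<le> e2 * S t"
    and nonneg: "\<And>t. t \<ge> 0 \<Longrightarrow> 0 \<le> D t" "\<And>t. t \<ge> 0 \<Longrightarrow> 0 \<le> S t"
    and pos: "\<delta> > 0" "c > 0" "K \<ge> 0" "M \<ge> 0" "e1 > 0" "e2 > 0"
    and N: "N = (2 * M + 1) / e1 + K / \<delta>"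
    and t: "t \<ge> 0"
  shows "S t \<le> (N * e2 + M) * S 0 * exp (- (c / (N * e2 + M)) * t)"
proof -
  define V where "V t = N * E t + L t" for t
  define \<xi> where "\<xi> = c / (N * e2 + M)"
  have "2 * M + 1 > 0" using pos by linarith
  then have "(2 * M + 1) / e1 > 0" "K / \<delta> \<ge> 0" using pos by auto
  then have Npos: "N > 0" unfolding N by linarith
  have den: "N * e2 + M > 0" using Npos pos by (simp add: add_pos_nonneg)
  have Vlow: "S t \<le> V t" if "t \<ge> 0" for t
  proof -
    have "N * e1 = 2 * M + 1 + K / \<delta> * e1" unfolding N using pos by (simp add: field_simps)
    then have "N * e1 \<ge> 2 * M + 1" using pos by simp
    then have "(2 * M + 1) * S t \<le> N * e1 * S t" using nonneg(2)[OF that] by (rule mult_right_mono)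
    also have "\<dots> \<le> N * E t" using ES(1)[OF that] Npos by (simp add: mult.assoc)
    finally have "(2 * M + 1) * S t - M * S t \<le> V t"
      using LS[OF that] by (simp add: V_def)
    moreover have "0 \<le> M * S t" using nonneg(2)[OF that] pos by simp
    ultimately show ?thesis by (simp add: algebra_simps)
  qed
  have Vup: "V t \<le> (N * e2 + M) * S t" if "t \<ge> 0" for t
  proof -
    have "N * E t \<le> N * (e2 * S t)" using ES(2)[OF that] Npos by simp
    then show ?thesis using LS[OF that] by (simp add: V_def algebra_simps)
  qed
  have dV: "(V has_real_derivative N * E' t + L' t) (at t within {0..})" if "t \<ge> 0" for t
    unfolding V_def using E[OF that] L[OF that] by (auto intro!: derivative_eq_intros)
  have V': "N * E' t + L' t \<le> - \<xi> * V t" if "t \<ge> 0" for t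
  proof -
    have "K / \<delta> \<le> N" unfolding N using pos by simp
    then have KN: "K \<le> N * \<delta>" using pos by (simp add: field_simps)
    have "N * E' t \<le> N * (- \<delta> * D t)" using E'[OF that] Npos by (intro mult_left_mono) auto
    moreover have "K * D t \<le> N * \<delta> * D t" using KN nonneg(1)[OF that] by (rule mult_right_mono)
    ultimately have "N * E' t + L' t \<le> - c * S t" using L'[OF that] by (simp add: algebra_simps)
    moreover have "\<xi> * V t \<le> \<xi> * ((N * e2 + M) * S t)"
      using Vup[OF that] pos den by (intro mult_left_mono) (auto simp: \<xi>_def)
    moreover have "\<xi> * ((N * e2 + M) * S t) = c * S t" using den by (simp add: \<xi>_def)
    ultimately show ?thesis by simp
  qed
  define W where "W t = V t * exp (\<xi> * t)" for t
  have dW: "(W has_real_derivative (N * E' t + L' t + \<xi> * V t) * exp (\<xi> * t)) (at t within {0..})"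
    if "t \<ge> 0" for t
    unfolding W_def using dV[OF that] by (auto intro!: derivative_eq_intros simp: algebra_simps)
  have "W t \<le> W 0"
  proof (rule DERIV_nonpos_imp_decreasing_open[OF t])
    fix x assume x: "0 < x" "x < t"
    have "(W has_real_derivative (N * E' x + L' x + \<xi> * V x) * exp (\<xi> * x)) (at x)"
      using dW[of x] x at_within_interior[of x "{0..}"] by (simp add: interior_real_atLeast)
    moreover have "(N * E' x + L' x + \<xi> * V x) * exp (\<xi> * x) \<le> 0"
      using V'[of x] x by (intro mult_nonpos_nonneg) auto
    ultimately show "\<exists>y. (W has_real_derivative y) (at x) \<and> y \<le> 0" by blast
  next
    have "continuous_on {0..} W" using dW by (intro DERIV_continuous_on) auto
    then show "continuous_on {0..t} W" by (rule continuous_on_subset) auto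
  qed
  then have "V t * exp (\<xi> * t) \<le> V 0" by (simp add: W_def)
  then have "V t \<le> V 0 * exp (- (\<xi> * t))" by (simp add: exp_minus field_simps)
  also have "\<dots> \<le> (N * e2 + M) * S 0 * exp (- (\<xi> * t))" using Vup[of 0] by simp
  finally show ?thesis using Vlow[OF t] by (simp add: \<xi>_def)
qed

lemma young: "x * y \<le> \<epsilon> * x\<^sup>2 + y\<^sup>2 / (4 * \<epsilon>)" if "\<epsilon> > 0" for x y \<epsilon> :: real
proof -
  have "0 \<le> (2 * \<epsilon> * x - y)\<^sup>2 / (4 * \<epsilon>)" using that by simp
  also have "\<dots> = \<epsilon> * x\<^sup>2 + y\<^sup>2 / (4 * \<epsilon>) - x * y"
    using that by (simp add: field_simps power2_eq_square)
  finally show ?thesis by simp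
qed

lemma bilinear_bound2:
  fixes x1 x2 y1 y2 :: real
  shows "\<bar>c11 * (x1 * y1) + c12 * (x1 * y2) + c21 * (x2 * y1) + c22 * (x2 * y2)\<bar>
    \<le> (\<bar>c11\<bar> + \<bar>c12\<bar> + \<bar>c21\<bar> + \<bar>c22\<bar>) * (sqrt (x1\<^sup>2 + x2\<^sup>2) * sqrt (y1\<^sup>2 + y2\<^sup>2))"
proof -
  have b: "\<bar>c * (x * y)\<bar> \<le> \<bar>c\<bar> * (sqrt (x1\<^sup>2 + x2\<^sup>2) * sqrt (y1\<^sup>2 + y2\<^sup>2))"
    if "x = x1 \<or> x = x2" "y = y1 \<or> y = y2" for c x y
    unfolding abs_mult using that by (intro mult_left_mono mult_mono) auto
  have "\<bar>c11 * (x1 * y1) + c12 * (x1 * y2) + c21 * (x2 * y1) + c22 * (x2 * y2)\<bar>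
    \<le> \<bar>c11 * (x1 * y1)\<bar> + \<bar>c12 * (x1 * y2)\<bar> + \<bar>c21 * (x2 * y1)\<bar> + \<bar>c22 * (x2 * y2)\<bar>"
    by linarith
  also have "\<dots> \<le> (\<bar>c11\<bar> + \<bar>c12\<bar> + \<bar>c21\<bar> + \<bar>c22\<bar>) * (sqrt (x1\<^sup>2 + x2\<^sup>2) * sqrt (y1\<^sup>2 + y2\<^sup>2))"
    unfolding distrib_right by (intro add_mono b) auto
  finally show ?thesis .
qed

lemma linear_bound2:
  fixes x1 x2 :: real
  shows "\<bar>c1 * x1 + c2 * x2\<bar> \<le> (\<bar>c1\<bar> + \<bar>c2\<bar>) * sqrt (x1\<^sup>2 + x2\<^sup>2)"
  using bilinear_bound2[of c1 x1 1 0 0 c2 x2 0] by simp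

text \<open>The coefficients of the system, with coercivity constants \<open>c0\<close> of the elastic and \<open>\<delta>\<close> of the damping
  form. In the first form, \<open>X\<close>, \<open>P\<close> and \<open>Q\<close> stand for the spatial derivatives of \<open>u\<close>, \<open>\<phi>\<close> and \<open>\<psi>\<close>.\<close>

locale modal_system =
  fixes \<rho> \<kappa>1 \<kappa>2 \<mu> \<alpha> \<gamma> \<beta> b d \<alpha>1 \<alpha>2 \<alpha>3 \<tau>1 \<tau>2 \<tau>3 \<tau>4 c0 \<delta> :: real
  assumes pos: "\<rho> > 0" "\<kappa>1 > 0" "\<kappa>2 > 0" "\<mu> > 0" "c0 > 0" "\<delta> > 0"
    and coupled: "\<not> (b = 0 \<and> d = 0)"
    and elastic: "\<And>X p q P Q. c0 * (X\<^sup>2 + p\<^sup>2 + q\<^sup>2 + P\<^sup>2 + Q\<^sup>2)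
      \<le> \<mu> * X\<^sup>2 + 2 * X * (b * p + d * q) + (\<alpha>1 * p\<^sup>2 + 2 * \<alpha>3 * p * q + \<alpha>2 * q\<^sup>2)
        + (\<alpha> * P\<^sup>2 + 2 * \<beta> * P * Q + \<gamma> * Q\<^sup>2)"
    and damping: "\<And>r s. \<delta> * (r\<^sup>2 + s\<^sup>2) \<le> \<tau>1 * r\<^sup>2 + (\<tau>2 + \<tau>3) * r * s + \<tau>4 * s\<^sup>2"
begin

text \<open>Here \<open>a\<close> is the sine coefficient of \<open>u\<close>, \<open>p\<close> and \<open>q\<close> are the cosine coefficients of \<open>\<phi>\<close> and \<open>\<psi>\<close>, and
  \<open>v\<close>, \<open>r\<close>, \<open>s\<close> are their velocities.\<close>

definition mode_solution where
  "mode_solution n a v p r q s \<longleftrightarrow> (\<forall>t\<ge>0.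
     (a has_real_derivative v t) (at t within {0..}) \<and>
     (p has_real_derivative r t) (at t within {0..}) \<and>
     (q has_real_derivative s t) (at t within {0..}) \<and>
     ((\<lambda>t. \<rho> * v t) has_real_derivative
       - n * (\<mu> * (n * a t) + b * p t + d * q t)) (at t within {0..}) \<and>
     ((\<lambda>t. \<kappa>1 * r t) has_real_derivative
       - n\<^sup>2 * (\<alpha> * p t + \<beta> * q t) - (b * (n * a t) + \<alpha>1 * p t + \<alpha>3 * q t + \<tau>1 * r t + \<tau>2 * s t))
       (at t within {0..}) \<and>
     ((\<lambda>t. \<kappa>2 * s t) has_real_derivative
       - n\<^sup>2 * (\<beta> * p t + \<gamma> * q t) - (d * (n * a t) + \<alpha>3 * p t + \<alpha>2 * q t + \<tau>3 * r t + \<tau>4 * s t))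
       (at t within {0..}))"

lemma mode_accelerations:
  assumes "mode_solution n a v p r q s"
  obtains A P Q where
    "\<And>t. t \<ge> 0 \<Longrightarrow> (a has_real_derivative v t) (at t within {0..})"
    "\<And>t. t \<ge> 0 \<Longrightarrow> (p has_real_derivative r t) (at t within {0..})"
    "\<And>t. t \<ge> 0 \<Longrightarrow> (q has_real_derivative s t) (at t within {0..})"
    "\<And>t. t \<ge> 0 \<Longrightarrow> (v has_real_derivative A t) (at t within {0..})"
    "\<And>t. t \<ge> 0 \<Longrightarrow> (r has_real_derivative P t) (at t within {0..})"
    "\<And>t. t \<ge> 0 \<Longrightarrow> (s has_real_derivative Q t) (at t within {0..})"
    "\<And>t. \<rho> * A t = - n * (\<mu> * (n * a t) + b * p t + d * q t)"
    "\<And>t. \<kappa>1 * P t = - n\<^sup>2 * (\<alpha> * p t + \<beta> * q t)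
       - (b * (n * a t) + \<alpha>1 * p t + \<alpha>3 * q t + \<tau>1 * r t + \<tau>2 * s t)"
    "\<And>t. \<kappa>2 * Q t = - n\<^sup>2 * (\<beta> * p t + \<gamma> * q t)
       - (d * (n * a t) + \<alpha>3 * p t + \<alpha>2 * q t + \<tau>3 * r t + \<tau>4 * s t)"
proof -
  have div: "(f has_real_derivative f' / k) (at t within {0..})"
    if "((\<lambda>t. k * f t) has_real_derivative f') (at t within {0..})" "k > 0" for f f' k t
    using DERIV_cdivide[OF that(1), of k] that(2) by simp
  show ?thesis
    using assms pos(1-3) unfolding mode_solution_def
    by (intro that[of "\<lambda>t. (- n * (\<mu> * (n * a t) + b * p t + d * q t)) / \<rho>"
      "\<lambda>t. (- n\<^sup>2 * (\<alpha> * p t + \<beta> * q t)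
        - (b * (n * a t) + \<alpha>1 * p t + \<alpha>3 * q t + \<tau>1 * r t + \<tau>2 * s t)) / \<kappa>1"
      "\<lambda>t. (- n\<^sup>2 * (\<beta> * p t + \<gamma> * q t)
        - (d * (n * a t) + \<alpha>3 * p t + \<alpha>2 * q t + \<tau>3 * r t + \<tau>4 * s t)) / \<kappa>2"] div) simp_all
qed

text \<open>The contribution of one mode to \<open>\<parallel>u\<^sub>x\<parallel>\<^sup>2 + \<parallel>u\<^sub>t\<parallel>\<^sup>2 + \<parallel>\<phi>\<^sub>x\<parallel>\<^sup>2 + \<parallel>\<psi>\<^sub>x\<parallel>\<^sup>2 + \<parallel>\<phi>\<^sub>t\<parallel>\<^sup>2 + \<parallel>\<psi>\<^sub>t\<parallel>\<^sup>2\<close>, up to a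
  factor that is the same for all modes.\<close>

definition mode_size :: "real \<Rightarrow> real \<Rightarrow> real \<Rightarrow> real \<Rightarrow> real \<Rightarrow> real \<Rightarrow> real \<Rightarrow> real" where
  "mode_size n a v p r q s = (n * a)\<^sup>2 + v\<^sup>2 + n\<^sup>2 * (p\<^sup>2 + q\<^sup>2) + r\<^sup>2 + s\<^sup>2"

definition mode_energy :: "real \<Rightarrow> real \<Rightarrow> real \<Rightarrow> real \<Rightarrow> real \<Rightarrow> real \<Rightarrow> real \<Rightarrow> real" where
  "mode_energy n a v p r q s = (\<rho> * v\<^sup>2 + \<kappa>1 * r\<^sup>2 + \<kappa>2 * s\<^sup>2
     + \<mu> * (n * a)\<^sup>2 + 2 * (n * a) * (b * p + d * q) + (\<alpha>1 * p\<^sup>2 + 2 * \<alpha>3 * p * q + \<alpha>2 * q\<^sup>2)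
     + n\<^sup>2 * (\<alpha> * p\<^sup>2 + 2 * \<beta> * p * q + \<gamma> * q\<^sup>2)) / 2"

lemma mode_potential_lower:
  "c0 * ((n * a)\<^sup>2 + n\<^sup>2 * (p\<^sup>2 + q\<^sup>2))
    \<le> \<mu> * (n * a)\<^sup>2 + 2 * (n * a) * (b * p + d * q) + (\<alpha>1 * p\<^sup>2 + 2 * \<alpha>3 * p * q + \<alpha>2 * q\<^sup>2)
      + n\<^sup>2 * (\<alpha> * p\<^sup>2 + 2 * \<beta> * p * q + \<gamma> * q\<^sup>2)"
proof -
  have "c0 * ((n * a)\<^sup>2 + n\<^sup>2 * (p\<^sup>2 + q\<^sup>2)) \<le> c0 * ((n * a)\<^sup>2 + p\<^sup>2 + q\<^sup>2 + (n * p)\<^sup>2 + (n * q)\<^sup>2)"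
    using pos by (intro mult_left_mono) (auto simp: algebra_simps power2_eq_square)
  also note elastic[of "n * a" p q "n * p" "n * q"]
  finally show ?thesis by (simp add: algebra_simps power2_eq_square)
qed

lemma mode_size_bounds:
  assumes "n \<ge> 1"
  shows "x \<in> {n * a, v, n * p, n * q, r, s, a, p, q} \<Longrightarrow> \<bar>x\<bar> \<le> sqrt (mode_size n a v p r q s)"
proof -
  have m: "\<bar>y\<bar> \<le> \<bar>n * y\<bar>" for y
    using mult_right_mono[of 1 "\<bar>n\<bar>" "\<bar>y\<bar>"] assms by (simp add: abs_mult)
  have b: "\<bar>x\<bar> \<le> sqrt (mode_size n a v p r q s)" if "x \<in> {n * a, v, n * p, n * q, r, s}" for x
  proof (rule real_le_rsqrt)
    show "\<bar>x\<bar>\<^sup>2 \<le> mode_size n a v p r q s"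
      using that by (auto simp: mode_size_def distrib_left simp flip: power_mult_distrib)
  qed
  then show "\<bar>x\<bar> \<le> sqrt (mode_size n a v p r q s)"
    if "x \<in> {n * a, v, n * p, n * q, r, s, a, p, q}"
  proof -
    have "x \<in> {n * a, v, n * p, n * q, r, s} \<or> x = a \<or> x = p \<or> x = q" using that by auto
    then show ?thesis
      using b[of x] order_trans[OF m[of a] b[of "n * a"]] order_trans[OF m[of p] b[of "n * p"]]
        order_trans[OF m[of q] b[of "n * q"]] by blast
  qed
qed

lemma mode_size_nonneg: "0 \<le> mode_size n a v p r q s"
  by (simp add: mode_size_def)

text \<open>Every functional used below is a combination of such products. The undifferentiated \<open>a\<close>, \<open>p\<close>, \<open>q\<close> are
  allowed as factors because \<open>n \<ge> 1\<close>.\<close>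

lemma mode_size_mult_bound:
  assumes "n \<ge> 1" "x \<in> {n * a, v, n * p, n * q, r, s, a, p, q}"
    "y \<in> {n * a, v, n * p, n * q, r, s, a, p, q}"
  shows "\<bar>c * (x * y)\<bar> \<le> \<bar>c\<bar> * mode_size n a v p r q s"
proof -
  have "\<bar>x\<bar> * \<bar>y\<bar> \<le> sqrt (mode_size n a v p r q s) * sqrt (mode_size n a v p r q s)"
    using assms by (intro mult_mono mode_size_bounds) (auto simp: mode_size_nonneg)
  then show ?thesis unfolding abs_mult by (intro mult_left_mono) (auto simp: mode_size_nonneg)
qed

lemma mode_energy_lower:
  assumes "e1 = min (min \<rho> c0) (min \<kappa>1 \<kappa>2) / 2"
  shows "e1 * mode_size n a v p r q s \<le> mode_energy n a v p r q s"
proof -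
  have "2 * e1 * v\<^sup>2 \<le> \<rho> * v\<^sup>2" "2 * e1 * r\<^sup>2 \<le> \<kappa>1 * r\<^sup>2" "2 * e1 * s\<^sup>2 \<le> \<kappa>2 * s\<^sup>2"
    "2 * e1 * ((n * a)\<^sup>2 + n\<^sup>2 * (p\<^sup>2 + q\<^sup>2)) \<le> c0 * ((n * a)\<^sup>2 + n\<^sup>2 * (p\<^sup>2 + q\<^sup>2))"
    unfolding assms by (intro mult_right_mono; simp)+
  moreover have "2 * e1 * mode_size n a v p r q s
     = 2 * e1 * v\<^sup>2 + 2 * e1 * r\<^sup>2 + 2 * e1 * s\<^sup>2 + 2 * e1 * ((n * a)\<^sup>2 + n\<^sup>2 * (p\<^sup>2 + q\<^sup>2))"
    by (simp add: mode_size_def algebra_simps)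
  moreover define W where "W = \<mu> * (n * a)\<^sup>2 + 2 * (n * a) * (b * p + d * q)
    + (\<alpha>1 * p\<^sup>2 + 2 * \<alpha>3 * p * q + \<alpha>2 * q\<^sup>2) + n\<^sup>2 * (\<alpha> * p\<^sup>2 + 2 * \<beta> * p * q + \<gamma> * q\<^sup>2)"
  moreover have "mode_energy n a v p r q s = (\<rho> * v\<^sup>2 + \<kappa>1 * r\<^sup>2 + \<kappa>2 * s\<^sup>2 + W) / 2"
    by (simp add: mode_energy_def W_def)
  ultimately show ?thesis using mode_potential_lower[of n a p q, folded W_def] by simp
qed

lemma mode_energy_upper:
  assumes "n \<ge> 1"
    and "e2 = \<bar>\<rho>\<bar> + \<bar>\<kappa>1\<bar> + \<bar>\<kappa>2\<bar> + \<bar>\<mu>\<bar> + \<bar>2 * b\<bar> + \<bar>2 * d\<bar> + \<bar>\<alpha>1\<bar> + \<bar>2 * \<alpha>3\<bar> + \<bar>\<alpha>2\<bar> + \<bar>\<alpha>\<bar> + \<bar>2 * \<beta>\<bar> + \<bar>\<gamma>\<bar>"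
  shows "mode_energy n a v p r q s \<le> e2 * mode_size n a v p r q s"
proof -
  let ?S = "mode_size n a v p r q s"
  have b: "c * (x * y) \<le> \<bar>c\<bar> * ?S"
    if "x \<in> {n * a, v, n * p, n * q, r, s, a, p, q}" "y \<in> {n * a, v, n * p, n * q, r, s, a, p, q}" for c x y
    using mode_size_mult_bound[OF assms(1) that, of c] by linarith
  have "2 * mode_energy n a v p r q s = \<rho> * (v * v) + \<kappa>1 * (r * r) + \<kappa>2 * (s * s)
     + \<mu> * ((n * a) * (n * a)) + 2 * b * ((n * a) * p) + 2 * d * ((n * a) * q)
     + \<alpha>1 * (p * p) + 2 * \<alpha>3 * (p * q) + \<alpha>2 * (q * q)
     + \<alpha> * ((n * p) * (n * p)) + 2 * \<beta> * ((n * p) * (n * q)) + \<gamma> * ((n * q) * (n * q))"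
    by (simp add: mode_energy_def power2_eq_square algebra_simps)
  also have "\<dots> \<le> e2 * ?S"
    unfolding assms(2) distrib_right by (intro add_mono b) auto
  finally have "2 * mode_energy n a v p r q s \<le> e2 * ?S" .
  moreover have "0 \<le> e2 * ?S"
    unfolding assms(2) by (intro mult_nonneg_nonneg mode_size_nonneg) simp
  ultimately show ?thesis by linarith
qed

lemma mode_energy_deriv:
  assumes "mode_solution n a v p r q s"
  obtains E' where "\<And>t. t \<ge> 0 \<Longrightarrow>
      ((\<lambda>t. mode_energy n (a t) (v t) (p t) (r t) (q t) (s t)) has_real_derivative E' t) (at t within {0..})"
    "\<And>t. E' t \<le> - \<delta> * ((r t)\<^sup>2 + (s t)\<^sup>2)"
proof -
  obtain A P Q where *:
    "\<And>t. t \<ge> 0 \<Longrightarrow> (a has_real_derivative v t) (at t within {0..})"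
    "\<And>t. t \<ge> 0 \<Longrightarrow> (p has_real_derivative r t) (at t within {0..})"
    "\<And>t. t \<ge> 0 \<Longrightarrow> (q has_real_derivative s t) (at t within {0..})"
    "\<And>t. t \<ge> 0 \<Longrightarrow> (v has_real_derivative A t) (at t within {0..})"
    "\<And>t. t \<ge> 0 \<Longrightarrow> (r has_real_derivative P t) (at t within {0..})"
    "\<And>t. t \<ge> 0 \<Longrightarrow> (s has_real_derivative Q t) (at t within {0..})"
    and A: "\<And>t. \<rho> * A t = - n * (\<mu> * (n * a t) + b * p t + d * q t)"
    and P: "\<And>t. \<kappa>1 * P t = - n\<^sup>2 * (\<alpha> * p t + \<beta> * q t)
       - (b * (n * a t) + \<alpha>1 * p t + \<alpha>3 * q t + \<tau>1 * r t + \<tau>2 * s t)"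
    and Q: "\<And>t. \<kappa>2 * Q t = - n\<^sup>2 * (\<beta> * p t + \<gamma> * q t)
       - (d * (n * a t) + \<alpha>3 * p t + \<alpha>2 * q t + \<tau>3 * r t + \<tau>4 * s t)"
    using mode_accelerations[OF assms] by blast
  let ?E' = "\<lambda>t. v t * (\<rho> * A t) + r t * (\<kappa>1 * P t) + s t * (\<kappa>2 * Q t)
       + \<mu> * n\<^sup>2 * a t * v t + n * v t * (b * p t + d * q t) + n * a t * (b * r t + d * s t)
       + \<alpha>1 * p t * r t + \<alpha>3 * (r t * q t + p t * s t) + \<alpha>2 * q t * s t
       + n\<^sup>2 * (\<alpha> * p t * r t + \<beta> * (r t * q t + p t * s t) + \<gamma> * q t * s t)"
  show ?thesis
  proof (rule that)
    fix t :: real assume t: "t \<ge> 0"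
    have "((\<lambda>t. \<rho> * (v t)\<^sup>2 + \<kappa>1 * (r t)\<^sup>2 + \<kappa>2 * (s t)\<^sup>2
       + \<mu> * (n * a t)\<^sup>2 + 2 * (n * a t) * (b * p t + d * q t)
       + (\<alpha>1 * (p t)\<^sup>2 + 2 * \<alpha>3 * p t * q t + \<alpha>2 * (q t)\<^sup>2)
       + n\<^sup>2 * (\<alpha> * (p t)\<^sup>2 + 2 * \<beta> * p t * q t + \<gamma> * (q t)\<^sup>2)) has_real_derivative 2 * ?E' t)
         (at t within {0..})"
      by (rule *[OF t] derivative_eq_intros refl)+ (simp add: power2_eq_square algebra_simps)
    from DERIV_cdivide[OF this, of 2]
    show "((\<lambda>t. mode_energy n (a t) (v t) (p t) (r t) (q t) (s t)) has_real_derivative ?E' t)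
        (at t within {0..})"
      by (simp only: mode_energy_def nonzero_mult_div_cancel_left[OF zero_neq_numeral[symmetric]])
  next
    fix t
    have "?E' t = - (\<tau>1 * (r t)\<^sup>2 + (\<tau>2 + \<tau>3) * r t * s t + \<tau>4 * (s t)\<^sup>2)"
      unfolding A P Q by (simp add: power2_eq_square algebra_simps)
    then show "?E' t \<le> - \<delta> * ((r t)\<^sup>2 + (s t)\<^sup>2)" using damping[of "r t" "s t"] by simp
  qed
qed

section \<open>A Lyapunov functional for high frequencies\<close>

text \<open>The constants are arguments, so that one choice of them can be shown to serve many frequencies at once.\<close>

definition lyapunov_bounds :: "real \<Rightarrow> real \<Rightarrow> real \<Rightarrow> real \<Rightarrow> bool" where
  "lyapunov_bounds n c K M \<longleftrightarrow> (\<forall>a v p r q s. mode_solution n a v p r q s \<longrightarrow>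
     (\<exists>L L'. \<forall>t\<ge>0. (L has_real_derivative L' t) (at t within {0..}) \<and>
       \<bar>L t\<bar> \<le> M * mode_size n (a t) (v t) (p t) (r t) (q t) (s t) \<and>
       L' t \<le> - c * mode_size n (a t) (v t) (p t) (r t) (q t) (s t) + K * ((r t)\<^sup>2 + (s t)\<^sup>2)))"

lemma elastic_gradient_lower: "c0 * (P\<^sup>2 + Q\<^sup>2) \<le> \<alpha> * P\<^sup>2 + 2 * \<beta> * P * Q + \<gamma> * Q\<^sup>2"
  using elastic[of 0 0 0 P Q] by simp

lemma elastic_order_zero_nonneg: "0 \<le> \<alpha>1 * p\<^sup>2 + 2 * \<alpha>3 * p * q + \<alpha>2 * q\<^sup>2"
proof -
  have "0 \<le> c0 * (0\<^sup>2 + p\<^sup>2 + q\<^sup>2 + 0\<^sup>2 + 0\<^sup>2)" using pos by simp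
  also note elastic[of 0 p q 0 0]
  finally show ?thesis by simp
qed

text \<open>The expression to be bounded below is \<open>- L'\<close> for the functional of the next lemma, with \<open>X\<close> for \<open>n a\<close>.
  Its positive terms are of full order in \<open>n\<close>. The product \<open>(B \<bullet> y) z\<close> is of the order \<open>n\<^sup>2 \<bar>y\<bar>\<^sup>2\<close> and is absorbed
  by the choice of \<open>m\<close>; the products of \<open>X\<close> and \<open>y\<close> are smaller by a factor \<open>1 / n\<close> than \<open>X\<^sup>2\<close> and
  \<open>n\<^sup>2 \<bar>y\<bar>\<^sup>2\<close> and are absorbed by the size of \<open>n\<close>; the other mixed terms contain a velocity of \<open>y\<close>.\<close>

lemma high_frequency_estimate:
  fixes X v p q r s n k1 k2 g :: real
  assumes n: "n \<ge> 1"
    and m: "m * c0 = \<bar>g / \<rho>\<bar> * ((\<bar>b\<bar> + \<bar>d\<bar>) * (\<bar>\<kappa>1 * k1\<bar> + \<bar>\<kappa>2 * k2\<bar>)) + 3" "m \<ge> 0"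
    and c2: "c2 = \<bar>k1 * \<alpha>1 + k2 * \<alpha>3\<bar> + \<bar>k1 * \<alpha>3 + k2 * \<alpha>2\<bar>"
    and c3: "c3 = \<bar>k1 * \<tau>1 + k2 * \<tau>3\<bar> + \<bar>k1 * \<tau>2 + k2 * \<tau>4\<bar>"
    and c6: "c6 = \<bar>\<tau>1\<bar> + \<bar>\<tau>2\<bar> + \<bar>\<tau>3\<bar> + \<bar>\<tau>4\<bar>"
    and N: "n \<ge> (\<bar>b\<bar> + \<bar>d\<bar>) + \<bar>g\<bar> * c2 + m * (\<bar>b\<bar> + \<bar>d\<bar>)"
    and z: "z = \<kappa>1 * k1 * p + \<kappa>2 * k2 * q"
    and w: "w = k1 * (\<alpha>1 * p + \<alpha>3 * q + \<tau>1 * r + \<tau>2 * s) + k2 * (\<alpha>3 * p + \<alpha>2 * q + \<tau>3 * r + \<tau>4 * s)"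
    and K: "K = m * (\<kappa>1 + \<kappa>2) + (\<bar>g\<bar> * c3)\<^sup>2 / 4 + (m * c6)\<^sup>2 / 4"
  shows "\<rho> * v\<^sup>2 + (X\<^sup>2 + n\<^sup>2 * (p\<^sup>2 + q\<^sup>2)) - K * (r\<^sup>2 + s\<^sup>2)
    \<le> \<rho> * v\<^sup>2 + 3 * X\<^sup>2 - X * (b * p + d * q) - n\<^sup>2 * (g / \<rho> * ((b * p + d * q) * z)) + g * X * w
      - m * (\<kappa>1 * r\<^sup>2 + \<kappa>2 * s\<^sup>2)
      + m * (n\<^sup>2 * (\<alpha> * p\<^sup>2 + 2 * \<beta> * p * q + \<gamma> * q\<^sup>2) + X * (b * p + d * q)
        + (\<alpha>1 * p\<^sup>2 + 2 * \<alpha>3 * p * q + \<alpha>2 * q\<^sup>2) + (p * (\<tau>1 * r + \<tau>2 * s) + q * (\<tau>3 * r + \<tau>4 * s)))"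
proof -
  define y where "y = sqrt (p\<^sup>2 + q\<^sup>2)"
  define e where "e = sqrt (r\<^sup>2 + s\<^sup>2)"
  define c1 where "c1 = \<bar>b\<bar> + \<bar>d\<bar>"
  have y: "y \<ge> 0" "y\<^sup>2 = p\<^sup>2 + q\<^sup>2" and e: "e \<ge> 0" "e\<^sup>2 = r\<^sup>2 + s\<^sup>2" by (simp_all add: y_def e_def)
  have By: "\<bar>b * p + d * q\<bar> \<le> c1 * y"
    using linear_bound2[of b p d q] by (simp add: y_def c1_def)
  have XBy: "\<bar>X * (b * p + d * q)\<bar> \<le> c1 * (\<bar>X\<bar> * y)"
    using mult_left_mono[OF By, of "\<bar>X\<bar>"] by (simp add: abs_mult mult_ac)
  have zy: "\<bar>z\<bar> \<le> (\<bar>\<kappa>1 * k1\<bar> + \<bar>\<kappa>2 * k2\<bar>) * y"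
    using linear_bound2[of "\<kappa>1 * k1" p "\<kappa>2 * k2" q] by (simp add: y_def z)
  have "\<bar>(b * p + d * q) * z\<bar> \<le> (c1 * y) * ((\<bar>\<kappa>1 * k1\<bar> + \<bar>\<kappa>2 * k2\<bar>) * y)"
    by (subst abs_mult, rule mult_mono[OF By zy]) (auto simp: c1_def y)
  then have "\<bar>g / \<rho>\<bar> * \<bar>(b * p + d * q) * z\<bar>
      \<le> \<bar>g / \<rho>\<bar> * ((c1 * y) * ((\<bar>\<kappa>1 * k1\<bar> + \<bar>\<kappa>2 * k2\<bar>) * y))"
    by (rule mult_left_mono) simp
  also have "\<bar>g / \<rho>\<bar> * ((c1 * y) * ((\<bar>\<kappa>1 * k1\<bar> + \<bar>\<kappa>2 * k2\<bar>) * y)) = (m * c0 - 3) * y\<^sup>2"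
    unfolding m(1) c1_def[symmetric]
    by (simp only: power2_eq_square add_diff_cancel_right' mult_ac)
  finally have "\<bar>g / \<rho> * ((b * p + d * q) * z)\<bar> \<le> (m * c0 - 3) * y\<^sup>2"
    by (simp only: abs_mult[of "g / \<rho>"])
  then have "n\<^sup>2 * (g / \<rho> * ((b * p + d * q) * z)) \<le> n\<^sup>2 * ((m * c0 - 3) * y\<^sup>2)"
    by (rule mult_left_mono[OF order_trans[OF abs_ge_self]]) simp
  then have Bz: "n\<^sup>2 * (g / \<rho> * ((b * p + d * q) * z)) \<le> (m * c0 - 3) * (n * y)\<^sup>2"
    by (simp add: power_mult_distrib mult_ac)
  have "w = ((k1 * \<alpha>1 + k2 * \<alpha>3) * p + (k1 * \<alpha>3 + k2 * \<alpha>2) * q)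
      + ((k1 * \<tau>1 + k2 * \<tau>3) * r + (k1 * \<tau>2 + k2 * \<tau>4) * s)"
    by (simp add: w algebra_simps)
  then have "\<bar>w\<bar> \<le> c2 * y + c3 * e"
    unfolding c2 c3 y_def e_def
    using linear_bound2[of "k1 * \<alpha>1 + k2 * \<alpha>3" p "k1 * \<alpha>3 + k2 * \<alpha>2" q]
      linear_bound2[of "k1 * \<tau>1 + k2 * \<tau>3" r "k1 * \<tau>2 + k2 * \<tau>4" s] by linarith
  then have "\<bar>g * X\<bar> * \<bar>w\<bar> \<le> \<bar>g * X\<bar> * (c2 * y + c3 * e)" by (rule mult_left_mono) simp
  then have "\<bar>g * X * w\<bar> \<le> \<bar>g\<bar> * c2 * (\<bar>X\<bar> * y) + \<bar>g\<bar> * c3 * (\<bar>X\<bar> * e)"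
    by (simp add: abs_mult algebra_simps)
  then have Xw: "- (\<bar>g\<bar> * c2 * (\<bar>X\<bar> * y)) - \<bar>g\<bar> * c3 * (\<bar>X\<bar> * e) \<le> g * X * w" by linarith
  have "\<kappa>1 * r\<^sup>2 + \<kappa>2 * s\<^sup>2 \<le> (\<kappa>1 + \<kappa>2) * e\<^sup>2"
    unfolding e(2) using pos(2,3) by (simp add: algebra_simps)
  then have kin: "m * (\<kappa>1 * r\<^sup>2 + \<kappa>2 * s\<^sup>2) \<le> m * (\<kappa>1 + \<kappa>2) * e\<^sup>2"
    using m(2) mult_left_mono by (fastforce simp: mult.assoc)
  have "p * (\<tau>1 * r + \<tau>2 * s) + q * (\<tau>3 * r + \<tau>4 * s)
      = \<tau>1 * (p * r) + \<tau>2 * (p * s) + \<tau>3 * (q * r) + \<tau>4 * (q * s)" by (simp add: algebra_simps)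
  then have "\<bar>p * (\<tau>1 * r + \<tau>2 * s) + q * (\<tau>3 * r + \<tau>4 * s)\<bar> \<le> c6 * (y * e)"
    using bilinear_bound2[of \<tau>1 p r \<tau>2 s \<tau>3 q \<tau>4] by (simp add: c6 y_def e_def)
  moreover have "c6 * (y * e) \<le> c6 * (n * y * e)"
    using n y e c6 mult_right_mono[of 1 n y] by (intro mult_left_mono mult_right_mono) auto
  ultimately have T: "- (c6 * (n * y * e)) \<le> p * (\<tau>1 * r + \<tau>2 * s) + q * (\<tau>3 * r + \<tau>4 * s)"
    by linarith
  have "n\<^sup>2 * (c0 * y\<^sup>2) \<le> n\<^sup>2 * (\<alpha> * p\<^sup>2 + 2 * \<beta> * p * q + \<gamma> * q\<^sup>2)"
    unfolding y(2) by (intro mult_left_mono elastic_gradient_lower) simp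
  then have A: "c0 * (n * y)\<^sup>2 \<le> n\<^sup>2 * (\<alpha> * p\<^sup>2 + 2 * \<beta> * p * q + \<gamma> * q\<^sup>2)"
    by (simp add: power_mult_distrib mult_ac)
  have "c0 * (n * y)\<^sup>2 - c1 * (\<bar>X\<bar> * y) - c6 * (n * y * e)
      \<le> n\<^sup>2 * (\<alpha> * p\<^sup>2 + 2 * \<beta> * p * q + \<gamma> * q\<^sup>2) + X * (b * p + d * q)
        + (\<alpha>1 * p\<^sup>2 + 2 * \<alpha>3 * p * q + \<alpha>2 * q\<^sup>2) + (p * (\<tau>1 * r + \<tau>2 * s) + q * (\<tau>3 * r + \<tau>4 * s))"
    using A XBy T elastic_order_zero_nonneg[of p q] by linarith
  then have F: "m * (c0 * (n * y)\<^sup>2 - c1 * (\<bar>X\<bar> * y) - c6 * (n * y * e))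
      \<le> m * (n\<^sup>2 * (\<alpha> * p\<^sup>2 + 2 * \<beta> * p * q + \<gamma> * q\<^sup>2) + X * (b * p + d * q)
        + (\<alpha>1 * p\<^sup>2 + 2 * \<alpha>3 * p * q + \<alpha>2 * q\<^sup>2) + (p * (\<tau>1 * r + \<tau>2 * s) + q * (\<tau>3 * r + \<tau>4 * s)))"
    by (rule mult_left_mono) fact
  have "(c1 + \<bar>g\<bar> * c2 + m * c1) * (\<bar>X\<bar> * y) \<le> n * (\<bar>X\<bar> * y)"
    using N y by (intro mult_right_mono) (auto simp: c1_def)
  also have "\<dots> \<le> X\<^sup>2 + (n * y)\<^sup>2 / 4"
    using young[of 1 "\<bar>X\<bar>" "n * y"] by (simp add: mult_ac)
  finally have cross: "c1 * (\<bar>X\<bar> * y) + \<bar>g\<bar> * c2 * (\<bar>X\<bar> * y) + m * c1 * (\<bar>X\<bar> * y) \<le> X\<^sup>2 + (n * y)\<^sup>2 / 4"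
    by (simp add: algebra_simps)
  have Xe: "\<bar>g\<bar> * c3 * (\<bar>X\<bar> * e) \<le> X\<^sup>2 + (\<bar>g\<bar> * c3)\<^sup>2 / 4 * e\<^sup>2"
    using young[of 1 "\<bar>X\<bar>" "\<bar>g\<bar> * c3 * e"] by (simp add: power_mult_distrib mult_ac)
  have Ye: "m * c6 * (n * y * e) \<le> (n * y)\<^sup>2 + (m * c6)\<^sup>2 / 4 * e\<^sup>2"
    using young[of 1 "n * y" "m * c6 * e"] by (simp add: power_mult_distrib mult_ac)
  have F': "m * (c0 * (n * y)\<^sup>2 - c1 * (\<bar>X\<bar> * y) - c6 * (n * y * e))
      = m * c0 * (n * y)\<^sup>2 - m * c1 * (\<bar>X\<bar> * y) - m * c6 * (n * y * e)" by (simp add: algebra_simps)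
  have Bz': "(m * c0 - 3) * (n * y)\<^sup>2 = m * c0 * (n * y)\<^sup>2 - 3 * (n * y)\<^sup>2" by (simp add: algebra_simps)
  have K': "K * (r\<^sup>2 + s\<^sup>2) = m * (\<kappa>1 + \<kappa>2) * e\<^sup>2 + (\<bar>g\<bar> * c3)\<^sup>2 / 4 * e\<^sup>2 + (m * c6)\<^sup>2 / 4 * e\<^sup>2"
    unfolding K e(2)[symmetric] by (simp add: algebra_simps)
  have Y: "n\<^sup>2 * (p\<^sup>2 + q\<^sup>2) = (n * y)\<^sup>2" by (simp add: power_mult_distrib y)
  have XBy': "X * (b * p + d * q) \<le> c1 * (\<bar>X\<bar> * y)" using XBy by linarith
  have "0 \<le> (n * y)\<^sup>2" by simp
  then show ?thesis
    using F[unfolded F'] Bz[unfolded Bz'] XBy' Xw kin cross Xe Ye unfolding K' Y by linarith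
qed

text \<open>The functional is \<open>L = - \<rho> a v - g n (v z - a z') + m (y \<bullet> K y')\<close> with \<open>z = k \<bullet> K y\<close>. The first
  term produces \<open>- \<rho> v\<^sup>2\<close> at the expense of \<open>\<mu> (n a)\<^sup>2\<close>. The second, whose terms of highest order cancel because
  \<open>z\<close> has the wave speed of \<open>u\<close>, produces a negative multiple of \<open>(n a)\<^sup>2\<close> at the expense of \<open>n\<^sup>2 \<bar>y\<bar>\<^sup>2\<close>. The third
  produces a negative multiple of \<open>n\<^sup>2 \<bar>y\<bar>\<^sup>2\<close> at the expense of \<open>\<bar>y'\<bar>\<^sup>2\<close>. So \<open>g\<close> is chosen first, then \<open>m\<close>, then the
  threshold \<open>N\<close>.\<close>

lemma high_frequency_lyapunov:
  assumes chi0: "(\<mu> * \<kappa>1 / \<rho> - \<alpha>) * (\<mu> * \<kappa>2 / \<rho> - \<gamma>) - \<beta>\<^sup>2 = 0"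
    and chi1: "d\<^sup>2 * (\<mu> * \<kappa>1 / \<rho> - \<alpha>) + b\<^sup>2 * (\<mu> * \<kappa>2 / \<rho> - \<gamma>) + 2 * b * d * \<beta> \<noteq> 0"
  obtains c K M N where "c > 0" "K \<ge> 0" "M \<ge> 0" "N \<ge> 1" "\<And>n. n \<ge> N \<Longrightarrow> lyapunov_bounds n c K M"
proof -
  define m11 m22 where "m11 = \<alpha> - \<mu> * \<kappa>1 / \<rho>" and "m22 = \<gamma> - \<mu> * \<kappa>2 / \<rho>"
  \<comment> \<open>The adjugate of \<open>((m11, \<beta>), (\<beta>, m22))\<close> applied to \<open>(b, d)\<close>; it lies in the kernel since the determinant is \<open>0\<close>.\<close>
  define k1 k2 where "k1 = m22 * b - \<beta> * d" and "k2 = m11 * d - \<beta> * b"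
  define \<theta> where "\<theta> = b * k1 + d * k2"
  have det: "m11 * m22 = \<beta> * \<beta>" using chi0 by (simp add: m11_def m22_def algebra_simps power2_eq_square)
  have "\<theta> = - (d\<^sup>2 * (\<mu> * \<kappa>1 / \<rho> - \<alpha>) + b\<^sup>2 * (\<mu> * \<kappa>2 / \<rho> - \<gamma>) + 2 * b * d * \<beta>)"
    by (simp add: \<theta>_def k1_def k2_def m11_def m22_def algebra_simps power2_eq_square)
  then have \<theta>: "\<theta> \<noteq> 0" using chi1 by simp
  have "m11 * k1 + \<beta> * k2 = b * (m11 * m22 - \<beta> * \<beta>)" "\<beta> * k1 + m22 * k2 = d * (m11 * m22 - \<beta> * \<beta>)"
    by (simp_all add: k1_def k2_def algebra_simps)
  then have "m11 * k1 + \<beta> * k2 = 0" "\<beta> * k1 + m22 * k2 = 0" by (simp_all add: det)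
  then have ker: "\<alpha> * k1 + \<beta> * k2 = \<mu> / \<rho> * (\<kappa>1 * k1)" "\<beta> * k1 + \<gamma> * k2 = \<mu> / \<rho> * (\<kappa>2 * k2)"
    by (simp_all add: m11_def m22_def algebra_simps)
  define g where "g = (\<mu> + 3) / \<theta>"
  have g: "g * \<theta> = \<mu> + 3" using \<theta> by (simp add: g_def)
  define m where "m = (\<bar>g / \<rho>\<bar> * ((\<bar>b\<bar> + \<bar>d\<bar>) * (\<bar>\<kappa>1 * k1\<bar> + \<bar>\<kappa>2 * k2\<bar>)) + 3) / c0"
  have m: "m * c0 = \<bar>g / \<rho>\<bar> * ((\<bar>b\<bar> + \<bar>d\<bar>) * (\<bar>\<kappa>1 * k1\<bar> + \<bar>\<kappa>2 * k2\<bar>)) + 3" "m \<ge> 0"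
    using pos by (simp_all add: m_def)
  define c2 where "c2 = \<bar>k1 * \<alpha>1 + k2 * \<alpha>3\<bar> + \<bar>k1 * \<alpha>3 + k2 * \<alpha>2\<bar>"
  define c3 where "c3 = \<bar>k1 * \<tau>1 + k2 * \<tau>3\<bar> + \<bar>k1 * \<tau>2 + k2 * \<tau>4\<bar>"
  define c6 where "c6 = \<bar>\<tau>1\<bar> + \<bar>\<tau>2\<bar> + \<bar>\<tau>3\<bar> + \<bar>\<tau>4\<bar>"
  define K where "K = m * (\<kappa>1 + \<kappa>2) + (\<bar>g\<bar> * c3)\<^sup>2 / 4 + (m * c6)\<^sup>2 / 4"
  define N where "N = max 1 ((\<bar>b\<bar> + \<bar>d\<bar>) + \<bar>g\<bar> * c2 + m * (\<bar>b\<bar> + \<bar>d\<bar>))"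
  define M where "M = \<bar>- \<rho>\<bar> + \<bar>- (g * \<kappa>1 * k1)\<bar> + \<bar>- (g * \<kappa>2 * k2)\<bar> + \<bar>g * \<kappa>1 * k1\<bar> + \<bar>g * \<kappa>2 * k2\<bar>
    + \<bar>m * \<kappa>1\<bar> + \<bar>m * \<kappa>2\<bar>"
  define c where "c = min \<rho> 1"
  have K0: "K \<ge> 0" using m(2) pos by (simp add: K_def)
  have c0': "c > 0" "c \<le> \<rho>" "c \<le> 1" using pos by (auto simp: c_def)
  have "lyapunov_bounds n c (K + c) M" if n: "n \<ge> N" for n
    unfolding lyapunov_bounds_def
  proof (intro allI impI)
    fix a v p r q s assume "mode_solution n a v p r q s"
    then obtain A P Q where *:
      "\<And>t. t \<ge> 0 \<Longrightarrow> (a has_real_derivative v t) (at t within {0..})"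
      "\<And>t. t \<ge> 0 \<Longrightarrow> (p has_real_derivative r t) (at t within {0..})"
      "\<And>t. t \<ge> 0 \<Longrightarrow> (q has_real_derivative s t) (at t within {0..})"
      "\<And>t. t \<ge> 0 \<Longrightarrow> (v has_real_derivative A t) (at t within {0..})"
      "\<And>t. t \<ge> 0 \<Longrightarrow> (r has_real_derivative P t) (at t within {0..})"
      "\<And>t. t \<ge> 0 \<Longrightarrow> (s has_real_derivative Q t) (at t within {0..})"
      and A: "\<And>t. \<rho> * A t = - n * (\<mu> * (n * a t) + b * p t + d * q t)"
      and P: "\<And>t. \<kappa>1 * P t = - n\<^sup>2 * (\<alpha> * p t + \<beta> * q t)
         - (b * (n * a t) + \<alpha>1 * p t + \<alpha>3 * q t + \<tau>1 * r t + \<tau>2 * s t)"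
      and Q: "\<And>t. \<kappa>2 * Q t = - n\<^sup>2 * (\<beta> * p t + \<gamma> * q t)
         - (d * (n * a t) + \<alpha>3 * p t + \<alpha>2 * q t + \<tau>3 * r t + \<tau>4 * s t)"
      using mode_accelerations by blast
    have n1: "n \<ge> 1" using n by (simp add: N_def)
    define z where "z t = \<kappa>1 * k1 * p t + \<kappa>2 * k2 * q t" for t
    define w where "w t = k1 * (\<alpha>1 * p t + \<alpha>3 * q t + \<tau>1 * r t + \<tau>2 * s t)
      + k2 * (\<alpha>3 * p t + \<alpha>2 * q t + \<tau>3 * r t + \<tau>4 * s t)" for t
    have nA: "n * A t = - (n\<^sup>2 / \<rho> * (\<mu> * (n * a t) + b * p t + d * q t))" for t
    proof -
      have "n * A t = n * (\<rho> * A t) / \<rho>" using pos by simp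
      also have "\<dots> = - (n\<^sup>2 / \<rho> * (\<mu> * (n * a t) + b * p t + d * q t))"
        unfolding A by (simp add: power2_eq_square)
      finally show ?thesis .
    qed
    \<comment> \<open>The acceleration of \<open>z\<close>: by the kernel equations its part of highest order is \<open>- n\<^sup>2 (\<mu> / \<rho>) z\<close>, as for \<open>u\<close>.\<close>
    have zdd: "k1 * (\<kappa>1 * P t) + k2 * (\<kappa>2 * Q t) = - (n\<^sup>2 * (\<mu> / \<rho> * z t)) - \<theta> * (n * a t) - w t" for t
    proof -
      have "k1 * (\<kappa>1 * P t) + k2 * (\<kappa>2 * Q t)
        = - (n\<^sup>2 * ((\<alpha> * k1 + \<beta> * k2) * p t + (\<beta> * k1 + \<gamma> * k2) * q t)) - \<theta> * (n * a t) - w t"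
        unfolding P Q by (simp add: \<theta>_def w_def algebra_simps)
      also have "(\<alpha> * k1 + \<beta> * k2) * p t + (\<beta> * k1 + \<gamma> * k2) * q t = \<mu> / \<rho> * z t"
        unfolding ker by (simp add: z_def algebra_simps)
      finally show ?thesis .
    qed
    define L where "L t = - \<rho> * (a t * v t) - g * n * (v t * z t - a t * (\<kappa>1 * k1 * r t + \<kappa>2 * k2 * s t))
      + m * (\<kappa>1 * (p t * r t) + \<kappa>2 * (q t * s t))" for t
    define L' where "L' t = - (\<rho> * (v t)\<^sup>2) - a t * (\<rho> * A t)
      - g * ((n * A t) * z t - n * a t * (k1 * (\<kappa>1 * P t) + k2 * (\<kappa>2 * Q t)))
      + m * (\<kappa>1 * (r t)\<^sup>2 + \<kappa>2 * (s t)\<^sup>2 + (p t * (\<kappa>1 * P t) + q t * (\<kappa>2 * Q t)))" for t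
    show "\<exists>L L'. \<forall>t\<ge>0. (L has_real_derivative L' t) (at t within {0..}) \<and>
       \<bar>L t\<bar> \<le> M * mode_size n (a t) (v t) (p t) (r t) (q t) (s t) \<and>
       L' t \<le> - c * mode_size n (a t) (v t) (p t) (r t) (q t) (s t) + (K + c) * ((r t)\<^sup>2 + (s t)\<^sup>2)"
    proof (intro exI allI impI conjI)
      fix t :: real assume t: "t \<ge> 0"
      show "(L has_real_derivative L' t) (at t within {0..})"
        unfolding L_def[abs_def] L'_def z_def[abs_def]
        by (rule *[OF t] derivative_eq_intros refl)+ (simp add: power2_eq_square algebra_simps)
      let ?S = "mode_size n (a t) (v t) (p t) (r t) (q t) (s t)"
      have bound: "\<bar>e * (x * y)\<bar> \<le> \<bar>e\<bar> * ?S"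
        if "x \<in> {n * a t, v t, n * p t, n * q t, r t, s t, a t, p t, q t}"
          "y \<in> {n * a t, v t, n * p t, n * q t, r t, s t, a t, p t, q t}" for e x y
        using mode_size_mult_bound[OF n1 that] .
      have L_eq: "L t = - \<rho> * (a t * v t) + - (g * \<kappa>1 * k1) * (v t * (n * p t)) + - (g * \<kappa>2 * k2) * (v t * (n * q t))
        + (g * \<kappa>1 * k1) * ((n * a t) * r t) + (g * \<kappa>2 * k2) * ((n * a t) * s t)
        + (m * \<kappa>1) * (p t * r t) + (m * \<kappa>2) * (q t * s t)"
        by (simp add: L_def z_def algebra_simps)
      show "\<bar>L t\<bar> \<le> M * ?S"
        unfolding L_eq M_def distrib_right
        by (intro order_trans[OF abs_triangle_ineq] add_mono bound) auto
      have L'1: "L' t = - (\<rho> * (v t)\<^sup>2 + 3 * (n * a t)\<^sup>2 - n * a t * (b * p t + d * q t)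
        - n\<^sup>2 * (g / \<rho> * ((b * p t + d * q t) * z t)) + g * (n * a t) * w t
        - m * (\<kappa>1 * (r t)\<^sup>2 + \<kappa>2 * (s t)\<^sup>2)
        + m * (n\<^sup>2 * (\<alpha> * (p t)\<^sup>2 + 2 * \<beta> * p t * q t + \<gamma> * (q t)\<^sup>2) + n * a t * (b * p t + d * q t)
          + (\<alpha>1 * (p t)\<^sup>2 + 2 * \<alpha>3 * p t * q t + \<alpha>2 * (q t)\<^sup>2)
          + (p t * (\<tau>1 * r t + \<tau>2 * s t) + q t * (\<tau>3 * r t + \<tau>4 * s t))))"
      proof -
        have 1: "a t * (\<rho> * A t) = - (\<mu> * (n * a t)\<^sup>2 + n * a t * (b * p t + d * q t))"
          unfolding A by (simp add: power2_eq_square algebra_simps)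
        have G: "(n * A t) * z t - n * a t * (k1 * (\<kappa>1 * P t) + k2 * (\<kappa>2 * Q t))
          = \<theta> * (n * a t)\<^sup>2 + n * a t * w t - n\<^sup>2 / \<rho> * ((b * p t + d * q t) * z t)"
          unfolding nA zdd by (simp add: power2_eq_square algebra_simps)
        have 2: "g * ((n * A t) * z t - n * a t * (k1 * (\<kappa>1 * P t) + k2 * (\<kappa>2 * Q t)))
          = (\<mu> + 3) * (n * a t)\<^sup>2 + g * (n * a t) * w t - n\<^sup>2 * (g / \<rho> * ((b * p t + d * q t) * z t))"
          unfolding G g[symmetric] by (simp add: algebra_simps)
        have 3: "p t * (\<kappa>1 * P t) + q t * (\<kappa>2 * Q t)
          = - (n\<^sup>2 * (\<alpha> * (p t)\<^sup>2 + 2 * \<beta> * p t * q t + \<gamma> * (q t)\<^sup>2) + n * a t * (b * p t + d * q t)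
          + (\<alpha>1 * (p t)\<^sup>2 + 2 * \<alpha>3 * p t * q t + \<alpha>2 * (q t)\<^sup>2)
          + (p t * (\<tau>1 * r t + \<tau>2 * s t) + q t * (\<tau>3 * r t + \<tau>4 * s t)))"
          unfolding P Q by (simp add: power2_eq_square algebra_simps)
        show ?thesis unfolding L'_def 1 2 3 by (simp add: algebra_simps)
      qed
      have "L' t \<le> - (\<rho> * (v t)\<^sup>2 + ((n * a t)\<^sup>2 + n\<^sup>2 * ((p t)\<^sup>2 + (q t)\<^sup>2)) - K * ((r t)\<^sup>2 + (s t)\<^sup>2))"
        unfolding L'1 neg_le_iff_le
        by (rule high_frequency_estimate[OF n1 m c2_def c3_def c6_def _ z_def w_def K_def])
          (use n in \<open>simp add: N_def\<close>)
      moreover have "c * (v t)\<^sup>2 \<le> \<rho> * (v t)\<^sup>2"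
        using c0' by (intro mult_right_mono) auto
      moreover have "c * ((n * a t)\<^sup>2 + n\<^sup>2 * ((p t)\<^sup>2 + (q t)\<^sup>2)) \<le> 1 * ((n * a t)\<^sup>2 + n\<^sup>2 * ((p t)\<^sup>2 + (q t)\<^sup>2))"
        using c0' by (intro mult_right_mono) auto
      ultimately show "L' t \<le> - c * ?S + (K + c) * ((r t)\<^sup>2 + (s t)\<^sup>2)"
        by (simp add: mode_size_def algebra_simps)
    qed
  qed
  then show ?thesis using c0' K0 by (intro that[of c "K + c" M N]) (auto simp: M_def N_def)
qed

section \<open>A Lyapunov functional for a fixed frequency\<close>

text \<open>The expression bounded above is \<open>L'\<close> for the functional of the next lemma, with \<open>X\<close> for \<open>n a\<close> and \<open>W\<close> for
  twice the potential energy. The acceleration \<open>A\<close> enters only multiplied by \<open>f\<close>, and \<open>N\<close> is chosen so that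
  \<open>N \<bar>f\<bar>\<^sup>2\<close> absorbs this product and the one of \<open>f\<close> with the velocities of \<open>y\<close>.\<close>

lemma fixed_frequency_estimate:
  fixes X v p q r s n m :: real
  assumes n: "n \<ge> 1" and m: "m * (n * (b\<^sup>2 + d\<^sup>2)) = \<rho> + 3" "m \<ge> 0"
    and A: "\<rho> * A = - n * (\<mu> * X + b * p + d * q)"
    and G: "G = m * (n * (\<mu> + (\<bar>b\<bar> + \<bar>d\<bar>)) / \<rho> * (\<bar>b\<bar> + \<bar>d\<bar>))"
    and N: "N = 2 * G\<^sup>2 / c0 + 1"
    and c6: "c6 = \<bar>\<tau>1\<bar> + \<bar>\<tau>2\<bar> + \<bar>\<tau>3\<bar> + \<bar>\<tau>4\<bar>"
    and K: "K = (\<kappa>1 + \<kappa>2) + c6\<^sup>2 / c0 + (m * (\<bar>h1\<bar> + \<bar>h2\<bar>))\<^sup>2 / 4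
      + N * (\<bar>j1\<bar> + \<bar>j2\<bar> + \<bar>j3\<bar>) + (N * n * (\<bar>b * \<kappa>1\<bar> + \<bar>d * \<kappa>2\<bar>))\<^sup>2 / 4 + (N * c6)\<^sup>2 / 4"
    and W: "c0 * (X\<^sup>2 + n\<^sup>2 * (p\<^sup>2 + q\<^sup>2)) \<le> W"
  shows "\<rho> * v\<^sup>2 + (\<kappa>1 * r\<^sup>2 + \<kappa>2 * s\<^sup>2) - W - (p * (\<tau>1 * r + \<tau>2 * s) + q * (\<tau>3 * r + \<tau>4 * s))
      - m * (A * (b * f1 + d * f2) + v * (h1 * r + h2 * s) + n * (b\<^sup>2 + d\<^sup>2) * v\<^sup>2)
      + N * ((j1 * r\<^sup>2 + j2 * (r * s) + j3 * s\<^sup>2) + n * v * (b * \<kappa>1 * r + d * \<kappa>2 * s)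
          - (f1\<^sup>2 + f2\<^sup>2) - (f1 * (\<tau>1 * r + \<tau>2 * s) + f2 * (\<tau>3 * r + \<tau>4 * s)))
    \<le> - (v\<^sup>2 + c0 / 2 * (X\<^sup>2 + n\<^sup>2 * (p\<^sup>2 + q\<^sup>2))) + K * (r\<^sup>2 + s\<^sup>2)"
proof -
  define y e \<phi> where "y = sqrt (p\<^sup>2 + q\<^sup>2)" and "e = sqrt (r\<^sup>2 + s\<^sup>2)" and "\<phi> = sqrt (f1\<^sup>2 + f2\<^sup>2)"
  define c1 where "c1 = \<bar>b\<bar> + \<bar>d\<bar>"
  have y: "y \<ge> 0" "y\<^sup>2 = p\<^sup>2 + q\<^sup>2" and e: "e \<ge> 0" "e\<^sup>2 = r\<^sup>2 + s\<^sup>2"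
    and \<phi>: "\<phi> \<ge> 0" "\<phi>\<^sup>2 = f1\<^sup>2 + f2\<^sup>2" by (simp_all add: y_def e_def \<phi>_def)
  have c1: "c1 \<ge> 0" by (simp add: c1_def)
  have N0: "N \<ge> 1" unfolding N using pos by simp
  have ny: "y \<le> n * y" using n y mult_right_mono[of 1 n y] by simp
  have T: "\<bar>x1 * (\<tau>1 * r + \<tau>2 * s) + x2 * (\<tau>3 * r + \<tau>4 * s)\<bar> \<le> c6 * (sqrt (x1\<^sup>2 + x2\<^sup>2) * e)" for x1 x2
  proof -
    have "x1 * (\<tau>1 * r + \<tau>2 * s) + x2 * (\<tau>3 * r + \<tau>4 * s)
      = \<tau>1 * (x1 * r) + \<tau>2 * (x1 * s) + \<tau>3 * (x2 * r) + \<tau>4 * (x2 * s)" by (simp add: algebra_simps)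
    then show ?thesis using bilinear_bound2[of \<tau>1 x1 r \<tau>2 s \<tau>3 x2 \<tau>4] by (simp add: c6 e_def)
  qed
  have c60: "c6 \<ge> 0" by (simp add: c6)
  have kin: "\<kappa>1 * r\<^sup>2 + \<kappa>2 * s\<^sup>2 \<le> (\<kappa>1 + \<kappa>2) * e\<^sup>2"
    unfolding e(2) using pos(2,3) by (simp add: algebra_simps)
  have "c6 * (y * e) \<le> c6 * (n * y * e)" using c60 ny e by (intro mult_left_mono mult_right_mono)
  also have "\<dots> \<le> c0 / 4 * (n * y)\<^sup>2 + c6\<^sup>2 / c0 * e\<^sup>2"
    using young[of "c0 / 4" "n * y" "c6 * e"] pos by (simp add: power_mult_distrib mult_ac)
  finally have T1: "- (p * (\<tau>1 * r + \<tau>2 * s) + q * (\<tau>3 * r + \<tau>4 * s)) \<le> c0 / 4 * (n * y)\<^sup>2 + c6\<^sup>2 / c0 * e\<^sup>2"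
    using T[of p q] unfolding y_def by linarith
  have "\<bar>b * p + d * q\<bar> \<le> c1 * y" using linear_bound2[of b p d q] by (simp add: y_def c1_def)
  also have "\<dots> \<le> c1 * (n * y)" using c1 ny by (intro mult_left_mono)
  finally have By: "\<bar>b * p + d * q\<bar> \<le> c1 * (n * y)" .
  have "\<bar>\<mu> * X + b * p + d * q\<bar> \<le> \<mu> * \<bar>X\<bar> + c1 * (n * y)"
  proof -
    have "\<bar>\<mu> * X\<bar> = \<mu> * \<bar>X\<bar>" using pos(4) by (simp add: abs_mult)
    then show ?thesis using By by linarith
  qed
  also have "\<dots> \<le> (\<mu> + c1) * (\<bar>X\<bar> + n * y)"
  proof -
    have "0 \<le> c1 * \<bar>X\<bar>" "0 \<le> \<mu> * (n * y)" using c1 pos n y by simp_all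
    then show ?thesis by (simp add: algebra_simps)
  qed
  finally have "n * \<bar>\<mu> * X + b * p + d * q\<bar> \<le> n * ((\<mu> + c1) * (\<bar>X\<bar> + n * y))"
    using n by (intro mult_left_mono) auto
  moreover have "\<rho> * \<bar>A\<bar> = n * \<bar>\<mu> * X + b * p + d * q\<bar>"
    using arg_cong[OF A, of abs] n pos by (simp add: abs_mult)
  ultimately have A': "\<bar>A\<bar> \<le> n * (\<mu> + c1) / \<rho> * (\<bar>X\<bar> + n * y)" using pos by (simp add: field_simps)
  have "\<bar>A * (b * f1 + d * f2)\<bar> \<le> (n * (\<mu> + c1) / \<rho> * (\<bar>X\<bar> + n * y)) * (c1 * \<phi>)"
    unfolding abs_mult c1_def \<phi>_def by (rule mult_mono[OF A'[unfolded c1_def] linear_bound2])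
      (use n y pos in auto)
  then have "m * \<bar>A * (b * f1 + d * f2)\<bar> \<le> m * ((n * (\<mu> + c1) / \<rho> * (\<bar>X\<bar> + n * y)) * (c1 * \<phi>))"
    using m(2) by (rule mult_left_mono)
  also have "\<dots> = \<bar>X\<bar> * (G * \<phi>) + (n * y) * (G * \<phi>)"
    unfolding G c1_def[symmetric] by (simp add: add_divide_distrib algebra_simps)
  also have "\<dots> \<le> (c0 / 4 * \<bar>X\<bar>\<^sup>2 + (G * \<phi>)\<^sup>2 / (4 * (c0 / 4))) + (c0 / 4 * (n * y)\<^sup>2 + (G * \<phi>)\<^sup>2 / (4 * (c0 / 4)))"
    using pos by (intro add_mono young) auto
  also have "\<dots> = c0 / 4 * X\<^sup>2 + c0 / 4 * (n * y)\<^sup>2 + (N - 1) * \<phi>\<^sup>2"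
    unfolding N by (simp add: power_mult_distrib)
  finally have "m * \<bar>A * (b * f1 + d * f2)\<bar> \<le> c0 / 4 * X\<^sup>2 + c0 / 4 * (n * y)\<^sup>2 + (N - 1) * \<phi>\<^sup>2" .
  moreover have "- (m * (A * (b * f1 + d * f2))) \<le> m * \<bar>A * (b * f1 + d * f2)\<bar>"
    using m(2) mult_left_mono[of "- (A * (b * f1 + d * f2))" "\<bar>A * (b * f1 + d * f2)\<bar>" m] by simp
  ultimately have AB: "- (m * (A * (b * f1 + d * f2))) \<le> c0 / 4 * X\<^sup>2 + c0 / 4 * (n * y)\<^sup>2 + (N - 1) * \<phi>\<^sup>2"
    by linarith
  have lin: "\<bar>k * (v * (x1 * r + x2 * s))\<bar> \<le> v\<^sup>2 + (k * (\<bar>x1\<bar> + \<bar>x2\<bar>))\<^sup>2 / 4 * e\<^sup>2" if "k \<ge> 0" for k x1 x2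
  proof -
    have "\<bar>k * (v * (x1 * r + x2 * s))\<bar> \<le> k * (\<bar>v\<bar> * ((\<bar>x1\<bar> + \<bar>x2\<bar>) * e))"
      unfolding abs_mult e_def using that by (intro mult_mono linear_bound2) auto
    also have "\<dots> \<le> v\<^sup>2 + (k * (\<bar>x1\<bar> + \<bar>x2\<bar>))\<^sup>2 / 4 * e\<^sup>2"
      using young[of 1 "\<bar>v\<bar>" "k * (\<bar>x1\<bar> + \<bar>x2\<bar>) * e"] by (simp add: power_mult_distrib mult_ac)
    finally show ?thesis .
  qed
  have H: "j1 * r\<^sup>2 + j2 * (r * s) + j3 * s\<^sup>2 \<le> (\<bar>j1\<bar> + \<bar>j2\<bar> + \<bar>j3\<bar>) * e\<^sup>2"
  proof -
    have "sqrt (r\<^sup>2 + s\<^sup>2) * sqrt (r\<^sup>2 + s\<^sup>2) = e\<^sup>2" by (simp add: e_def)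
    then show ?thesis
      using bilinear_bound2[of j1 r r j2 s 0 s j3] by (simp add: power2_eq_square)
  qed
  have NH: "N * (j1 * r\<^sup>2 + j2 * (r * s) + j3 * s\<^sup>2) \<le> N * (\<bar>j1\<bar> + \<bar>j2\<bar> + \<bar>j3\<bar>) * e\<^sup>2"
    using mult_left_mono[OF H, of N] N0 by (simp add: mult.assoc)
  have Nv: "N * (n * v * (b * \<kappa>1 * r + d * \<kappa>2 * s)) \<le> v\<^sup>2 + (N * n * (\<bar>b * \<kappa>1\<bar> + \<bar>d * \<kappa>2\<bar>))\<^sup>2 / 4 * e\<^sup>2"
    using lin[of "N * n" "b * \<kappa>1" "d * \<kappa>2"] N0 n by (simp add: mult.assoc)
  have mv: "- (m * (v * (h1 * r + h2 * s))) \<le> v\<^sup>2 + (m * (\<bar>h1\<bar> + \<bar>h2\<bar>))\<^sup>2 / 4 * e\<^sup>2"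
    using lin[of m h1 h2] m(2) by linarith
  have "N * (- (f1 * (\<tau>1 * r + \<tau>2 * s) + f2 * (\<tau>3 * r + \<tau>4 * s))) \<le> N * (c6 * (\<phi> * e))"
    using T[of f1 f2] N0 unfolding \<phi>_def by (intro mult_left_mono) auto
  also have "\<dots> \<le> \<phi>\<^sup>2 + (N * c6)\<^sup>2 / 4 * e\<^sup>2"
    using young[of 1 \<phi> "N * c6 * e"] by (simp add: power_mult_distrib mult_ac)
  finally have NT: "- (N * (f1 * (\<tau>1 * r + \<tau>2 * s) + f2 * (\<tau>3 * r + \<tau>4 * s))) \<le> \<phi>\<^sup>2 + (N * c6)\<^sup>2 / 4 * e\<^sup>2"
    by (simp only: mult_minus_right)
  have K': "K * (r\<^sup>2 + s\<^sup>2) = (\<kappa>1 + \<kappa>2) * e\<^sup>2 + c6\<^sup>2 / c0 * e\<^sup>2 + (m * (\<bar>h1\<bar> + \<bar>h2\<bar>))\<^sup>2 / 4 * e\<^sup>2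
      + N * (\<bar>j1\<bar> + \<bar>j2\<bar> + \<bar>j3\<bar>) * e\<^sup>2 + (N * n * (\<bar>b * \<kappa>1\<bar> + \<bar>d * \<kappa>2\<bar>))\<^sup>2 / 4 * e\<^sup>2 + (N * c6)\<^sup>2 / 4 * e\<^sup>2"
    unfolding K e(2)[symmetric] by (simp only: distrib_right)
  have Y: "n\<^sup>2 * (p\<^sup>2 + q\<^sup>2) = (n * y)\<^sup>2" by (simp add: power_mult_distrib y)
  have mB: "m * (A * (b * f1 + d * f2) + v * (h1 * r + h2 * s) + n * (b\<^sup>2 + d\<^sup>2) * v\<^sup>2)
     = m * (A * (b * f1 + d * f2)) + m * (v * (h1 * r + h2 * s)) + (\<rho> * v\<^sup>2 + 3 * v\<^sup>2)"
    using m(1) by (simp add: distrib_left mult.assoc[symmetric]) (simp add: distrib_right[symmetric] mult.assoc)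
  have NB: "N * ((j1 * r\<^sup>2 + j2 * (r * s) + j3 * s\<^sup>2) + n * v * (b * \<kappa>1 * r + d * \<kappa>2 * s)
          - (f1\<^sup>2 + f2\<^sup>2) - (f1 * (\<tau>1 * r + \<tau>2 * s) + f2 * (\<tau>3 * r + \<tau>4 * s)))
    = N * (j1 * r\<^sup>2 + j2 * (r * s) + j3 * s\<^sup>2) + N * (n * v * (b * \<kappa>1 * r + d * \<kappa>2 * s))
      - ((N - 1) * \<phi>\<^sup>2 + \<phi>\<^sup>2) - N * (f1 * (\<tau>1 * r + \<tau>2 * s) + f2 * (\<tau>3 * r + \<tau>4 * s))"
    unfolding \<phi>(2) by (simp add: distrib_left right_diff_distrib left_diff_distrib)
  have cX: "0 \<le> c0 * X\<^sup>2" using pos by simp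
  have W': "c0 * X\<^sup>2 + c0 * (n * y)\<^sup>2 \<le> W" using W unfolding Y by (simp add: distrib_left)
  have R: "- (v\<^sup>2 + c0 / 2 * (X\<^sup>2 + (n * y)\<^sup>2)) = - v\<^sup>2 - c0 * X\<^sup>2 / 2 - c0 * (n * y)\<^sup>2 / 2"
    by (simp add: distrib_left)
  have c4: "c0 / 4 * x = c0 * x / 4" for x by simp
  show ?thesis
    unfolding mB NB K' Y R
    using kin T1[unfolded c4] AB[unfolded c4] NH Nv mv NT W' cX by linarith
qed

text \<open>With \<open>f = (n\<^sup>2 A + R) y + n a B\<close> one has \<open>K y'' = - f - T y'\<close>, so the derivative of \<open>f \<bullet> K y'\<close> contains
  \<open>- \<bar>f\<bar>\<^sup>2\<close>. The derivative of \<open>v (B \<bullet> f)\<close> contains \<open>n \<bar>B\<bar>\<^sup>2 v\<^sup>2\<close>, at the expense of \<open>f\<close>. Finally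
  \<open>\<rho> a v + y \<bullet> K y'\<close> produces minus twice the potential energy at the expense of \<open>\<rho> v\<^sup>2\<close>. The functional
  combines the three; its constants may depend on \<open>n\<close>, since it is applied to finitely many frequencies only.\<close>

lemma fixed_frequency_lyapunov:
  assumes n: "n \<ge> 1"
  obtains c K M where "c > 0" "K \<ge> 0" "M \<ge> 0" "lyapunov_bounds n c K M"
proof -
  define H11 H12 H22 where "H11 = n\<^sup>2 * \<alpha> + \<alpha>1" and "H12 = n\<^sup>2 * \<beta> + \<alpha>3" and "H22 = n\<^sup>2 * \<gamma> + \<alpha>2"
  define h1 h2 where "h1 = b * H11 + d * H12" and "h2 = b * H12 + d * H22"
  define m where "m = (\<rho> + 3) / (n * (b\<^sup>2 + d\<^sup>2))"
  have B2: "b\<^sup>2 + d\<^sup>2 > 0" using coupled by (simp add: sum_power2_gt_zero_iff)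
  have m: "m * (n * (b\<^sup>2 + d\<^sup>2)) = \<rho> + 3" "m \<ge> 0" using B2 n pos by (auto simp: m_def)
  define G where "G = m * (n * (\<mu> + (\<bar>b\<bar> + \<bar>d\<bar>)) / \<rho> * (\<bar>b\<bar> + \<bar>d\<bar>))"
  define N where "N = 2 * G\<^sup>2 / c0 + 1"
  define c6 where "c6 = \<bar>\<tau>1\<bar> + \<bar>\<tau>2\<bar> + \<bar>\<tau>3\<bar> + \<bar>\<tau>4\<bar>"
  define K where "K = (\<kappa>1 + \<kappa>2) + c6\<^sup>2 / c0 + (m * (\<bar>h1\<bar> + \<bar>h2\<bar>))\<^sup>2 / 4
      + N * (\<bar>H11 * \<kappa>1\<bar> + \<bar>H12 * \<kappa>1 + H12 * \<kappa>2\<bar> + \<bar>H22 * \<kappa>2\<bar>) + (N * n * (\<bar>b * \<kappa>1\<bar> + \<bar>d * \<kappa>2\<bar>))\<^sup>2 / 4 + (N * c6)\<^sup>2 / 4"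
  have "0 \<le> 2 * G\<^sup>2 / c0" using pos by (intro divide_nonneg_pos) auto
  then have N0: "N \<ge> 0" by (simp add: N_def)
  then have K0: "K \<ge> 0" using pos by (simp add: K_def)
  define M where "M = \<bar>\<rho>\<bar> + \<bar>\<kappa>1\<bar> + \<bar>\<kappa>2\<bar> + \<bar>- (m * h1)\<bar> + \<bar>- (m * h2)\<bar> + \<bar>- (m * (b\<^sup>2 + d\<^sup>2))\<bar>
    + \<bar>N * H11 * \<kappa>1\<bar> + \<bar>N * H12 * \<kappa>1\<bar> + \<bar>N * b * \<kappa>1\<bar> + \<bar>N * H12 * \<kappa>2\<bar> + \<bar>N * H22 * \<kappa>2\<bar> + \<bar>N * d * \<kappa>2\<bar>"
  define c where "c = min 1 (c0 / 2)"
  have c: "c > 0" "c \<le> 1" "c \<le> c0 / 2" using pos by (auto simp: c_def)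
  have "lyapunov_bounds n c (K + c) M"
    unfolding lyapunov_bounds_def
  proof (intro allI impI)
    fix a v p r q s assume "mode_solution n a v p r q s"
    then obtain A P Q where *:
      "\<And>t. t \<ge> 0 \<Longrightarrow> (a has_real_derivative v t) (at t within {0..})"
      "\<And>t. t \<ge> 0 \<Longrightarrow> (p has_real_derivative r t) (at t within {0..})"
      "\<And>t. t \<ge> 0 \<Longrightarrow> (q has_real_derivative s t) (at t within {0..})"
      "\<And>t. t \<ge> 0 \<Longrightarrow> (v has_real_derivative A t) (at t within {0..})"
      "\<And>t. t \<ge> 0 \<Longrightarrow> (r has_real_derivative P t) (at t within {0..})"
      "\<And>t. t \<ge> 0 \<Longrightarrow> (s has_real_derivative Q t) (at t within {0..})"
      and A: "\<And>t. \<rho> * A t = - n * (\<mu> * (n * a t) + b * p t + d * q t)"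
      and P: "\<And>t. \<kappa>1 * P t = - n\<^sup>2 * (\<alpha> * p t + \<beta> * q t)
         - (b * (n * a t) + \<alpha>1 * p t + \<alpha>3 * q t + \<tau>1 * r t + \<tau>2 * s t)"
      and Q: "\<And>t. \<kappa>2 * Q t = - n\<^sup>2 * (\<beta> * p t + \<gamma> * q t)
         - (d * (n * a t) + \<alpha>3 * p t + \<alpha>2 * q t + \<tau>3 * r t + \<tau>4 * s t)"
      using mode_accelerations by blast
    define f1 f2 where "f1 t = H11 * p t + H12 * q t + b * (n * a t)"
      and "f2 t = H12 * p t + H22 * q t + d * (n * a t)" for t
    have P': "\<kappa>1 * P t = - f1 t - (\<tau>1 * r t + \<tau>2 * s t)" for t
      unfolding P by (simp add: f1_def H11_def H12_def algebra_simps)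
    have Q': "\<kappa>2 * Q t = - f2 t - (\<tau>3 * r t + \<tau>4 * s t)" for t
      unfolding Q by (simp add: f2_def H22_def H12_def algebra_simps)
    define L where "L t = \<rho> * (a t * v t) + \<kappa>1 * (p t * r t) + \<kappa>2 * (q t * s t)
      - m * (v t * (b * f1 t + d * f2 t)) + N * (f1 t * (\<kappa>1 * r t) + f2 t * (\<kappa>2 * s t))" for t
    define L' where "L' t = \<rho> * (v t)\<^sup>2 + (\<kappa>1 * (r t)\<^sup>2 + \<kappa>2 * (s t)\<^sup>2)
      + (a t * (\<rho> * A t) + p t * (\<kappa>1 * P t) + q t * (\<kappa>2 * Q t))
      - m * (A t * (b * f1 t + d * f2 t) + v t * (h1 * r t + h2 * s t) + n * (b\<^sup>2 + d\<^sup>2) * (v t)\<^sup>2)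
      + N * ((H11 * \<kappa>1 * (r t)\<^sup>2 + (H12 * \<kappa>1 + H12 * \<kappa>2) * (r t * s t) + H22 * \<kappa>2 * (s t)\<^sup>2)
        + n * v t * (b * \<kappa>1 * r t + d * \<kappa>2 * s t) + (f1 t * (\<kappa>1 * P t) + f2 t * (\<kappa>2 * Q t)))" for t
    show "\<exists>L L'. \<forall>t\<ge>0. (L has_real_derivative L' t) (at t within {0..}) \<and>
       \<bar>L t\<bar> \<le> M * mode_size n (a t) (v t) (p t) (r t) (q t) (s t) \<and>
       L' t \<le> - c * mode_size n (a t) (v t) (p t) (r t) (q t) (s t) + (K + c) * ((r t)\<^sup>2 + (s t)\<^sup>2)"
    proof (intro exI allI impI conjI)
      fix t :: real assume t: "t \<ge> 0"
      have df: "(f1 has_real_derivative H11 * r t + H12 * s t + b * (n * v t)) (at t within {0..})"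
        "(f2 has_real_derivative H12 * r t + H22 * s t + d * (n * v t)) (at t within {0..})"
        unfolding f1_def[abs_def] f2_def[abs_def]
        by ((rule *[OF t] derivative_eq_intros refl)+, simp)+
      show "(L has_real_derivative L' t) (at t within {0..})"
        unfolding L_def[abs_def] L'_def h1_def h2_def
        by (rule df *[OF t] derivative_eq_intros refl)+ (simp add: power2_eq_square algebra_simps)
      let ?S = "mode_size n (a t) (v t) (p t) (r t) (q t) (s t)"
      have bound: "\<bar>e * (x * y)\<bar> \<le> \<bar>e\<bar> * ?S"
        if "x \<in> {n * a t, v t, n * p t, n * q t, r t, s t, a t, p t, q t}"
          "y \<in> {n * a t, v t, n * p t, n * q t, r t, s t, a t, p t, q t}" for e x y
        using mode_size_mult_bound[OF n that] .
      have L_eq: "L t = \<rho> * (a t * v t) + \<kappa>1 * (p t * r t) + \<kappa>2 * (q t * s t)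
        + - (m * h1) * (v t * p t) + - (m * h2) * (v t * q t) + - (m * (b\<^sup>2 + d\<^sup>2)) * (v t * (n * a t))
        + (N * H11 * \<kappa>1) * (p t * r t) + (N * H12 * \<kappa>1) * (q t * r t) + (N * b * \<kappa>1) * ((n * a t) * r t)
        + (N * H12 * \<kappa>2) * (p t * s t) + (N * H22 * \<kappa>2) * (q t * s t) + (N * d * \<kappa>2) * ((n * a t) * s t)"
        by (simp add: L_def f1_def f2_def h1_def h2_def power2_eq_square algebra_simps)
      show "\<bar>L t\<bar> \<le> M * ?S"
        unfolding L_eq M_def distrib_right
        by (intro order_trans[OF abs_triangle_ineq] add_mono bound) auto
      define W where "W = \<mu> * (n * a t)\<^sup>2 + 2 * (n * a t) * (b * p t + d * q t)
        + (\<alpha>1 * (p t)\<^sup>2 + 2 * \<alpha>3 * p t * q t + \<alpha>2 * (q t)\<^sup>2)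
        + n\<^sup>2 * (\<alpha> * (p t)\<^sup>2 + 2 * \<beta> * p t * q t + \<gamma> * (q t)\<^sup>2)"
      have A1: "a t * (\<rho> * A t) = - (\<mu> * (n * a t)\<^sup>2 + n * a t * (b * p t + d * q t))"
        unfolding A by (simp add: power2_eq_square algebra_simps)
      have PQ1: "p t * (\<kappa>1 * P t) + q t * (\<kappa>2 * Q t)
        = - (n\<^sup>2 * (\<alpha> * (p t)\<^sup>2 + 2 * \<beta> * p t * q t + \<gamma> * (q t)\<^sup>2) + n * a t * (b * p t + d * q t)
        + (\<alpha>1 * (p t)\<^sup>2 + 2 * \<alpha>3 * p t * q t + \<alpha>2 * (q t)\<^sup>2)
        + (p t * (\<tau>1 * r t + \<tau>2 * s t) + q t * (\<tau>3 * r t + \<tau>4 * s t)))"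
        unfolding P Q by (simp add: power2_eq_square algebra_simps)
      have 1: "a t * (\<rho> * A t) + p t * (\<kappa>1 * P t) + q t * (\<kappa>2 * Q t)
        = - W - (p t * (\<tau>1 * r t + \<tau>2 * s t) + q t * (\<tau>3 * r t + \<tau>4 * s t))"
        using A1 PQ1 unfolding W_def by linarith
      have 2: "f1 t * (\<kappa>1 * P t) + f2 t * (\<kappa>2 * Q t) = - ((f1 t)\<^sup>2 + (f2 t)\<^sup>2)
        - (f1 t * (\<tau>1 * r t + \<tau>2 * s t) + f2 t * (\<tau>3 * r t + \<tau>4 * s t))"
        unfolding P' Q' by (simp add: power2_eq_square algebra_simps)
      have "L' t \<le> - ((v t)\<^sup>2 + c0 / 2 * ((n * a t)\<^sup>2 + n\<^sup>2 * ((p t)\<^sup>2 + (q t)\<^sup>2))) + K * ((r t)\<^sup>2 + (s t)\<^sup>2)"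
        using fixed_frequency_estimate[OF n m A G_def N_def c6_def K_def
            mode_potential_lower[of n "a t" "p t" "q t", folded W_def],
            of "v t" "r t" "s t" "f1 t" "f2 t"]
        unfolding L'_def 1 2 by (simp only: add_diff_eq add_uminus_conv_diff)
      moreover have "c * (v t)\<^sup>2 \<le> 1 * (v t)\<^sup>2"
        using c by (intro mult_right_mono) auto
      moreover have "c * ((n * a t)\<^sup>2 + n\<^sup>2 * ((p t)\<^sup>2 + (q t)\<^sup>2))
          \<le> c0 / 2 * ((n * a t)\<^sup>2 + n\<^sup>2 * ((p t)\<^sup>2 + (q t)\<^sup>2))"
        using c by (intro mult_right_mono) auto
      moreover have "- c * ?S + (K + c) * ((r t)\<^sup>2 + (s t)\<^sup>2)
        = - (c * (v t)\<^sup>2) - c * ((n * a t)\<^sup>2 + n\<^sup>2 * ((p t)\<^sup>2 + (q t)\<^sup>2)) + K * ((r t)\<^sup>2 + (s t)\<^sup>2)"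
        by (simp add: mode_size_def algebra_simps)
      ultimately show "L' t \<le> - c * ?S + (K + c) * ((r t)\<^sup>2 + (s t)\<^sup>2)" by linarith
    qed
  qed
  then show ?thesis using c K0 by (intro that[of c "K + c" M]) (auto simp: M_def)
qed

section \<open>Decay uniform in the frequency\<close>

definition mode_decays :: "real \<Rightarrow> real \<Rightarrow> real \<Rightarrow> bool" where
  "mode_decays n M \<xi> \<longleftrightarrow> (\<forall>a v p r q s t. mode_solution n a v p r q s \<longrightarrow> t \<ge> 0 \<longrightarrow>
     mode_size n (a t) (v t) (p t) (r t) (q t) (s t)
       \<le> M * mode_size n (a 0) (v 0) (p 0) (r 0) (q 0) (s 0) * exp (- \<xi> * t))"

lemma mode_decays_mono:
  assumes "mode_decays n M \<xi>" "M \<le> M'" "\<xi>' \<le> \<xi>" "0 \<le> M'"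
  shows "mode_decays n M' \<xi>'"
  unfolding mode_decays_def
proof (intro allI impI)
  fix a v p r q s :: "real \<Rightarrow> real" and t :: real
  let ?S = "\<lambda>t. mode_size n (a t) (v t) (p t) (r t) (q t) (s t)"
  assume "mode_solution n a v p r q s" and t: "t \<ge> 0"
  then have "?S t \<le> M * ?S 0 * exp (- \<xi> * t)" using assms(1) by (auto simp: mode_decays_def)
  also have "\<dots> \<le> M' * ?S 0 * exp (- \<xi>' * t)"
    using assms t mode_size_nonneg by (intro mult_mono mult_right_mono mult_nonneg_nonneg) (auto intro!: mult_right_mono)
  finally show "?S t \<le> M' * ?S 0 * exp (- \<xi>' * t)" .
qed

lemma lyapunov_bounds_imp_decay:
  assumes "c > 0" "K \<ge> 0" "M0 \<ge> 0"
  obtains M \<xi> where "M \<ge> 0" "\<xi> > 0" "\<And>n. n \<ge> 1 \<Longrightarrow> lyapunov_bounds n c K M0 \<Longrightarrow> mode_decays n M \<xi>"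
proof -
  define e1 where "e1 = min (min \<rho> c0) (min \<kappa>1 \<kappa>2) / 2"
  define e2 where "e2 = \<bar>\<rho>\<bar> + \<bar>\<kappa>1\<bar> + \<bar>\<kappa>2\<bar> + \<bar>\<mu>\<bar> + \<bar>2 * b\<bar> + \<bar>2 * d\<bar> + \<bar>\<alpha>1\<bar> + \<bar>2 * \<alpha>3\<bar> + \<bar>\<alpha>2\<bar> + \<bar>\<alpha>\<bar> + \<bar>2 * \<beta>\<bar> + \<bar>\<gamma>\<bar>"
  have e: "e1 > 0" "e2 > 0" using pos by (auto simp: e1_def e2_def)
  define N where "N = (2 * M0 + 1) / e1 + K / \<delta>"
  have "(2 * M0 + 1) / e1 > 0" "K / \<delta> \<ge> 0" using assms e pos by (auto intro!: divide_pos_pos)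
  then have N: "N > 0" unfolding N_def by linarith
  have den: "N * e2 + M0 > 0" using N e assms by (simp add: add_pos_nonneg)
  show ?thesis
  proof (rule that)
    show "N * e2 + M0 \<ge> 0" "c / (N * e2 + M0) > 0" using den assms by auto
    fix n :: real assume n: "n \<ge> 1" and lyap: "lyapunov_bounds n c K M0"
    show "mode_decays n (N * e2 + M0) (c / (N * e2 + M0))"
      unfolding mode_decays_def
    proof (intro allI impI)
      fix a v p r q s :: "real \<Rightarrow> real" and t :: real
      assume sol: "mode_solution n a v p r q s" and t: "t \<ge> 0"
      obtain L L' where L: "\<forall>t\<ge>0. (L has_real_derivative L' t) (at t within {0..}) \<and>
         \<bar>L t\<bar> \<le> M0 * mode_size n (a t) (v t) (p t) (r t) (q t) (s t) \<and>
         L' t \<le> - c * mode_size n (a t) (v t) (p t) (r t) (q t) (s t) + K * ((r t)\<^sup>2 + (s t)\<^sup>2)"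
        using lyap sol unfolding lyapunov_bounds_def by blast
      obtain E' where E': "\<And>t. t \<ge> 0 \<Longrightarrow>
          ((\<lambda>t. mode_energy n (a t) (v t) (p t) (r t) (q t) (s t)) has_real_derivative E' t) (at t within {0..})"
        "\<And>t. E' t \<le> - \<delta> * ((r t)\<^sup>2 + (s t)\<^sup>2)"
        using mode_energy_deriv[OF sol] by blast
      show "mode_size n (a t) (v t) (p t) (r t) (q t) (s t)
         \<le> (N * e2 + M0) * mode_size n (a 0) (v 0) (p 0) (r 0) (q 0) (s 0) * exp (- (c / (N * e2 + M0)) * t)"
        by (rule lyapunov_exponential_decay[OF E'(1) _ E'(2) _ _ mode_energy_lower[OF e1_def]
              mode_energy_upper[OF n e2_def] _ _ pos(6) assms(1-3) e N_def t, where L = L and L' = L'])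
          (use L in \<open>auto simp: mode_size_nonneg\<close>)
    qed
  qed
qed

text \<open>Beyond a threshold the first functional serves all frequencies; the finitely many integers below it are
  covered by taking the largest factor and the smallest rate.\<close>

lemma uniform_mode_decay:
  assumes "(\<mu> * \<kappa>1 / \<rho> - \<alpha>) * (\<mu> * \<kappa>2 / \<rho> - \<gamma>) - \<beta>\<^sup>2 = 0"
    and "d\<^sup>2 * (\<mu> * \<kappa>1 / \<rho> - \<alpha>) + b\<^sup>2 * (\<mu> * \<kappa>2 / \<rho> - \<gamma>) + 2 * b * d * \<beta> \<noteq> 0"
  obtains M \<xi> where "M \<ge> 0" "\<xi> > 0" "\<And>n :: nat. n \<ge> 1 \<Longrightarrow> mode_decays (real n) M \<xi>"
proof -
  obtain c K M0 N where c: "c > 0" "K \<ge> 0" "M0 \<ge> 0" and N: "N \<ge> 1"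
    and high: "\<And>n. n \<ge> N \<Longrightarrow> lyapunov_bounds n c K M0"
    using high_frequency_lyapunov[OF assms] by blast
  obtain M1 \<xi>1 where 1: "M1 \<ge> 0" "\<xi>1 > 0" "\<And>n. n \<ge> 1 \<Longrightarrow> lyapunov_bounds n c K M0 \<Longrightarrow> mode_decays n M1 \<xi>1"
    using lyapunov_bounds_imp_decay[OF c] by blast
  have single: "\<exists>M \<xi>. M \<ge> 0 \<and> \<xi> > 0 \<and> mode_decays (real n) M \<xi>" if "n \<ge> 1" for n :: nat
  proof -
    obtain c K M0 where c: "c > 0" "K \<ge> 0" "M0 \<ge> 0" "lyapunov_bounds (real n) c K M0"
      using fixed_frequency_lyapunov[of "real n"] \<open>n \<ge> 1\<close> by auto
    obtain M \<xi> where "M \<ge> 0" "\<xi> > 0" "\<And>n. n \<ge> 1 \<Longrightarrow> lyapunov_bounds n c K M0 \<Longrightarrow> mode_decays n M \<xi>"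
      using lyapunov_bounds_imp_decay[OF c(1-3)] by blast
    moreover have "real n \<ge> 1" using \<open>n \<ge> 1\<close> by simp
    ultimately show ?thesis using c(4) by blast
  qed
  have low: "\<exists>M \<xi>. M \<ge> 0 \<and> \<xi> > 0 \<and> (\<forall>n. 1 \<le> n \<and> n < k \<longrightarrow> mode_decays (real n) M \<xi>)" for k :: nat
  proof (induction k)
    case 0 show ?case by (intro exI[of _ 1]) simp
  next
    case (Suc k)
    then obtain M \<xi> where M: "M \<ge> 0" "\<xi> > 0" "\<And>n. 1 \<le> n \<Longrightarrow> n < k \<Longrightarrow> mode_decays (real n) M \<xi>" by blast
    show ?case
    proof (cases "k \<ge> 1")
      case True
      then obtain M' \<xi>' where M': "M' \<ge> 0" "\<xi>' > 0" "mode_decays (real k) M' \<xi>'" using single by blast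
      have "mode_decays (real n) (max M M') (min \<xi> \<xi>')" if "1 \<le> n" "n < Suc k" for n
        using that M M' mode_decays_mono[of _ M \<xi> "max M M'" "min \<xi> \<xi>'"]
          mode_decays_mono[of _ M' \<xi>' "max M M'" "min \<xi> \<xi>'"]
        by (cases "n = k") auto
      then show ?thesis using M M' by (intro exI[of _ "max M M'"] exI[of _ "min \<xi> \<xi>'"]) auto
    next
      case False
      then show ?thesis by (intro exI[of _ 1]) auto
    qed
  qed
  obtain k :: nat where k: "real k \<ge> N" using real_arch_simple by blast
  obtain M2 \<xi>2 where 2: "M2 \<ge> 0" "\<xi>2 > 0" "\<And>n. 1 \<le> n \<Longrightarrow> n < k \<Longrightarrow> mode_decays (real n) M2 \<xi>2"
    using low[of k] by blast
  show ?thesis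
  proof (rule that[of "max M1 M2" "min \<xi>1 \<xi>2"])
    fix n :: nat assume n: "n \<ge> 1"
    show "mode_decays (real n) (max M1 M2) (min \<xi>1 \<xi>2)"
    proof (cases "n < k")
      case True
      then show ?thesis using 1 2 n mode_decays_mono[OF 2(3)[of n]] by auto
    next
      case False
      then have "real n \<ge> N" using k by linarith
      then show ?thesis using 1 2 n N mode_decays_mono[OF 1(3)[of "real n"]] high by auto
    qed
  qed (use 1 2 in auto)
qed

end

section \<open>Coercivity of the elastic and the damping form\<close>

lemma UNIV_5: "UNIV = {1, 2, 3, 4, 5 :: 5}"
proof -
  have "x = 1 \<or> x = 2 \<or> x = 3 \<or> x = 4 \<or> x = 5" for x :: 5
  proof (induct x)
    case (of_int z)
    then have "z = 0 \<or> z = 1 \<or> z = 2 \<or> z = 3 \<or> z = 4" by fastforce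
    then show ?case by auto
  qed
  then show ?thesis by auto
qed

lemma sum_5: "sum f (UNIV :: 5 set) = f 1 + f 2 + f 3 + f 4 + f 5" for f :: "5 \<Rightarrow> real"
  unfolding UNIV_5 by (simp add: ac_simps)

lemma vector_5:
  fixes a b c d e :: "'a :: zero"
  shows "(vector [a, b, c, d, e] :: 'a ^ 5) $ 1 = a" "(vector [a, b, c, d, e] :: 'a ^ 5) $ 2 = b"
    "(vector [a, b, c, d, e] :: 'a ^ 5) $ 3 = c" "(vector [a, b, c, d, e] :: 'a ^ 5) $ 4 = d"
    "(vector [a, b, c, d, e] :: 'a ^ 5) $ 5 = e"
  by (simp_all add: vector_def)

text \<open>The quadratic form attains a positive minimum on the compact unit sphere.\<close>

lemma positive_definite_coercive:
  fixes A :: "real ^ 'n ^ 'n"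
  assumes "positive_definite A"
  obtains c where "c > 0" "\<And>x. c * (norm x)\<^sup>2 \<le> x \<bullet> (A *v x)"
proof -
  have "continuous_on (sphere 0 1) (\<lambda>x. x \<bullet> (A *v x))"
    by (intro continuous_intros linear_continuous_on matrix_vector_mul_bounded_linear)
  moreover have "sphere 0 1 \<noteq> ({} :: (real ^ 'n) set)" by simp
  ultimately obtain z where z: "z \<in> sphere 0 1" "\<And>x. x \<in> sphere 0 1 \<Longrightarrow> z \<bullet> (A *v z) \<le> x \<bullet> (A *v x)"
    using continuous_attains_inf[of "sphere 0 1" "\<lambda>x. x \<bullet> (A *v x)"] by auto
  have "z \<noteq> 0" using z(1) by auto
  then have pos: "z \<bullet> (A *v z) > 0" using assms by (simp add: positive_definite_def)
  have "z \<bullet> (A *v z) * (norm x)\<^sup>2 \<le> x \<bullet> (A *v x)" for x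
  proof (cases "x = 0")
    case False
    have "z \<bullet> (A *v z) \<le> (x /\<^sub>R norm x) \<bullet> (A *v (x /\<^sub>R norm x))"
      using False by (intro z(2)) simp
    also have "\<dots> = x \<bullet> (A *v x) / (norm x)\<^sup>2"
      by (simp add: matrix_vector_mult_scaleR power2_eq_square divide_inverse mult_ac)
    finally show ?thesis using False by (simp add: field_simps)
  qed simp
  then show ?thesis using pos that by blast
qed

lemma coefficient_matrix_form:
  "vector [X, p, q, P, Q] \<bullet> (coefficient_matrix C *v vector [X, p, q, P, Q])
    = c_mu C * X\<^sup>2 + 2 * X * (c_b C * p + c_d C * q)
      + (c_alpha1 C * p\<^sup>2 + 2 * c_alpha3 C * p * q + c_alpha2 C * q\<^sup>2)
      + (c_alpha C * P\<^sup>2 + 2 * c_beta C * P * Q + c_gamma C * Q\<^sup>2)"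
  unfolding inner_vec_def matrix_vector_mult_def coefficient_matrix_def
  by (simp add: sum_5 vector_5 power2_eq_square algebra_simps)

text \<open>The constant is determinant over trace of the symmetrised damping matrix, a lower bound for its smaller
  eigenvalue.\<close>

lemma damping_coercive:
  fixes \<tau>1 \<tau>2 \<tau>3 \<tau>4 :: real
  assumes "\<tau>1 > 0" "4 * \<tau>1 * \<tau>4 > (\<tau>2 + \<tau>3)\<^sup>2"
  obtains \<delta> where "\<delta> > 0" "\<And>r s. \<delta> * (r\<^sup>2 + s\<^sup>2) \<le> \<tau>1 * r\<^sup>2 + (\<tau>2 + \<tau>3) * r * s + \<tau>4 * s\<^sup>2"
proof -
  define h where "h = (\<tau>2 + \<tau>3) / 2"
  have h: "\<tau>1 * \<tau>4 - h\<^sup>2 > 0" using assms(2) by (simp add: h_def power_divide)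
  then have "\<tau>1 * \<tau>4 > 0" using zero_le_power2[of h] by linarith
  then have \<tau>4: "\<tau>4 > 0" using assms(1) by (simp add: zero_less_mult_iff)
  define \<delta> where "\<delta> = (\<tau>1 * \<tau>4 - h\<^sup>2) / (\<tau>1 + \<tau>4)"
  have tr: "\<delta> * (\<tau>1 + \<tau>4) = \<tau>1 * \<tau>4 - h\<^sup>2" using assms(1) \<tau>4 by (simp add: \<delta>_def)
  have \<delta>: "\<delta> > 0" using h assms(1) \<tau>4 by (simp add: \<delta>_def)
  have "\<delta> * (\<tau>1 + \<tau>4) < \<tau>1 * (\<tau>1 + \<tau>4)"
    unfolding tr
    using distrib_left[of \<tau>1 \<tau>1 \<tau>4] mult_pos_pos[OF assms(1) assms(1)] zero_le_power2[of h] by linarith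
  then have gap: "\<tau>1 - \<delta> > 0" using assms(1) \<tau>4 by simp
  have det: "(\<tau>1 - \<delta>) * (\<tau>4 - \<delta>) - h\<^sup>2 = \<delta>\<^sup>2" using tr by (simp add: power2_eq_square algebra_simps)
  have "\<delta> * (r\<^sup>2 + s\<^sup>2) \<le> \<tau>1 * r\<^sup>2 + (\<tau>2 + \<tau>3) * r * s + \<tau>4 * s\<^sup>2" for r s
  proof -
    have "0 \<le> ((\<tau>1 - \<delta>) * r + h * s)\<^sup>2 + ((\<tau>1 - \<delta>) * (\<tau>4 - \<delta>) - h\<^sup>2) * s\<^sup>2" unfolding det by simp
    also have "\<dots> = (\<tau>1 - \<delta>) * ((\<tau>1 - \<delta>) * r\<^sup>2 + 2 * h * r * s + (\<tau>4 - \<delta>) * s\<^sup>2)"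
      by (simp add: power2_eq_square algebra_simps)
    finally have "0 \<le> (\<tau>1 - \<delta>) * r\<^sup>2 + 2 * h * r * s + (\<tau>4 - \<delta>) * s\<^sup>2"
      using gap by (simp add: zero_le_mult_iff)
    moreover have "2 * h = \<tau>2 + \<tau>3" by (simp add: h_def)
    ultimately have "0 \<le> (\<tau>1 - \<delta>) * r\<^sup>2 + (\<tau>2 + \<tau>3) * r * s + (\<tau>4 - \<delta>) * s\<^sup>2" by (simp only:)
    then show ?thesis by (simp add: algebra_simps)
  qed
  then show ?thesis using \<delta> that by blast
qed

section \<open>Decay of the energy\<close>

lemma time_deriv_coefficient:
  assumes "has_L2_time_deriv f g" "\<And>t. t \<ge> 0 \<Longrightarrow> f t \<in> L2" "\<And>t. t \<ge> 0 \<Longrightarrow> g t \<in> L2" "e \<in> L2" "t \<ge> 0"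
  shows "((\<lambda>s. LINT x|I\<pi>. f s x * e x) has_real_derivative (LINT x|I\<pi>. g t x * e x)) (at t within {0..})"
  unfolding has_field_derivative_iff
proof (rule LIM_zero_cancel, rule Lim_null_comparison)
  let ?N = "\<lambda>s. L2_norm (\<lambda>x. (f s x - f t x) / (s - t) - g t x)"
  have "(?N \<longlongrightarrow> 0) (at t within {0..})" using assms(1,5) by (simp add: has_L2_time_deriv_def)
  from tendsto_mult_right[OF this, of "L2_norm e"]
  show "((\<lambda>s. ?N s * L2_norm e) \<longlongrightarrow> 0) (at t within {0..})" by simp
  have "norm (((LINT x|I\<pi>. f s x * e x) - (LINT x|I\<pi>. f t x * e x)) / (s - t) - (LINT x|I\<pi>. g t x * e x))
      \<le> ?N s * L2_norm e" if "s \<ge> 0" for s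
  proof -
    note L = assms(2)[OF that] assms(2)[OF assms(5)] assms(3)[OF assms(5)]
    have "((LINT x|I\<pi>. f s x * e x) - (LINT x|I\<pi>. f t x * e x)) / (s - t) - (LINT x|I\<pi>. g t x * e x)
      = (LINT x|I\<pi>. ((f s x - f t x) / (s - t) - g t x) * e x)"
      using L assms(4) by (simp add: left_diff_distrib diff_divide_distrib L2_mult_integrable times_divide_eq_left)
    then show ?thesis
      using L2_Cauchy_Schwarz[OF L2_diff[OF L2_divide[OF L2_diff[OF L(1,2)]] L(3)] assms(4)] by simp
  qed
  then show "\<forall>\<^sub>F s in at t within {0..}.
      norm (((LINT x|I\<pi>. f s x * e x) - (LINT x|I\<pi>. f t x * e x)) / (s - t) - (LINT x|I\<pi>. g t x * e x))
      \<le> ?N s * L2_norm e"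
    by (auto simp: eventually_at_filter)
qed

abbreviation sin_coeff :: "(real \<Rightarrow> real) \<Rightarrow> nat \<Rightarrow> real" where
  "sin_coeff f n \<equiv> LINT x|I\<pi>. f x * sin (real n * x)"

abbreviation cos_coeff :: "(real \<Rightarrow> real) \<Rightarrow> nat \<Rightarrow> real" where
  "cos_coeff f n \<equiv> LINT x|I\<pi>. f x * cos (real n * x)"

lemma Parseval_sin_coeff:
  "f \<in> L2 \<Longrightarrow> (\<lambda>n. (sin_coeff f (Suc n))\<^sup>2 * (2 / pi)) sums (L2_norm f)\<^sup>2"
  using Parseval_sines[of f] by (simp add: sines_def)

lemma Parseval_cos_coeff:
  assumes "f \<in> L2" "cos_coeff f 0 = 0"
  shows "(\<lambda>n. (cos_coeff f (Suc n))\<^sup>2 * (2 / pi)) sums (L2_norm f)\<^sup>2"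
proof -
  define F where "F n = (cos_coeff f n)\<^sup>2 / (if n = 0 then pi else pi / 2)" for n
  have "F sums (L2_norm f)\<^sup>2"
    using Parseval_cosines[OF assms(1)] by (simp add: cosines_def F_def[abs_def])
  moreover have "F 0 = 0" using assms(2) by (simp add: F_def)
  ultimately have "(\<lambda>n. F (Suc n)) sums (L2_norm f)\<^sup>2" by (simp add: sums_Suc_iff)
  then show ?thesis by (simp add: F_def)
qed

text \<open>Zero mean removes the only mode with \<open>n < 1\<close>.\<close>

lemma Poincare_H1_star:
  assumes "f \<in> H1_star" shows "(L2_norm f)\<^sup>2 \<le> (L2_norm (wderiv f))\<^sup>2"
proof -
  have f: "f \<in> H1" "cos_coeff f 0 = 0" using assms by (auto simp: H1_star_def)
  show ?thesis
  proof (rule sums_le[OF _ Parseval_cos_coeff Parseval_sin_coeff])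
    fix n
    have "1 * (cos_coeff f (Suc n))\<^sup>2 \<le> (real (Suc n))\<^sup>2 * (cos_coeff f (Suc n))\<^sup>2"
      by (intro mult_right_mono) auto
    then show "(cos_coeff f (Suc n))\<^sup>2 * (2 / pi) \<le> (sin_coeff (wderiv f) (Suc n))\<^sup>2 * (2 / pi)"
      unfolding sine_coefficient_wderiv[OF f(1)] by (intro mult_right_mono) (auto simp: power_mult_distrib)
  qed (use f H1_in_L2 wderiv_properties in auto)
qed

lemma energy_le_gradient_norms:
  obtains K where "K \<ge> 0" "\<And>u u' \<phi> \<phi>' \<psi> \<psi>'. (u, u', \<phi>, \<phi>', \<psi>, \<psi>') \<in> energy_space \<Longrightarrow>
    energy C (u, u', \<phi>, \<phi>', \<psi>, \<psi>') \<le> K * ((L2_norm (wderiv u))\<^sup>2 + (L2_norm u')\<^sup>2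
      + (L2_norm (wderiv \<phi>))\<^sup>2 + (L2_norm (wderiv \<psi>))\<^sup>2 + (L2_norm \<phi>')\<^sup>2 + (L2_norm \<psi>')\<^sup>2)"
proof -
  define k where "k = \<bar>c_rho C\<bar> + \<bar>c_kappa1 C\<bar> + \<bar>c_kappa2 C\<bar> + \<bar>c_mu C\<bar> + \<bar>c_alpha C\<bar> + \<bar>c_gamma C\<bar>
    + \<bar>c_alpha1 C\<bar> + \<bar>c_alpha2 C\<bar> + \<bar>c_beta C\<bar> + \<bar>c_b C\<bar> + \<bar>c_d C\<bar> + \<bar>c_alpha3 C\<bar>"
  have k: "k \<ge> 0" by (simp add: k_def)
  have pointwise: "c_rho C * v\<^sup>2 + c_kappa1 C * r\<^sup>2 + c_kappa2 C * s\<^sup>2 + c_mu C * X\<^sup>2 + c_alpha C * P\<^sup>2 + c_gamma C * Q\<^sup>2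
       + c_alpha1 C * p\<^sup>2 + c_alpha2 C * q\<^sup>2 + 2 * c_beta C * P * Q + 2 * c_b C * X * p + 2 * c_d C * X * q
       + 2 * c_alpha3 C * p * q \<le> k * (X\<^sup>2 + v\<^sup>2 + P\<^sup>2 + Q\<^sup>2 + r\<^sup>2 + s\<^sup>2 + p\<^sup>2 + q\<^sup>2)" for v r s X P Q p q
  proof -
    define S where "S = X\<^sup>2 + v\<^sup>2 + P\<^sup>2 + Q\<^sup>2 + r\<^sup>2 + s\<^sup>2 + p\<^sup>2 + q\<^sup>2"
    have mult: "c * y \<le> \<bar>c\<bar> * S" if "\<bar>y\<bar> \<le> S" for c y
      using mult_left_mono[OF that, of "\<bar>c\<bar>"] by (simp add: abs_mult[symmetric])
    have sq: "\<bar>y\<^sup>2\<bar> \<le> S" if "y \<in> {X, v, P, Q, r, s, p, q}" for y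
      using that by (auto simp: S_def)
    have cross: "2 * c * y * z \<le> \<bar>c\<bar> * S" if "y\<^sup>2 + z\<^sup>2 \<le> S" for c y z
    proof -
      have "\<bar>2 * y * z\<bar> \<le> y\<^sup>2 + z\<^sup>2"
        using sum_squares_bound[of "\<bar>y\<bar>" "\<bar>z\<bar>"] by (simp add: abs_mult)
      then show ?thesis using mult[of "2 * y * z" c] that by (simp add: mult_ac)
    qed
    show ?thesis
      unfolding S_def[symmetric] k_def distrib_right
      by (intro add_mono mult[OF sq] cross) (auto simp: S_def)
  qed
  show ?thesis
  proof (rule that[of k])
    fix u u' \<phi> \<phi>' \<psi> \<psi>'
    assume "(u, u', \<phi>, \<phi>', \<psi>, \<psi>') \<in> energy_space"
    then have H: "u \<in> H1_0" "u' \<in> L2" "\<phi> \<in> H1_star" "\<phi>' \<in> L2" "\<psi> \<in> H1_star" "\<psi>' \<in> L2"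
      by (auto simp: energy_space_def L2_star_def)
    then have H1: "u \<in> H1" "\<phi> \<in> H1" "\<psi> \<in> H1" by (auto simp: H1_0_def H1_star_def)
    have L: "u' \<in> L2" "\<phi>' \<in> L2" "\<psi>' \<in> L2" "\<phi> \<in> L2" "\<psi> \<in> L2"
      "wderiv u \<in> L2" "wderiv \<phi> \<in> L2" "wderiv \<psi> \<in> L2"
      using H H1 by (auto intro: H1_in_L2 wderiv_properties)
    note sq = L[THEN L2_square_integrable]
    have int: "integrable I\<pi> (\<lambda>x. c * f x * g x)" if "f \<in> L2" "g \<in> L2" for c f g
      using integrable_mult_right[OF L2_mult_integrable[OF that], of c] by (simp add: mult.assoc)
    have "2 * energy C (u, u', \<phi>, \<phi>', \<psi>, \<psi>') = (LINT x|I\<pi>.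
       c_rho C * (u' x)\<^sup>2 + c_kappa1 C * (\<phi>' x)\<^sup>2 + c_kappa2 C * (\<psi>' x)\<^sup>2
       + c_mu C * (wderiv u x)\<^sup>2 + c_alpha C * (wderiv \<phi> x)\<^sup>2 + c_gamma C * (wderiv \<psi> x)\<^sup>2
       + c_alpha1 C * (\<phi> x)\<^sup>2 + c_alpha2 C * (\<psi> x)\<^sup>2
       + 2 * c_beta C * wderiv \<phi> x * wderiv \<psi> x
       + 2 * c_b C * wderiv u x * \<phi> x + 2 * c_d C * wderiv u x * \<psi> x
       + 2 * c_alpha3 C * \<phi> x * \<psi> x)"
      by (simp add: energy_def)
    also have "\<dots> \<le> (LINT x|I\<pi>. k * ((wderiv u x)\<^sup>2 + (u' x)\<^sup>2 + (wderiv \<phi> x)\<^sup>2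
        + (wderiv \<psi> x)\<^sup>2 + (\<phi>' x)\<^sup>2 + (\<psi>' x)\<^sup>2 + (\<phi> x)\<^sup>2 + (\<psi> x)\<^sup>2))"
      by (rule integral_mono[OF _ _ pointwise])
        (intro Bochner_Integration.integrable_add integrable_mult_right sq int L)+
    also have "\<dots> = k * ((L2_norm (wderiv u))\<^sup>2 + (L2_norm u')\<^sup>2 + (L2_norm (wderiv \<phi>))\<^sup>2
        + (L2_norm (wderiv \<psi>))\<^sup>2 + (L2_norm \<phi>')\<^sup>2 + (L2_norm \<psi>')\<^sup>2 + (L2_norm \<phi>)\<^sup>2 + (L2_norm \<psi>)\<^sup>2)"
      using sq by (simp add: L2_norm_power2)
    also have "\<dots> \<le> k * (2 * ((L2_norm (wderiv u))\<^sup>2 + (L2_norm u')\<^sup>2 + (L2_norm (wderiv \<phi>))\<^sup>2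
        + (L2_norm (wderiv \<psi>))\<^sup>2 + (L2_norm \<phi>')\<^sup>2 + (L2_norm \<psi>')\<^sup>2))"
    proof (rule mult_left_mono[OF _ k])
      have aux: "a + b + c + d + e + f + g + h \<le> 2 * (a + b + c + d + e + f)"
        if "0 \<le> a" "0 \<le> b" "0 \<le> e" "0 \<le> f" "g \<le> c" "h \<le> d" for a b c d e f g h :: real
        using that by simp
      show "(L2_norm (wderiv u))\<^sup>2 + (L2_norm u')\<^sup>2 + (L2_norm (wderiv \<phi>))\<^sup>2
        + (L2_norm (wderiv \<psi>))\<^sup>2 + (L2_norm \<phi>')\<^sup>2 + (L2_norm \<psi>')\<^sup>2 + (L2_norm \<phi>)\<^sup>2 + (L2_norm \<psi>)\<^sup>2
        \<le> 2 * ((L2_norm (wderiv u))\<^sup>2 + (L2_norm u')\<^sup>2 + (L2_norm (wderiv \<phi>))\<^sup>2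
        + (L2_norm (wderiv \<psi>))\<^sup>2 + (L2_norm \<phi>')\<^sup>2 + (L2_norm \<psi>')\<^sup>2)"
        by (rule aux) (intro zero_le_power2 Poincare_H1_star H)+
    qed
    finally show "energy C (u, u', \<phi>, \<phi>', \<psi>, \<psi>') \<le> k * ((L2_norm (wderiv u))\<^sup>2 + (L2_norm u')\<^sup>2
      + (L2_norm (wderiv \<phi>))\<^sup>2 + (L2_norm (wderiv \<psi>))\<^sup>2 + (L2_norm \<phi>')\<^sup>2 + (L2_norm \<psi>')\<^sup>2)"
      by (simp only: mult.left_commute[of k 2] mult_le_cancel_left_pos zero_less_numeral)
  qed (rule k)
qed

lemma integral_linear_combination3:
  assumes "f \<in> L2" "g \<in> L2" "h \<in> L2" "e \<in> L2"
  shows "(LINT x|I\<pi>. (c1 * f x + c2 * g x + c3 * h x) * e x)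
    = c1 * (LINT x|I\<pi>. f x * e x) + c2 * (LINT x|I\<pi>. g x * e x) + c3 * (LINT x|I\<pi>. h x * e x)"
  using assms by (simp add: distrib_right mult.assoc L2_mult_integrable)

text \<open>Testing with a sine or cosine turns the variational equations into ordinary differential equations, since the
  coefficients of the weak derivatives are expressed by those of the functions.\<close>

lemma weak_solution_coefficients:
  assumes sol: "weak_solution C U0 u u' \<phi> \<phi>' \<psi> \<psi>'" and t: "t \<ge> 0"
  shows "((\<lambda>t. sin_coeff (u t) n) has_real_derivative sin_coeff (u' t) n) (at t within {0..})" (is ?du)
    and "((\<lambda>t. cos_coeff (\<phi> t) n) has_real_derivative cos_coeff (\<phi>' t) n) (at t within {0..})" (is ?dp)
    and "((\<lambda>t. cos_coeff (\<psi> t) n) has_real_derivative cos_coeff (\<psi>' t) n) (at t within {0..})" (is ?dq)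
    and "((\<lambda>t. c_rho C * sin_coeff (u' t) n) has_real_derivative
       - real n * (c_mu C * (real n * sin_coeff (u t) n) + c_b C * cos_coeff (\<phi> t) n + c_d C * cos_coeff (\<psi> t) n))
       (at t within {0..})" (is ?dv)
    and "((\<lambda>t. c_kappa1 C * cos_coeff (\<phi>' t) n) has_real_derivative
       - (real n)\<^sup>2 * (c_alpha C * cos_coeff (\<phi> t) n + c_beta C * cos_coeff (\<psi> t) n)
       - (c_b C * (real n * sin_coeff (u t) n) + c_alpha1 C * cos_coeff (\<phi> t) n + c_alpha3 C * cos_coeff (\<psi> t) n
         + c_tau1 C * cos_coeff (\<phi>' t) n + c_tau2 C * cos_coeff (\<psi>' t) n)) (at t within {0..})" (is ?dr)
    and "((\<lambda>t. c_kappa2 C * cos_coeff (\<psi>' t) n) has_real_derivative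
       - (real n)\<^sup>2 * (c_beta C * cos_coeff (\<phi> t) n + c_gamma C * cos_coeff (\<psi> t) n)
       - (c_d C * (real n * sin_coeff (u t) n) + c_alpha3 C * cos_coeff (\<phi> t) n + c_alpha2 C * cos_coeff (\<psi> t) n
         + c_tau3 C * cos_coeff (\<phi>' t) n + c_tau4 C * cos_coeff (\<psi>' t) n)) (at t within {0..})" (is ?ds)
proof -
  let ?s = "\<lambda>x. sin (real n * x)" and ?c = "\<lambda>x. cos (real n * x)"
  have sp: "u t \<in> H1_0" "u' t \<in> L2" "\<phi> t \<in> H1" "\<phi>' t \<in> L2" "\<psi> t \<in> H1" "\<psi>' t \<in> L2" if "t \<ge> 0" for t
    using sol that unfolding weak_solution_def by (auto simp: energy_space_def L2_star_def H1_star_def)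
  have u1: "u t \<in> H1" if "t \<ge> 0" for t using sp(1)[OF that] by (simp add: H1_0_def)
  note L = sp(2,4,6) u1[THEN H1_in_L2] sp(3,5)[THEN H1_in_L2]
  note D = u1[OF t, THEN wderiv_properties(1)] sp(3,5)[OF t, THEN wderiv_properties(1)]
  note Lt = L[OF t]
  show ?du
    ?dp
    ?dq
    using sol L t unfolding weak_solution_def
    by (auto intro!: time_deriv_coefficient sin_multiple_in_L2 cos_multiple_in_L2)
  \<comment> \<open>Ten conditions on regularity and time derivatives precede the variational equations.\<close>
  note equations = sol[unfolded weak_solution_def, THEN conjunct2, THEN conjunct2, THEN conjunct2, THEN conjunct2, THEN conjunct2, THEN conjunct2, THEN conjunct2, THEN conjunct2, THEN conjunct2, THEN conjunct2]
  note weak_form = equations[THEN conjunct1] equations[THEN conjunct2, THEN conjunct1]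
    equations[THEN conjunct2, THEN conjunct2, THEN conjunct1]
  have weak_u: "((\<lambda>s. LINT x|I\<pi>. c_rho C * u' s x * ?s x) has_real_derivative
      - (LINT x|I\<pi>. (c_mu C * wderiv (u t) x + c_b C * \<phi> t x + c_d C * \<psi> t x) * wderiv ?s x)) (at t within {0..})"
    by (rule weak_form(1)[rule_format, OF sin_in_H1_0 t])
  have weak_\<phi>: "((\<lambda>s. LINT x|I\<pi>. c_kappa1 C * \<phi>' s x * ?c x) has_real_derivative
      - (LINT x|I\<pi>. (c_alpha C * wderiv (\<phi> t) x + c_beta C * wderiv (\<psi> t) x) * wderiv ?c x)
      - (LINT x|I\<pi>. (c_b C * wderiv (u t) x + c_alpha1 C * \<phi> t x + c_alpha3 C * \<psi> t x
                    + c_tau1 C * \<phi>' t x + c_tau2 C * \<psi>' t x) * ?c x)) (at t within {0..})"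
    by (rule weak_form(2)[rule_format, OF cos_in_H1 t])
  have weak_\<psi>: "((\<lambda>s. LINT x|I\<pi>. c_kappa2 C * \<psi>' s x * ?c x) has_real_derivative
      - (LINT x|I\<pi>. (c_beta C * wderiv (\<phi> t) x + c_gamma C * wderiv (\<psi> t) x) * wderiv ?c x)
      - (LINT x|I\<pi>. (c_d C * wderiv (u t) x + c_alpha3 C * \<phi> t x + c_alpha2 C * \<psi> t x
                    + c_tau3 C * \<phi>' t x + c_tau4 C * \<psi>' t x) * ?c x)) (at t within {0..})"
    by (rule weak_form(3)[rule_format, OF cos_in_H1 t])
  have stress_u: "(LINT x|I\<pi>. (c1 * wderiv (u t) x + c2 * \<phi> t x + c3 * \<psi> t x) * wderiv ?s x)
      = real n * (c1 * (real n * sin_coeff (u t) n) + c2 * cos_coeff (\<phi> t) n + c3 * cos_coeff (\<psi> t) n)" for c1 c2 c3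
  proof -
    have "(LINT x|I\<pi>. (c1 * wderiv (u t) x + c2 * \<phi> t x + c3 * \<psi> t x) * wderiv ?s x)
      = (LINT x|I\<pi>. (c1 * wderiv (u t) x + c2 * \<phi> t x + c3 * \<psi> t x) * (real n * ?c x))"
      by (intro integral_mult_AE_cong wderiv_properties(1) sin_in_H1 L2_cmult cos_multiple_in_L2 L2_add D Lt wderiv_sin)
    also have "\<dots> = real n * (LINT x|I\<pi>. (c1 * wderiv (u t) x + c2 * \<phi> t x + c3 * \<psi> t x) * ?c x)"
      by (simp add: mult.left_commute[of _ "real n"])
    also have "(LINT x|I\<pi>. (c1 * wderiv (u t) x + c2 * \<phi> t x + c3 * \<psi> t x) * ?c x)
      = c1 * (real n * sin_coeff (u t) n) + c2 * cos_coeff (\<phi> t) n + c3 * cos_coeff (\<psi> t) n"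
      unfolding cosine_coefficient_wderiv[OF sp(1)[OF t], symmetric]
      by (intro integral_linear_combination3 D Lt cos_multiple_in_L2)
    finally show ?thesis .
  qed
  have stress: "(LINT x|I\<pi>. (c1 * wderiv (\<phi> t) x + c2 * wderiv (\<psi> t) x) * wderiv ?c x)
      = (real n)\<^sup>2 * (c1 * cos_coeff (\<phi> t) n + c2 * cos_coeff (\<psi> t) n)" for c1 c2
  proof -
    have "(LINT x|I\<pi>. (c1 * wderiv (\<phi> t) x + c2 * wderiv (\<psi> t) x) * wderiv ?c x)
      = (LINT x|I\<pi>. (c1 * wderiv (\<phi> t) x + c2 * wderiv (\<psi> t) x) * (- real n * ?s x))"
      by (intro integral_mult_AE_cong wderiv_properties(1) cos_in_H1 L2_cmult sin_multiple_in_L2 L2_add D wderiv_cos)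
    also have "\<dots> = - real n * (LINT x|I\<pi>. (c1 * wderiv (\<phi> t) x + c2 * wderiv (\<psi> t) x + 0 * wderiv (\<psi> t) x) * ?s x)"
      by (simp add: mult.left_commute[of _ "real n"])
    also have "\<dots> = - real n * (c1 * sin_coeff (wderiv (\<phi> t)) n + c2 * sin_coeff (wderiv (\<psi> t)) n)"
      by (subst integral_linear_combination3) (simp_all add: D sin_multiple_in_L2)
    also have "\<dots> = (real n)\<^sup>2 * (c1 * cos_coeff (\<phi> t) n + c2 * cos_coeff (\<psi> t) n)"
      unfolding sine_coefficient_wderiv[OF sp(3)[OF t]] sine_coefficient_wderiv[OF sp(5)[OF t]]
      by (simp add: power2_eq_square algebra_simps)
    finally show ?thesis .
  qed
  have force: "(LINT x|I\<pi>. (c1 * wderiv (u t) x + c2 * \<phi> t x + c3 * \<psi> t x + c4 * \<phi>' t x + c5 * \<psi>' t x) * ?c x)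
      = c1 * (real n * sin_coeff (u t) n) + c2 * cos_coeff (\<phi> t) n + c3 * cos_coeff (\<psi> t) n
        + c4 * cos_coeff (\<phi>' t) n + c5 * cos_coeff (\<psi>' t) n" for c1 c2 c3 c4 c5
  proof -
    have split: "(LINT x|I\<pi>. (f x + c4 * \<phi>' t x + c5 * \<psi>' t x) * ?c x)
      = (LINT x|I\<pi>. f x * ?c x) + c4 * cos_coeff (\<phi>' t) n + c5 * cos_coeff (\<psi>' t) n" if "f \<in> L2" for f
      using integral_linear_combination3[OF that Lt(2,3) cos_multiple_in_L2, of 1 c4 c5 "real n"] by simp
    have sum: "(LINT x|I\<pi>. (c1 * wderiv (u t) x + c2 * \<phi> t x + c3 * \<psi> t x) * ?c x)
      = c1 * cos_coeff (wderiv (u t)) n + c2 * cos_coeff (\<phi> t) n + c3 * cos_coeff (\<psi> t) n"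
      by (intro integral_linear_combination3 D Lt cos_multiple_in_L2)
    have "(\<lambda>x. c1 * wderiv (u t) x + c2 * \<phi> t x + c3 * \<psi> t x) \<in> L2" by (intro L2_add L2_cmult D Lt)
    from split[OF this] show ?thesis
      unfolding sum cosine_coefficient_wderiv[OF sp(1)[OF t]] .
  qed
  show ?dv
    using weak_u unfolding stress_u mult.assoc by simp
  show ?dr
    using weak_\<phi> unfolding stress force mult.assoc by simp
  show ?ds
    using weak_\<psi> unfolding stress force mult.assoc by simp
qed

theorem theorem4:
  fixes C :: coefficients
    and U0 :: state
    and u u' \<phi> \<phi>' \<psi> \<psi>' :: "real \<Rightarrow> real \<Rightarrow> real"
  assumes "admissible C"
    and "U0 \<in> energy_space"
    and "weak_solution C U0 u u' \<phi> \<phi>' \<psi> \<psi>'"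
    and "chi0 C = 0"
    and "chi1 C \<noteq> 0"
  shows "\<exists>lam xi :: real. lam > 0 \<and> xi > 0 \<and>
           (\<forall>t\<ge>0. energy C (u t, u' t, \<phi> t, \<phi>' t, \<psi> t, \<psi>' t) \<le> lam * exp (- xi * t))"
proof -
  note adm = \<open>admissible C\<close>[unfolded admissible_def]
  obtain c0 where c0: "c0 > 0" "\<And>x. c0 * (norm x)\<^sup>2 \<le> x \<bullet> (coefficient_matrix C *v x)"
    using positive_definite_coercive adm by blast
  obtain \<delta> where \<delta>: "\<delta> > 0" "\<And>r s. \<delta> * (r\<^sup>2 + s\<^sup>2)
      \<le> c_tau1 C * r\<^sup>2 + (c_tau2 C + c_tau3 C) * r * s + c_tau4 C * s\<^sup>2"
    using damping_coercive adm by blast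
  interpret modal_system "c_rho C" "c_kappa1 C" "c_kappa2 C" "c_mu C" "c_alpha C" "c_gamma C" "c_beta C"
    "c_b C" "c_d C" "c_alpha1 C" "c_alpha2 C" "c_alpha3 C" "c_tau1 C" "c_tau2 C" "c_tau3 C" "c_tau4 C" c0 \<delta>
  proof
    fix X p q P Q :: real
    have "(norm (vector [X, p, q, P, Q] :: real ^ 5))\<^sup>2 = X\<^sup>2 + p\<^sup>2 + q\<^sup>2 + P\<^sup>2 + Q\<^sup>2"
      by (simp add: power2_norm_eq_inner inner_vec_def sum_5 vector_5 flip: power2_eq_square)
    then show "c0 * (X\<^sup>2 + p\<^sup>2 + q\<^sup>2 + P\<^sup>2 + Q\<^sup>2)
      \<le> c_mu C * X\<^sup>2 + 2 * X * (c_b C * p + c_d C * q)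
        + (c_alpha1 C * p\<^sup>2 + 2 * c_alpha3 C * p * q + c_alpha2 C * q\<^sup>2)
        + (c_alpha C * P\<^sup>2 + 2 * c_beta C * P * Q + c_gamma C * Q\<^sup>2)"
      using c0(2)[of "vector [X, p, q, P, Q]"] unfolding coefficient_matrix_form by simp
  qed (use adm c0 \<delta> in auto)
  obtain M \<xi> where M: "M \<ge> 0" "\<xi> > 0" and decay: "\<And>n :: nat. n \<ge> 1 \<Longrightarrow> mode_decays (real n) M \<xi>"
    using uniform_mode_decay assms(4,5) unfolding chi0_def chi1_def by blast
  obtain K where K: "K \<ge> 0" and energy_le: "\<And>u u' \<phi> \<phi>' \<psi> \<psi>'. (u, u', \<phi>, \<phi>', \<psi>, \<psi>') \<in> energy_space \<Longrightarrow>
    energy C (u, u', \<phi>, \<phi>', \<psi>, \<psi>') \<le> K * ((L2_norm (wderiv u))\<^sup>2 + (L2_norm u')\<^sup>2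
      + (L2_norm (wderiv \<phi>))\<^sup>2 + (L2_norm (wderiv \<psi>))\<^sup>2 + (L2_norm \<phi>')\<^sup>2 + (L2_norm \<psi>')\<^sup>2)"
    using energy_le_gradient_norms by blast
  define T where "T t = (L2_norm (wderiv (u t)))\<^sup>2 + (L2_norm (u' t))\<^sup>2 + (L2_norm (wderiv (\<phi> t)))\<^sup>2
    + (L2_norm (wderiv (\<psi> t)))\<^sup>2 + (L2_norm (\<phi>' t))\<^sup>2 + (L2_norm (\<psi>' t))\<^sup>2" for t
  define S where "S t n = mode_size (real n) (sin_coeff (u t) n) (sin_coeff (u' t) n)
    (cos_coeff (\<phi> t) n) (cos_coeff (\<phi>' t) n) (cos_coeff (\<psi> t) n) (cos_coeff (\<psi>' t) n)" for t and n :: nat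
  have space: "(u t, u' t, \<phi> t, \<phi>' t, \<psi> t, \<psi>' t) \<in> energy_space" if "t \<ge> 0" for t
    using assms(3) that by (simp add: weak_solution_def)
  have modes: "(\<lambda>n. S t (Suc n) * (2 / pi)) sums T t" if "t \<ge> 0" for t
  proof -
    have H: "u t \<in> H1_0" "u' t \<in> L2" "\<phi> t \<in> H1" "\<phi>' t \<in> L2" "\<psi> t \<in> H1" "\<psi>' t \<in> L2"
      "cos_coeff (\<phi>' t) 0 = 0" "cos_coeff (\<psi>' t) 0 = 0"
      using space[OF that] by (auto simp: energy_space_def H1_star_def L2_star_def)
    then have H1: "u t \<in> H1" by (simp add: H1_0_def)
    have u0: "cos_coeff (wderiv (u t)) 0 = 0" using cosine_coefficient_wderiv[OF H(1), of 0] by simp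
    note W = wderiv_properties(1)
    have "(\<lambda>n. (cos_coeff (wderiv (u t)) (Suc n))\<^sup>2 * (2 / pi) + (sin_coeff (u' t) (Suc n))\<^sup>2 * (2 / pi)
      + (sin_coeff (wderiv (\<phi> t)) (Suc n))\<^sup>2 * (2 / pi) + (sin_coeff (wderiv (\<psi> t)) (Suc n))\<^sup>2 * (2 / pi)
      + (cos_coeff (\<phi>' t) (Suc n))\<^sup>2 * (2 / pi) + (cos_coeff (\<psi>' t) (Suc n))\<^sup>2 * (2 / pi)) sums T t"
      unfolding T_def
      by (intro sums_add Parseval_cos_coeff Parseval_sin_coeff W H H1 u0)
    then show ?thesis
      unfolding cosine_coefficient_wderiv[OF H(1)] sine_coefficient_wderiv[OF H(3)] sine_coefficient_wderiv[OF H(5)]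
      by (simp add: S_def mode_size_def power_mult_distrib distrib_right distrib_left add_divide_distrib add_ac del: of_nat_Suc)
  qed
  have mode_decay: "S t (Suc n) \<le> M * S 0 (Suc n) * exp (- \<xi> * t)" if "t \<ge> 0" for t n
  proof -
    have "mode_solution (real (Suc n)) (\<lambda>t. sin_coeff (u t) (Suc n)) (\<lambda>t. sin_coeff (u' t) (Suc n))
      (\<lambda>t. cos_coeff (\<phi> t) (Suc n)) (\<lambda>t. cos_coeff (\<phi>' t) (Suc n))
      (\<lambda>t. cos_coeff (\<psi> t) (Suc n)) (\<lambda>t. cos_coeff (\<psi>' t) (Suc n))"
      unfolding mode_solution_def
      by (intro allI impI conjI weak_solution_coefficients[OF assms(3)])
    from decay[of "Suc n", unfolded mode_decays_def, rule_format, OF _ this that]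
    show ?thesis by (simp add: S_def del: of_nat_Suc)
  qed
  have T_decay: "T t \<le> M * exp (- \<xi> * t) * T 0" if "t \<ge> 0" for t
  proof (rule sums_le[OF _ modes[OF that] sums_mult[OF modes[of 0]]])
    fix n
    show "S t (Suc n) * (2 / pi) \<le> M * exp (- \<xi> * t) * (S 0 (Suc n) * (2 / pi))"
      using mult_right_mono[OF mode_decay[OF that, of n], of "2 / pi"] by (simp add: mult_ac)
  qed simp
  have T0: "T 0 \<ge> 0" by (simp add: T_def)
  show ?thesis
  proof (intro exI conjI allI impI)
    \<comment> \<open>The summand \<open>1\<close> keeps the constant positive for the zero solution.\<close>
    show "K * M * T 0 + 1 > 0" using K M T0 by (simp add: add_nonneg_pos)
    show "\<xi> > 0" by (rule M)
    fix t :: real assume t: "t \<ge> 0"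
    have "energy C (u t, u' t, \<phi> t, \<phi>' t, \<psi> t, \<psi>' t) \<le> K * T t"
      unfolding T_def by (rule energy_le[OF space[OF t]])
    also have "\<dots> \<le> K * (M * exp (- \<xi> * t) * T 0)" by (rule mult_left_mono[OF T_decay[OF t] K])
    also have "\<dots> \<le> (K * M * T 0 + 1) * exp (- \<xi> * t)" by (simp add: algebra_simps)
    finally show "energy C (u t, u' t, \<phi> t, \<phi>' t, \<psi> t, \<psi>' t) \<le> (K * M * T 0 + 1) * exp (- \<xi> * t)" .
  qed
qed

end
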